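(* Let $(\xi,\eta),(\xi',\eta')\in L^2_{\mathcal F}(T,T+u)\times L^2_{\mathcal F}(T,T+u;\mathbf R^d)$ with $\xi_T,\xi'_T\in L^2(\mathcal F_T)$, and let $\varphi,\varphi'\in L^2_{\mathcal F}(0,T;\mathbf R)$. Let $$g:\Omega\times[0,T]\times\overline L^2_{\mathcal F}(-l,T+u)\times\overline L^2_{\mathcal F}(-l,T+u;\mathbf R^d)\to\mathbf R$$ be such that $(g(t,\mathbf Y,\mathbf Z))_{t\in[0,T]}$ is progressively measurable for each $(\mathbf Y,\mathbf Z)$, $g(\cdot,\mathbf 0,\mathbf 0)\in L^2_{\mathcal F}(0,T)$, and, for some constant $K>0$ and some probability measure $\lambda$ on $[-l,u]$, for each $t\in[0,T]$ and all $(\mathbf y,\mathbf z),(\tilde{\mathbf y},\tilde{\mathbf z})$ in the domain, $$|g(t,\mathbf y,\mathbf z)-g(t,\tilde{\mathbf y},\tilde{\mathbf z})|\le K\,E\Big[\int_{-l}^u\big(|y_{t+r}-\tilde y_{t+r}|+|z_{t+r}-\tilde z_{t+r}|\big)\lambda(dr)\,\Big|\,\mathcal F_t\Big].$$ Let $f(t,\cdot,\cdot):=g(t,\cdot,\cdot)+\varphi_t$ and $f'(t,\cdot,\cdot):=g(t,\cdot,\cdot)+\varphi'_t$. Suppose there exists a constant $\beta\ge2$ such that $\frac{8K^2e^{\beta l}}{\beta}\le1$. Let $(\mathbf Y,\mathbf Z)$ be the solution of the BSDE with coefficient $f$ and terminal data $(\xi,\eta)$, and $(\mathbf Y',\mathbf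 Z')$ the solution of the BSDE with coefficient $f'$ and terminal data $(\xi',\eta')$. Then for each $t\in[0,T]$, $$|Y_t-Y'_t|^2+E\Big[\int_t^T\big(|Y_s-Y'_s|^2+|Z_s-Z'_s|^2\big)ds\,\Big|\,\mathcal F_t\Big]$$ $$\le C\,E\Big[|\xi_T-\xi'_T|^2+\int_t^T|\varphi_s-\varphi'_s|^2ds+\int_T^{T+u}\big(|\xi_s-\xi'_s|^2+|\eta_s-\eta'_s|^2\big)ds\,\Big|\,\mathcal F_t\Big]+C\int_{t-l}^t\big(|Y_s-Y'_s|^2+|Z_s-Z'_s|^2\big)ds,$$ where $C>0$ is a constant depending only on $K$ and $l$ (the constants $T$ and $u$ being fixed throughout).
   Context: $(\Omega,\mathcal F,P)$ is a complete probability space with a $d$-dimensional standard Brownian motion $(B_t)_{t\ge0}$; $(\mathcal F_t)_{t\ge0}$ is its natural filtration augmented by the $P$-null sets. $T>0$, $l\ge0$, $u\ge0$ are given constants, fixed once and for all. $|\cdot|$ is the Euclidean norm. Spaces (when $d=1$, the target $\mathbf R^d$ is omitted from the notation): - $L^2(\mathcal F_t;\mathbf R^d)$: $\mathcal F_t$-measurable $\mathbf R^d$-valued random variables $\xi$ with $E|\xi|^2<\infty$. - $L^2_{\mathcal F}(a,b;\mathbf R^d)$ ($0\le a\le b$): $\mathbf R^d$-valued progressively measurable processes $\psi$ on $[a,b]$ with $E\int_a^b|\psi_r|^2dr<\infty$. - $\mathcal S^2_{\mathcal F}(a,b;\mathbf R^d)$: continuous processes in $L^2_{\mathcal F}(a,b;\mathbf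 R^d)$ with $E[\sup_{r\in[a,b]}|\psi_r|^2]<\infty$. - $\overline L^2_{\mathcal F}(-s,t;\mathbf R^d)$ ($s\ge0$): processes $\psi$ on $[-s,t]$ such that $(\psi_r)_{r\in[0,t]}\in L^2_{\mathcal F}(0,t;\mathbf R^d)$ and $(\psi_r)_{r\in[-s,0]}$ is a (deterministic) Lebesgue measurable function with $\int_{-s}^0|\psi_r|^2dr<\infty$. Boldface $\mathbf X$ denotes the whole process $\{X_r\}_{-l\le r\le T+u}$. The BSDE with coefficient $f$ and terminal data $(\xi,\eta)$ is $$Y_t=\xi_T+\int_t^Tf(s,\mathbf Y,\mathbf Z)\,ds-\int_t^TZ_s\,dB_s,\ t\in[0,T);\quad (Y_t,Z_t)=(\xi_t,\eta_t),\ t\in[T,T+u];\quad (Y_t,Z_t)=(Y_0,0),\ t\in[-l,0).$$ A solution is a pair $(\mathbf Y,\mathbf Z)$ satisfying it with $(Y_t,Z_t)_{t\in[0,T]}\in\mathcal S^2_{\mathcal F}(0,T)\times L^2_{\mathcal F}(0,T;\mathbf R^d)$. *)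

theory Defs
  imports "HOL-Probability.Probability"
begin

text \<open>
  Processes are total functions of time and sample point; only their values on the time interval
  under consideration matter. Vectors of dimension d are elements of \<open>real ^ 'd\<close>.
\<close>

text \<open>
  The density below is that of d independent centred normal variables of variance \<open>t - s\<close>.
\<close>

definition brownian_motion :: "'a measure \<Rightarrow> (real \<Rightarrow> 'a \<Rightarrow> real ^ 'd) \<Rightarrow> bool" where
  "brownian_motion M B \<longleftrightarrow>
     (\<forall>t\<ge>0. B t \<in> borel_measurable M) \<and>
     (AE \<omega> in M. B 0 \<omega> = 0) \<and>
     (\<forall>(\<tau>::nat \<Rightarrow> real) n. 0 \<le> \<tau> 0 \<and> mono \<tau> \<longrightarrow>
        prob_space.indep_vars M (\<lambda>_. borel) (\<lambda>i \<omega>. B (\<tau> (Suc i)) \<omega> - B (\<tau> i) \<omega>) {..<n}) \<and>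
     (\<forall>s t. 0 \<le> s \<and> s < t \<longrightarrow>
        distributed M lborel (\<lambda>\<omega>. B t \<omega> - B s \<omega>)
          (\<lambda>x. ennreal (\<Prod>i\<in>UNIV. normal_density 0 (sqrt (t - s)) (x $ i)))) \<and>
     (AE \<omega> in M. continuous_on {0..} (\<lambda>t. B t \<omega>))"

definition brownian_filtration ::
    "'a measure \<Rightarrow> (real \<Rightarrow> 'a \<Rightarrow> real ^ 'd) \<Rightarrow> real \<Rightarrow> 'a measure" where
  "brownian_filtration M B t =
     sigma (space M)
       ((\<Union>s\<in>{0..t}. {B s -` A \<inter> space M | A. A \<in> sets borel}) \<union> null_sets M)"

definition prog_measurable ::
    "'a measure \<Rightarrow> (real \<Rightarrow> 'a \<Rightarrow> real ^ 'd) \<Rightarrow> real \<Rightarrow> real \<Rightarrow>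
     (real \<Rightarrow> 'a \<Rightarrow> 'b::euclidean_space) \<Rightarrow> bool" where
  "prog_measurable M B a b \<psi> \<longleftrightarrow>
     (\<forall>t\<in>{a..b}. (\<lambda>(r, \<omega>). \<psi> r \<omega>) \<in>
        borel_measurable (restrict_space borel {a..t} \<Otimes>\<^sub>M brownian_filtration M B t))"

definition L2_rv :: "'a measure \<Rightarrow> (real \<Rightarrow> 'a \<Rightarrow> real ^ 'd) \<Rightarrow> real \<Rightarrow>
    ('a \<Rightarrow> 'b::euclidean_space) set" where
  "L2_rv M B t =
     {\<xi>. \<xi> \<in> borel_measurable (brownian_filtration M B t) \<and>
         (\<integral>\<^sup>+\<omega>. ennreal ((norm (\<xi> \<omega>))\<^sup>2) \<partial>M) < \<infinity>}"

definition L2_process :: "'a measure \<Rightarrow> (real \<Rightarrow> 'a \<Rightarrow> real ^ 'd) \<Rightarrow> real \<Rightarrow> real \<Rightarrow>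
    (real \<Rightarrow> 'a \<Rightarrow> 'b::euclidean_space) set" where
  "L2_process M B a b =
     {\<psi>. prog_measurable M B a b \<psi> \<and>
         (\<integral>\<^sup>+\<omega>. (\<integral>\<^sup>+r\<in>{a..b}. ennreal ((norm (\<psi> r \<omega>))\<^sup>2) \<partial>lborel) \<partial>M) < \<infinity>}"

definition S2_process :: "'a measure \<Rightarrow> (real \<Rightarrow> 'a \<Rightarrow> real ^ 'd) \<Rightarrow> real \<Rightarrow> real \<Rightarrow>
    (real \<Rightarrow> 'a \<Rightarrow> 'b::euclidean_space) set" where
  "S2_process M B a b =
     {\<psi>. \<psi> \<in> L2_process M B a b \<and>
         (AE \<omega> in M. continuous_on {a..b} (\<lambda>r. \<psi> r \<omega>)) \<and>
         (\<integral>\<^sup>+\<omega>. (SUP r\<in>{a..b}. ennreal ((norm (\<psi> r \<omega>))\<^sup>2)) \<partial>M) < \<infinity>}"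

text \<open>
  Processes on \<open>[-s, t]\<close> whose part on \<open>[-s, 0]\<close> is deterministic. Deterministic means equal to a
  fixed function almost surely: a solution of the BSDE equals \<open>Y 0\<close> on \<open>[-l, 0)\<close>, which is
  measurable for the augmented \<open>\<sigma>\<close>-algebra at time 0 and hence constant only up to a null set.
\<close>

definition L2_bar :: "'a measure \<Rightarrow> (real \<Rightarrow> 'a \<Rightarrow> real ^ 'd) \<Rightarrow> real \<Rightarrow> real \<Rightarrow>
    (real \<Rightarrow> 'a \<Rightarrow> 'b::euclidean_space) set" where
  "L2_bar M B s t =
     {\<psi>. \<psi> \<in> L2_process M B 0 t \<and>
         (\<exists>h. h \<in> borel_measurable (lebesgue_on {-s..0}) \<and>
              (\<integral>\<^sup>+r. ennreal ((norm (h r))\<^sup>2) \<partial>lebesgue_on {-s..0}) < \<infinity> \<and>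
              (AE \<omega> in M. \<forall>r\<in>{-s..0}. \<psi> r \<omega> = h r))}"

text \<open>
  The Ito integral over \<open>[a, b]\<close>: the mean-square limit of the elementary integrals of simple
  integrands \<open>\<Sum>i<n. H i * 1_(\<tau> i, \<tau> (Suc i)]\<close> that approximate the integrand in mean square. The
  relation determines the integral almost surely.
\<close>

definition simple_integrand :: "'a measure \<Rightarrow> (real \<Rightarrow> 'a \<Rightarrow> real ^ 'd) \<Rightarrow> real \<Rightarrow> real \<Rightarrow>
    nat \<Rightarrow> (nat \<Rightarrow> real) \<Rightarrow> (nat \<Rightarrow> 'a \<Rightarrow> real ^ 'd) \<Rightarrow> bool" where
  "simple_integrand M B a b n \<tau> H \<longleftrightarrow>
     \<tau> 0 = a \<and> \<tau> n = b \<and> (\<forall>i<n. \<tau> i \<le> \<tau> (Suc i)) \<and>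
     (\<forall>i<n. H i \<in> borel_measurable (brownian_filtration M B (\<tau> i)) \<and>
            (\<exists>c. \<forall>\<omega>\<in>space M. norm (H i \<omega>) \<le> c))"

definition simple_process :: "nat \<Rightarrow> (nat \<Rightarrow> real) \<Rightarrow> (nat \<Rightarrow> 'a \<Rightarrow> real ^ 'd) \<Rightarrow>
    real \<Rightarrow> 'a \<Rightarrow> real ^ 'd" where
  "simple_process n \<tau> H s \<omega> =
     (\<Sum>i<n. indicator {\<tau> i<..\<tau> (Suc i)} s *\<^sub>R H i \<omega>)"

definition simple_integral :: "(real \<Rightarrow> 'a \<Rightarrow> real ^ 'd) \<Rightarrow> nat \<Rightarrow> (nat \<Rightarrow> real) \<Rightarrow>
    (nat \<Rightarrow> 'a \<Rightarrow> real ^ 'd) \<Rightarrow> 'a \<Rightarrow> real" where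
  "simple_integral B n \<tau> H \<omega> = (\<Sum>i<n. H i \<omega> \<bullet> (B (\<tau> (Suc i)) \<omega> - B (\<tau> i) \<omega>))"

definition has_ito_integral :: "'a measure \<Rightarrow> (real \<Rightarrow> 'a \<Rightarrow> real ^ 'd) \<Rightarrow> real \<Rightarrow> real \<Rightarrow>
    (real \<Rightarrow> 'a \<Rightarrow> real ^ 'd) \<Rightarrow> ('a \<Rightarrow> real) \<Rightarrow> bool" where
  "has_ito_integral M B a b Z I \<longleftrightarrow>
     I \<in> borel_measurable M \<and>
     (\<exists>n \<tau> H.
        (\<forall>k::nat. simple_integrand M B a b (n k) (\<tau> k) (H k)) \<and>
        (\<lambda>k. \<integral>\<^sup>+\<omega>. (\<integral>\<^sup>+s\<in>{a..b}.
            ennreal ((norm (simple_process (n k) (\<tau> k) (H k) s \<omega> - Z s \<omega>))\<^sup>2) \<partial>lborel) \<partial>M)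
          \<longlonglongrightarrow> 0 \<and>
        (\<lambda>k. \<integral>\<^sup>+\<omega>. ennreal ((simple_integral B (n k) (\<tau> k) (H k) \<omega> - I \<omega>)\<^sup>2) \<partial>M)
          \<longlonglongrightarrow> 0)"

text \<open>
  Coefficients have type \<open>time \<Rightarrow> process \<Rightarrow> process \<Rightarrow> sample point \<Rightarrow> real\<close> and are only
  meaningful on \<open>L2_bar\<close>, so a solution is required to lie there. The equation and the boundary
  conditions hold almost surely for each time.
\<close>

definition bsde_solution :: "'a measure \<Rightarrow> (real \<Rightarrow> 'a \<Rightarrow> real ^ 'd) \<Rightarrow>
    real \<Rightarrow> real \<Rightarrow> real \<Rightarrow>
    (real \<Rightarrow> (real \<Rightarrow> 'a \<Rightarrow> real) \<Rightarrow> (real \<Rightarrow> 'a \<Rightarrow> real ^ 'd) \<Rightarrow> 'a \<Rightarrow> real) \<Rightarrow>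
    (real \<Rightarrow> 'a \<Rightarrow> real) \<Rightarrow> (real \<Rightarrow> 'a \<Rightarrow> real ^ 'd) \<Rightarrow>
    (real \<Rightarrow> 'a \<Rightarrow> real) \<Rightarrow> (real \<Rightarrow> 'a \<Rightarrow> real ^ 'd) \<Rightarrow> bool" where
  "bsde_solution M B T l u f \<xi> \<eta> Y Z \<longleftrightarrow>
     Y \<in> L2_bar M B l (T + u) \<and> Z \<in> L2_bar M B l (T + u) \<and>
     Y \<in> S2_process M B 0 T \<and> Z \<in> L2_process M B 0 T \<and>
     (\<forall>t\<in>{0..<T}. \<exists>I. has_ito_integral M B t T Z I \<and>
        (AE \<omega> in M. Y t \<omega> = \<xi> T \<omega> + (LINT s:{t..T}|lborel. f s Y Z \<omega>) - I \<omega>)) \<and>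
     (\<forall>t\<in>{T..T + u}. AE \<omega> in M. Y t \<omega> = \<xi> t \<omega> \<and> Z t \<omega> = \<eta> t \<omega>) \<and>
     (\<forall>t\<in>{-l..<0}. AE \<omega> in M. Y t \<omega> = Y 0 \<omega> \<and> Z t \<omega> = 0)"

text \<open>
  A Lebesgue measurable initial segment need not be measurable for an arbitrary Borel measure
  \<open>\<lambda>\<close>; this predicate says that the integral of \<open>r \<mapsto> y (t + r)\<close> against \<open>\<lambda>\<close> makes sense.
\<close>

definition shift_measurable :: "'a measure \<Rightarrow> real measure \<Rightarrow> real \<Rightarrow>
    (real \<Rightarrow> 'a \<Rightarrow> 'b::euclidean_space) \<Rightarrow> bool" where
  "shift_measurable M lam t y \<longleftrightarrow> (AE \<omega> in M. (\<lambda>r. y (t + r) \<omega>) \<in> borel_measurable lam)"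

text \<open>
  \<open>lam\<close> is a measure on \<open>[-l, u]\<close>. The conditional expectation is that of nonnegative extended
  variables, because for a fixed \<open>t\<close> the inner integral need not be integrable.
\<close>

definition lipschitz_coefficient :: "'a measure \<Rightarrow> (real \<Rightarrow> 'a \<Rightarrow> real ^ 'd) \<Rightarrow>
    real \<Rightarrow> real \<Rightarrow> real \<Rightarrow> real \<Rightarrow> real measure \<Rightarrow>
    (real \<Rightarrow> (real \<Rightarrow> 'a \<Rightarrow> real) \<Rightarrow> (real \<Rightarrow> 'a \<Rightarrow> real ^ 'd) \<Rightarrow> 'a \<Rightarrow> real) \<Rightarrow> bool" where
  "lipschitz_coefficient M B T l u K lam g \<longleftrightarrow>
     (\<forall>t\<in>{0..T}.
        \<forall>y\<in>L2_bar M B l (T + u). \<forall>z\<in>L2_bar M B l (T + u).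
        \<forall>y'\<in>L2_bar M B l (T + u). \<forall>z'\<in>L2_bar M B l (T + u).
          shift_measurable M lam t y \<longrightarrow> shift_measurable M lam t z \<longrightarrow>
          shift_measurable M lam t y' \<longrightarrow> shift_measurable M lam t z' \<longrightarrow>
          (AE \<omega> in M. ennreal \<bar>g t y z \<omega> - g t y' z' \<omega>\<bar> \<le>
             ennreal K * nn_cond_exp M (brownian_filtration M B t)
               (\<lambda>\<omega>. \<integral>\<^sup>+r. ennreal (\<bar>y (t + r) \<omega> - y' (t + r) \<omega>\<bar> +
                                 norm (z (t + r) \<omega> - z' (t + r) \<omega>)) \<partial>lam) \<omega>))"

end

theory Submission
  imports Defs
begin

text \<open>
  Put \<open>U = Y - Y'\<close> and \<open>V = Z - Z'\<close>, and let \<open>G\<close> be the difference of \<open>g\<close> along the two solutions.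
  The estimate is a weighted energy estimate: the equation for \<open>U\<close> gives, for the weight
  \<open>exp (\<beta> * s)\<close> and conditionally on the past of \<open>t\<close>, an equality between the energy of \<open>(U, V)\<close>
  over \<open>[t, T]\<close> and the terminal value plus the integral of \<open>2 * U * (G + \<phi> - \<phi>')\<close>. The Lipschitz
  condition bounds \<open>G\<^sup>2\<close> by the same energy over the longer window \<open>[t - l, T + u]\<close>, with the factor
  \<open>2 * K\<^sup>2 * exp (\<beta> * l)\<close>. The smallness condition makes this small enough for the part over
  \<open>[t, T]\<close> to be absorbed; what remains is the past over \<open>[t - l, t]\<close> and the prescribed data over
  \<open>[T, T + u]\<close>.
  
  The Ito formula is avoided. The equation at time \<open>s\<close> reads \<open>U s + J s = \<Xi> + \<Phi> s\<close>, where \<open>J s\<close> is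
  the stochastic integral of \<open>V\<close> over \<open>[s, T]\<close> and \<open>\<Phi> s\<close> is an ordinary integral over \<open>[s, T]\<close>.
  Taking second moments of both sides needs only two properties of \<open>J s\<close>: orthogonality to the past
  of \<open>s\<close> and the isometry. The square of the right-hand side is differentiated by ordinary
  calculus. This is \<open>energy_identity\<close>; the exponential weight enters through
  \<open>exponential_weight\<close>.
  
  Conditional expectations are handled by testing. Multiplying all processes by the indicator of an
  event \<open>A\<close> of the past of \<open>t\<close> preserves the equation, so every estimate is an inequality between
  integrals over \<open>A\<close>, and \<open>AE_le_of_tests\<close> returns to the conditional form. The Lipschitz condition is
  used in the same way at each time (\<open>lipschitz_mean_square\<close>).
  
  The two properties of \<open>J s\<close> come from the definition of the Ito integral as a mean-square limit. An
  increment of Brownian motion is independent of the augmented past (\<open>indep_past_increment\<close>) and has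
  Gaussian moments; hence the isometry for step integrands (\<open>elementary_isometry\<close>), which is proved for
  overlapping intervals so that it applies directly to the difference of the approximations of \<open>Z\<close>
  and \<open>Z'\<close>, and passes to the limit (\<open>ito_rep_difference\<close>).
\<close>

section \<open>The filtration and the increments of Brownian motion\<close>

lemma (in prob_space) indep_set_mono:
  "indep_set A B \<Longrightarrow> A' \<subseteq> A \<Longrightarrow> B' \<subseteq> B \<Longrightarrow> indep_set A' B'"
  unfolding indep_sets2_eq by blast

locale brownian = prob_space M for M :: "'a measure" +
  fixes B :: "real \<Rightarrow> 'a \<Rightarrow> real ^ 'd"
  assumes bm: "brownian_motion M B"
begin

abbreviation F :: "real \<Rightarrow> 'a measure" where "F \<equiv> brownian_filtration M B"

lemma B_measurable: "0 \<le> t \<Longrightarrow> B t \<in> borel_measurable M"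
  using bm by (simp add: brownian_motion_def)

lemma F_generator_sets:
  "(\<Union>s\<in>{0..t}. {B s -` A \<inter> space M | A. A \<in> sets borel}) \<union> null_sets M \<subseteq> sets M"
  using measurable_sets[OF B_measurable] by auto

lemma space_F [simp]: "space (F t) = space M"
  by (simp add: brownian_filtration_def space_measure_of_conv)

lemma sets_F: "sets (F t) = sigma_sets (space M)
    ((\<Union>s\<in>{0..t}. {B s -` A \<inter> space M | A. A \<in> sets borel}) \<union> null_sets M)"
  unfolding brownian_filtration_def
  by (rule sets_measure_of) (use F_generator_sets sets.sets_into_space in blast)

lemma sets_F_subset: "sets (F t) \<subseteq> sets M"
  unfolding sets_F by (rule sets.sigma_sets_subset[OF F_generator_sets])

lemma subalgebra_F: "subalgebra M (F t)"
  by (simp add: subalgebra_def sets_F_subset)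

lemma sets_F_mono: "s \<le> t \<Longrightarrow> sets (F s) \<subseteq> sets (F t)"
  unfolding sets_F by (rule sigma_sets_mono') force

lemma measurable_F_mono: "s \<le> t \<Longrightarrow> f \<in> measurable (F s) N \<Longrightarrow> f \<in> measurable (F t) N"
  using sets_F_mono[of s t] by (auto simp: measurable_def)

lemma measurable_F_M: "f \<in> measurable (F t) N \<Longrightarrow> f \<in> measurable M N"
  using sets_F_subset[of t] by (auto simp: measurable_def)

lemma B_measurable_F:
  assumes "0 \<le> s" "s \<le> t" shows "B s \<in> borel_measurable (F t)"
proof (rule measurableI)
  fix A :: "(real ^ 'd) set" assume "A \<in> sets borel"
  then show "B s -` A \<inter> space (F t) \<in> sets (F t)"
    unfolding sets_F space_F using assms by (intro sigma_sets.Basic) auto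
qed auto

text \<open>
  The hypotheses on Brownian motion only give joint independence of finitely many increments. Up to
  a null set the past is generated by cylinders in finitely many times, and \<open>B 0 = 0\<close> lets a cylinder
  be read off from the increments between consecutive times, so a monotone class argument extends
  the independence to the whole past.
\<close>

lemma cylinder_indep_increment:
  assumes st: "0 \<le> s" "s < t" and J: "finite J" "J \<subseteq> {0..s}"
    and A: "\<And>j. j \<in> J \<Longrightarrow> A j \<in> sets borel" and D: "D \<in> sets borel"
  defines "C \<equiv> {\<omega>\<in>space M. \<forall>j\<in>J. B j \<omega> \<in> A j}"
  defines "X \<equiv> {\<omega>\<in>space M. B t \<omega> - B s \<omega> \<in> D}"
  shows "prob (C \<inter> X) = prob C * prob X"
proof -
  define xs where "xs = 0 # sorted_list_of_set J @ [s]"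
  define n where "n = length (sorted_list_of_set J)"
  define \<tau> where "\<tau> i = (if i < length xs then xs ! i else t)" for i
  have len: "length xs = Suc (Suc n)" by (simp add: xs_def n_def nth_append)
  have sorted: "sorted xs"
    using st J by (auto simp: xs_def sorted_append)
  have set_xs: "set xs = insert 0 (insert s J)"
    using J by (auto simp: xs_def)
  have \<tau>0: "\<tau> 0 = 0" by (simp add: \<tau>_def xs_def)
  have xs_le: "x \<le> t" if "x \<in> set xs" for x
    using that set_xs st J by auto
  have mono: "mono \<tau>"
  proof (rule monoI)
    fix i j :: nat assume "i \<le> j"
    then show "\<tau> i \<le> \<tau> j"
      using sorted xs_le by (auto simp: \<tau>_def sorted_nth_mono)
  qed
  have \<tau>_pos: "0 \<le> \<tau> i" for i using mono \<tau>0 by (metis le0 monoD)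
  define \<Delta> where "\<Delta> i \<omega> = B (\<tau> (Suc i)) \<omega> - B (\<tau> i) \<omega>" for i \<omega>
  have indep: "indep_vars (\<lambda>_. borel) \<Delta> {..<Suc (Suc n)}"
    using bm mono \<tau>0 unfolding brownian_motion_def \<Delta>_def[abs_def] by simp
  have last: "\<tau> (Suc n) = s" "\<tau> (Suc (Suc n)) = t"
    by (simp_all add: \<tau>_def len) (simp add: xs_def n_def nth_append)
  have "\<exists>k\<le>Suc n. j = \<tau> k" if j: "j \<in> J" for j
  proof -
    from j obtain k where "k < length xs" "xs ! k = j"
      using set_xs by (metis in_set_conv_nth insertCI)
    then show ?thesis using len by (intro exI[of _ k]) (auto simp: \<tau>_def)
  qed
  then obtain k where k: "\<And>j. j \<in> J \<Longrightarrow> k j \<le> Suc n" "\<And>j. j \<in> J \<Longrightarrow> j = \<tau> (k j)"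
    by metis
  \<comment> \<open>Two independent blocks: the first \<open>n + 1\<close> increments lie in the past, the last is \<open>B t - B s\<close>.\<close>
  define K where "K b = (if b then {..n} else {Suc n})" for b :: bool
  have indep2: "indep_vars (\<lambda>b. PiM (K b) (\<lambda>_. borel)) (\<lambda>b \<omega>. restrict (\<lambda>i. \<Delta> i \<omega>) (K b)) UNIV"
    by (rule indep_vars_restrict[OF indep]) (auto simp: K_def disjoint_family_on_def)
  have indep3: "indep_var (PiM {..n} (\<lambda>_. borel)) (\<lambda>\<omega>. restrict (\<lambda>i. \<Delta> i \<omega>) {..n})
      (PiM {Suc n} (\<lambda>_. borel)) (\<lambda>\<omega>. restrict (\<lambda>i. \<Delta> i \<omega>) {Suc n})"
    unfolding indep_var_def
    by (rule iffD1[OF indep_vars_cong indep2]) (auto simp: K_def split: bool.split)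
  define P where "P = {f \<in> space (PiM {..n} (\<lambda>_. borel :: (real^'d) measure)).
      \<forall>j\<in>J. (\<Sum>i<k j. f i) \<in> A j}"
  define Q where "Q = {f \<in> space (PiM {Suc n} (\<lambda>_. borel :: (real^'d) measure)). f (Suc n) \<in> D}"
  have P: "P \<in> sets (PiM {..n} (\<lambda>_. borel))"
  proof -
    have [measurable]: "(\<lambda>f. \<Sum>i<k j. f i) \<in> borel_measurable (PiM {..n} (\<lambda>_. borel :: (real^'d) measure))"
      if "j \<in> J" for j
      using k(1)[OF that] by (intro borel_measurable_sum measurable_component_singleton) auto
    show ?thesis
      unfolding P_def using J(1) A by measurable
  qed
  have Q: "Q \<in> sets (PiM {Suc n} (\<lambda>_. borel))"
    unfolding Q_def using D by measurable
  have "prob ((\<lambda>\<omega>. (restrict (\<lambda>i. \<Delta> i \<omega>) {..n}, restrict (\<lambda>i. \<Delta> i \<omega>) {Suc n})) -` (P \<times> Q) \<inter> space M)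
    = prob ((\<lambda>\<omega>. restrict (\<lambda>i. \<Delta> i \<omega>) {..n}) -` P \<inter> space M)
      * prob ((\<lambda>\<omega>. restrict (\<lambda>i. \<Delta> i \<omega>) {Suc n}) -` Q \<inter> space M)"
    by (rule indep_varD[OF indep3 P Q])
  moreover have Q_X: "(\<lambda>\<omega>. restrict (\<lambda>i. \<Delta> i \<omega>) {Suc n}) -` Q \<inter> space M = X"
    by (simp add: Q_def X_def space_PiM \<Delta>_def last vimage_def Int_def conj_commute)
  moreover define C' where "C' = (\<lambda>\<omega>. restrict (\<lambda>i. \<Delta> i \<omega>) {..n}) -` P \<inter> space M"
  moreover have "(\<lambda>\<omega>. (restrict (\<lambda>i. \<Delta> i \<omega>) {..n}, restrict (\<lambda>i. \<Delta> i \<omega>) {Suc n})) -` (P \<times> Q) \<inter> space M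
     = C' \<inter> X"
    unfolding Q_X[symmetric] C'_def by blast
  ultimately have *: "prob (C' \<inter> X) = prob C' * prob X" by simp
  have B0: "AE \<omega> in M. B 0 \<omega> = 0" using bm by (simp add: brownian_motion_def)
  have eq: "AE \<omega> in M. \<omega> \<in> C' \<longleftrightarrow> \<omega> \<in> C"
    using B0
  proof eventually_elim
    case (elim \<omega>)
    have "(\<Sum>i<k j. restrict (\<lambda>i. \<Delta> i \<omega>) {..n} i) = B j \<omega>" if j: "j \<in> J" for j
    proof -
      have "(\<Sum>i<k j. restrict (\<lambda>i. \<Delta> i \<omega>) {..n} i) = (\<Sum>i<k j. \<Delta> i \<omega>)"
        using k(1)[OF j] by (intro sum.cong) auto
      also have "\<dots> = B (\<tau> (k j)) \<omega> - B (\<tau> 0) \<omega>"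
        unfolding \<Delta>_def by (rule sum_lessThan_telescope)
      finally show ?thesis using k(2)[OF j] elim \<tau>0 by simp
    qed
    then show ?case by (auto simp: C'_def C_def P_def space_PiM)
  qed
  have meas: "C \<in> sets M" "X \<in> sets M" "C' \<in> sets M"
  proof -
    have [measurable]: "B j \<in> borel_measurable M" if "j \<in> J" for j
      using that J B_measurable by auto
    show "C \<in> sets M" unfolding C_def using J(1) A by measurable
    have [measurable]: "B t \<in> borel_measurable M" "B s \<in> borel_measurable M"
      using st by (auto intro: B_measurable)
    show "X \<in> sets M" unfolding X_def using D by measurable
    show "C' \<in> sets M" unfolding C'_def
      using indep3 P by (auto simp: indep_var_eq intro: measurable_sets)
  qed
  have "prob C' = prob C" "prob (C' \<inter> X) = prob (C \<inter> X)"
    using eq meas by (auto intro!: finite_measure_eq_AE)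
  with * show ?thesis by simp
qed

lemma indep_past_increment:
  assumes st: "0 \<le> s" "s < t"
  shows "indep_set (sets (F s)) {(\<lambda>\<omega>. B t \<omega> - B s \<omega>) -` D \<inter> space M | D. D \<in> sets borel}"
proof -
  define cyl where "cyl J A = {\<omega>\<in>space M. \<forall>j\<in>J. B j \<omega> \<in> A j}" for J and A :: "real \<Rightarrow> (real^'d) set"
  define G where "G = {E \<in> sets M. \<exists>J A. finite J \<and> J \<subseteq> {0..s} \<and> (\<forall>j\<in>J. A j \<in> sets borel) \<and>
      (AE \<omega> in M. \<omega> \<in> E \<longleftrightarrow> \<omega> \<in> cyl J A)}"
  define X where "X = {(\<lambda>\<omega>. B t \<omega> - B s \<omega>) -` D \<inter> space M | D. D \<in> sets borel}"
  have [measurable]: "B t \<in> borel_measurable M" "B s \<in> borel_measurable M"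
    using st by (auto intro: B_measurable)
  have Xm: "X \<subseteq> sets M" unfolding X_def by auto
  have cylm: "cyl J A \<in> sets M" if J: "finite J" "J \<subseteq> {0..s}" "\<forall>j\<in>J. A j \<in> sets borel" for J A
  proof -
    have [measurable]: "B j \<in> borel_measurable M" if "j \<in> J" for j
      using that J B_measurable by auto
    show ?thesis unfolding cyl_def using J(1,3) by measurable
  qed
  have "indep_set G X"
    unfolding indep_sets2_eq
  proof (intro conjI ballI)
    show "G \<subseteq> events" by (auto simp: G_def)
    show "X \<subseteq> events" by (rule Xm)
    fix P Q assume "P \<in> G" "Q \<in> X"
      obtain J A where JA: "finite J" "J \<subseteq> {0..s}" "\<forall>j\<in>J. A j \<in> sets borel"
        "AE \<omega> in M. \<omega> \<in> P \<longleftrightarrow> \<omega> \<in> cyl J A" "P \<in> sets M"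
        using \<open>P \<in> G\<close> unfolding G_def by blast
      obtain D where D: "D \<in> sets borel" "Q = {\<omega>\<in>space M. B t \<omega> - B s \<omega> \<in> D}"
        using \<open>Q \<in> X\<close> unfolding X_def by blast
      have Q: "Q \<in> sets M" using \<open>Q \<in> X\<close> Xm by auto
      have "prob (cyl J A \<inter> Q) = prob (cyl J A) * prob Q"
        unfolding cyl_def D(2) by (rule cylinder_indep_increment) (use st JA D in auto)
      moreover have "prob P = prob (cyl J A)" "prob (P \<inter> Q) = prob (cyl J A \<inter> Q)"
        using JA(4,5) Q cylm[OF JA(1-3)] by (auto intro!: finite_measure_eq_AE)
      ultimately show "prob (P \<inter> Q) = prob P * prob Q" by simp
  qed
  moreover have "Int_stable G"
  proof (rule Int_stableI)
    fix P Q assume "P \<in> G" "Q \<in> G"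
    then obtain J A J' A' where *: "finite J" "J \<subseteq> {0..s}" "\<forall>j\<in>J. A j \<in> sets borel"
        "AE \<omega> in M. \<omega> \<in> P \<longleftrightarrow> \<omega> \<in> cyl J A" "P \<in> sets M"
        "finite J'" "J' \<subseteq> {0..s}" "\<forall>j\<in>J'. A' j \<in> sets borel"
        "AE \<omega> in M. \<omega> \<in> Q \<longleftrightarrow> \<omega> \<in> cyl J' A'" "Q \<in> sets M"
      unfolding G_def by blast
    define A'' where "A'' j = (if j \<in> J then A j else UNIV) \<inter> (if j \<in> J' then A' j else UNIV)" for j
    have "AE \<omega> in M. \<omega> \<in> P \<inter> Q \<longleftrightarrow> \<omega> \<in> cyl (J \<union> J') A''"
      using *(4,9) by eventually_elim (auto simp: cyl_def A''_def)
    moreover have "\<forall>j\<in>J \<union> J'. A'' j \<in> sets borel"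
      using * by (auto simp: A''_def)
    ultimately show "P \<inter> Q \<in> G"
      unfolding G_def using * by (auto intro!: exI[of _ "J \<union> J'"] exI[of _ A''])
  qed
  moreover have "Int_stable X"
    unfolding X_def Int_stable_def
  proof safe
    fix D D' :: "(real^'d) set" assume "D \<in> sets borel" "D' \<in> sets borel"
    then show "\<exists>E. (\<lambda>\<omega>. B t \<omega> - B s \<omega>) -` D \<inter> space M \<inter> ((\<lambda>\<omega>. B t \<omega> - B s \<omega>) -` D' \<inter> space M) =
        (\<lambda>\<omega>. B t \<omega> - B s \<omega>) -` E \<inter> space M \<and> E \<in> sets borel"
      by (intro exI[of _ "D \<inter> D'"]) auto
  qed
  ultimately have "indep_set (sigma_sets (space M) G) (sigma_sets (space M) X)"
    by (rule indep_set_sigma_sets)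
  moreover have "sets (F s) \<subseteq> sigma_sets (space M) G"
    unfolding sets_F
  proof (rule sigma_sets_mono', rule subsetI)
    fix E assume "E \<in> (\<Union>r\<in>{0..s}. {B r -` A \<inter> space M | A. A \<in> sets borel}) \<union> null_sets M"
    then show "E \<in> G"
    proof
      assume "E \<in> (\<Union>r\<in>{0..s}. {B r -` A \<inter> space M | A. A \<in> sets borel})"
      then obtain r A where r: "0 \<le> r" "r \<le> s" "E = B r -` A \<inter> space M" "A \<in> sets borel" by auto
      have "E \<in> sets M" using measurable_sets[OF B_measurable[OF r(1)] r(4)] r(3) by simp
      then show "E \<in> G" unfolding G_def
        using r by (auto intro!: exI[of _ "{r}"] exI[of _ "\<lambda>_. A"] simp: cyl_def)
    next
      assume E: "E \<in> null_sets M"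
      then have "AE \<omega> in M. \<omega> \<notin> E" by (rule AE_not_in)
      with E show "E \<in> G" unfolding G_def
        using st by (auto intro!: exI[of _ "{0}"] exI[of _ "\<lambda>_. {}"] simp: cyl_def)
    qed
  qed
  ultimately have "indep_set (sets (F s)) X"
    using indep_set_mono sigma_sets_superset_generator by metis
  then show ?thesis unfolding X_def .
qed

lemma expectation_past_times_increment:
  fixes Z :: "'a \<Rightarrow> real" and h :: "real ^ 'd \<Rightarrow> real"
  assumes st: "0 \<le> s" "s < t" and Z: "Z \<in> borel_measurable (F s)" "integrable M Z"
    and h: "h \<in> borel_measurable borel" "integrable M (\<lambda>\<omega>. h (B t \<omega> - B s \<omega>))"
  shows "integrable M (\<lambda>\<omega>. Z \<omega> * h (B t \<omega> - B s \<omega>))"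
    and "(\<integral>\<omega>. Z \<omega> * h (B t \<omega> - B s \<omega>) \<partial>M) = (\<integral>\<omega>. Z \<omega> \<partial>M) * (\<integral>\<omega>. h (B t \<omega> - B s \<omega>) \<partial>M)"
proof -
  have [measurable]: "B t \<in> borel_measurable M" "B s \<in> borel_measurable M" "Z \<in> borel_measurable M"
    using st Z(2) by (auto intro: B_measurable)
  note h(1)[measurable]
  have "indep_var borel Z borel (\<lambda>\<omega>. h (B t \<omega> - B s \<omega>))"
    unfolding indep_var_eq
  proof safe
    have 1: "sigma_sets (space M) {Z -` A \<inter> space M | A. A \<in> sets borel} \<subseteq> sigma_sets (space M) (sets (F s))"
      using measurable_sets[OF Z(1)] by (intro sigma_sets_mono') auto
    have "{(\<lambda>\<omega>. h (B t \<omega> - B s \<omega>)) -` A \<inter> space M | A. A \<in> sets borel}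
        \<subseteq> {(\<lambda>\<omega>. B t \<omega> - B s \<omega>) -` D \<inter> space M | D. D \<in> sets borel}"
    proof safe
      fix A :: "real set" assume "A \<in> sets borel"
      then have "h -` A \<in> sets borel" using measurable_sets[OF h(1)] by simp
      then show "\<exists>D. (\<lambda>\<omega>. h (B t \<omega> - B s \<omega>)) -` A \<inter> space M = (\<lambda>\<omega>. B t \<omega> - B s \<omega>) -` D \<inter> space M \<and> D \<in> sets borel"
        by (intro exI[of _ "h -` A"]) auto
    qed
    then have 2: "indep_set (sets (F s)) {(\<lambda>\<omega>. h (B t \<omega> - B s \<omega>)) -` A \<inter> space M | A. A \<in> sets borel}"
      by (rule indep_set_mono[OF indep_past_increment[OF st] order_refl])
    have "indep_set (sigma_sets (space M) (sets (F s)))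
        (sigma_sets (space M) {(\<lambda>\<omega>. h (B t \<omega> - B s \<omega>)) -` A \<inter> space M | A. A \<in> sets borel})"
    proof (rule indep_set_sigma_sets[OF 2])
      show "Int_stable (sets (F s))" by (auto simp: Int_stable_def)
      show "Int_stable {(\<lambda>\<omega>. h (B t \<omega> - B s \<omega>)) -` A \<inter> space M | A. A \<in> sets borel}"
        unfolding Int_stable_def
      proof safe
        fix D D' :: "real set" assume "D \<in> sets borel" "D' \<in> sets borel"
        then show "\<exists>E. (\<lambda>\<omega>. h (B t \<omega> - B s \<omega>)) -` D \<inter> space M \<inter> ((\<lambda>\<omega>. h (B t \<omega> - B s \<omega>)) -` D' \<inter> space M) =
            (\<lambda>\<omega>. h (B t \<omega> - B s \<omega>)) -` E \<inter> space M \<and> E \<in> sets borel"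
          by (intro exI[of _ "D \<inter> D'"]) auto
      qed
    qed
    then show "indep_set (sigma_sets (space M) {Z -` A \<inter> space M | A. A \<in> sets borel})
        (sigma_sets (space M) {(\<lambda>\<omega>. h (B t \<omega> - B s \<omega>)) -` A \<inter> space M | A. A \<in> sets borel})"
      using 1 by (rule indep_set_mono) simp
  qed auto
  from indep_var_lebesgue_integral[OF this Z(2) h(2)] indep_var_integrable[OF this Z(2) h(2)]
  show "integrable M (\<lambda>\<omega>. Z \<omega> * h (B t \<omega> - B s \<omega>))"
    "(\<integral>\<omega>. Z \<omega> * h (B t \<omega> - B s \<omega>) \<partial>M) = (\<integral>\<omega>. Z \<omega> \<partial>M) * (\<integral>\<omega>. h (B t \<omega> - B s \<omega>) \<partial>M)"
    by auto
qed

end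

section \<open>Gaussian moments of the increments\<close>

text \<open>
  Lebesgue measure on \<open>real ^ 'n\<close> is the product over the coordinates, so that mixed moments of a
  vector with independent components factor.
\<close>

lemma lborel_vec_prod:
  fixes h :: "'n::finite \<Rightarrow> real \<Rightarrow> real"
  assumes h: "\<And>i. integrable lborel (h i)"
  shows "integrable lborel (\<lambda>x::real^'n. \<Prod>i\<in>UNIV. h i (x $ i))"
    and "(\<integral>x. (\<Prod>i\<in>UNIV. h i (x $ i)) \<partial>(lborel :: (real^'n) measure)) = (\<Prod>i\<in>UNIV. \<integral>x. h i x \<partial>lborel)"
proof -
  interpret product_sigma_finite "\<lambda>_ :: real^'n. lborel :: real measure" by standard
  define e where "e = (\<lambda>i::'n. axis i (1::real))"
  have inj: "inj e" by (auto simp: e_def inj_on_def axis_eq_axis)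
  have Basis: "Basis = range e" by (auto simp: Basis_vec_def e_def)
  define h' where "h' b = h (inv e b)" for b
  have h'e: "h' (e i) = h i" for i using inj by (simp add: h'_def)
  have [measurable]: "h i \<in> borel_measurable borel" for i using h[of i] by simp
  have int_h': "integrable lborel (h' b)" for b using h by (simp add: h'_def)
  have eq: "(\<Prod>i\<in>UNIV. h i ((\<Sum>b\<in>Basis. f b *\<^sub>R b) $ i)) = (\<Prod>b\<in>Basis. h' b (f b))"
    for f :: "real^'n \<Rightarrow> real"
  proof -
    have "(\<Sum>b\<in>Basis. f b *\<^sub>R b) $ i = f (e i)" for i
    proof -
      have "(\<Sum>b\<in>Basis. f b *\<^sub>R b) $ i = (\<Sum>b\<in>Basis. f b *\<^sub>R b) \<bullet> e i"
        by (simp add: e_def inner_axis)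
      also have "\<dots> = f (e i)"
        by (rule inner_sum_left_Basis) (simp add: Basis)
      finally show ?thesis .
    qed
    then show ?thesis
      unfolding Basis by (simp add: prod.reindex[OF inj] h'e)
  qed
  have [measurable]: "(\<lambda>x::real^'n. \<Prod>i\<in>UNIV. h i (x $ i)) \<in> borel_measurable borel"
    by measurable
  show "integrable lborel (\<lambda>x::real^'n. \<Prod>i\<in>UNIV. h i (x $ i))"
    unfolding lborel_eq[where 'a="real^'n"]
    by (subst integrable_distr_eq) (simp_all only: eq, auto intro!: product_integrable_prod int_h')
  show "(\<integral>x. (\<Prod>i\<in>UNIV. h i (x $ i)) \<partial>(lborel :: (real^'n) measure)) = (\<Prod>i\<in>UNIV. \<integral>x. h i x \<partial>lborel)"
    unfolding lborel_eq[where 'a="real^'n"]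
    apply (subst integral_distr)
    apply measurable
    apply (simp only: eq)
    apply (subst product_integral_prod)
    apply (auto simp: int_h' Basis prod.reindex[OF inj] h'e)
    done
qed

lemma integrable_times_of_squares:
  fixes f g :: "'b \<Rightarrow> real"
  assumes [measurable]: "f \<in> borel_measurable N" "g \<in> borel_measurable N"
    and "integrable N (\<lambda>x. (f x)\<^sup>2)" "integrable N (\<lambda>x. (g x)\<^sup>2)"
  shows "integrable N (\<lambda>x. f x * g x)"
proof (rule Bochner_Integration.integrable_bound[of N "\<lambda>x. (f x)\<^sup>2 + (g x)\<^sup>2"])
  have "\<bar>f x * g x\<bar> \<le> (f x)\<^sup>2 + (g x)\<^sup>2" for x
  proof -
    have "2 * (\<bar>f x\<bar> * \<bar>g x\<bar>) \<le> (f x)\<^sup>2 + (g x)\<^sup>2" "0 \<le> \<bar>f x\<bar> * \<bar>g x\<bar>"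
      using sum_squares_bound[of "\<bar>f x\<bar>" "\<bar>g x\<bar>"] by (simp_all add: mult.assoc)
    then show ?thesis unfolding abs_mult by linarith
  qed
  then show "AE x in N. norm (f x * g x) \<le> norm ((f x)\<^sup>2 + (g x)\<^sup>2)" by auto
qed (use assms in auto)

context brownian
begin

lemma increment_mixed_moment:
  fixes m :: "'d \<Rightarrow> nat"
  assumes st: "0 \<le> s" "s < t"
  shows "integrable M (\<lambda>\<omega>. \<Prod>i\<in>UNIV. ((B t \<omega> - B s \<omega>) $ i) ^ m i)"
    and "(\<integral>\<omega>. (\<Prod>i\<in>UNIV. ((B t \<omega> - B s \<omega>) $ i) ^ m i) \<partial>M)
      = (\<Prod>i\<in>UNIV. \<integral>x. normal_density 0 (sqrt (t - s)) x * x ^ m i \<partial>lborel)"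
proof -
  define \<sigma> where "\<sigma> = sqrt (t - s)"
  have \<sigma>: "0 < \<sigma>" using st by (simp add: \<sigma>_def)
  have dist: "distributed M lborel (\<lambda>\<omega>. B t \<omega> - B s \<omega>) (\<lambda>x. ennreal (\<Prod>i\<in>UNIV. normal_density 0 \<sigma> (x $ i)))"
    using bm st unfolding brownian_motion_def \<sigma>_def by blast
  have int: "integrable lborel (\<lambda>x. normal_density 0 \<sigma> x * x ^ m i)" for i
    using integrable_normal_moment[OF \<sigma>, of 0 "m i"] by simp
  have nn: "0 \<le> (\<Prod>i\<in>UNIV. normal_density 0 \<sigma> (x $ i))" for x :: "real^'d"
    by (intro prod_nonneg) auto
  have meas: "(\<lambda>x::real^'d. \<Prod>i\<in>UNIV. (x $ i) ^ m i) \<in> borel_measurable lborel"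
    by measurable
  note prod = lborel_vec_prod[of "\<lambda>i x. normal_density 0 \<sigma> x * x ^ m i", OF int, unfolded prod.distrib]
  show "integrable M (\<lambda>\<omega>. \<Prod>i\<in>UNIV. ((B t \<omega> - B s \<omega>) $ i) ^ m i)"
    using distributed_integrable[OF dist meas nn] prod(1) by simp
  show "(\<integral>\<omega>. (\<Prod>i\<in>UNIV. ((B t \<omega> - B s \<omega>) $ i) ^ m i) \<partial>M)
      = (\<Prod>i\<in>UNIV. \<integral>x. normal_density 0 (sqrt (t - s)) x * x ^ m i \<partial>lborel)"
    using distributed_integral[OF dist meas nn] prod(2) by (simp add: \<sigma>_def)
qed

lemma increment_moments:
  assumes st: "0 \<le> s" "s < t"
  shows "integrable M (\<lambda>\<omega>. (B t \<omega> - B s \<omega>) $ j)"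
    and "(\<integral>\<omega>. (B t \<omega> - B s \<omega>) $ j \<partial>M) = 0"
    and "integrable M (\<lambda>\<omega>. (B t \<omega> - B s \<omega>) $ j * (B t \<omega> - B s \<omega>) $ k)"
    and "(\<integral>\<omega>. (B t \<omega> - B s \<omega>) $ j * (B t \<omega> - B s \<omega>) $ k \<partial>M) = (if j = k then t - s else 0)"
proof -
  define \<sigma> where "\<sigma> = sqrt (t - s)"
  have \<sigma>: "0 < \<sigma>" using st by (simp add: \<sigma>_def)
  define \<mu> where "\<mu> n = (\<integral>x. normal_density 0 (sqrt (t - s)) x * x ^ n \<partial>lborel)" for n :: nat
  have \<mu>0: "\<mu> 0 = 1" using \<sigma> by (simp add: \<mu>_def \<sigma>_def)
  have \<mu>1: "\<mu> 1 = 0" using integral_normal_moment_odd[OF \<sigma>, of 0 0] by (simp add: \<mu>_def \<sigma>_def)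
  have \<mu>2: "\<mu> 2 = t - s"
    using integral_normal_moment_even[OF \<sigma>, of 0 1] st by (simp add: \<mu>_def \<sigma>_def)
  define m1 where "m1 = (\<lambda>i. if i = j then 1::nat else 0)"
  define m2 where "m2 = (\<lambda>i. (if i = j then 1::nat else 0) + (if i = k then 1 else 0))"
  have delta: "(\<Prod>i\<in>UNIV. (x $ i) ^ (if i = l then 1::nat else 0)) = x $ l" for x :: "real^'d" and l
  proof -
    have "(\<Prod>i\<in>UNIV. (x $ i) ^ (if i = l then 1::nat else 0)) = (\<Prod>i\<in>UNIV. if i = l then x $ i else 1)"
      by (intro prod.cong) auto
    then show ?thesis by simp
  qed
  have p1: "(\<Prod>i\<in>UNIV. (x $ i) ^ m1 i) = x $ j" for x :: "real^'d"
    unfolding m1_def by (rule delta)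
  have p2: "(\<Prod>i\<in>UNIV. (x $ i) ^ m2 i) = x $ j * x $ k" for x :: "real^'d"
    unfolding m2_def power_add prod.distrib delta ..
  have "(\<Prod>i\<in>UNIV. \<mu> (m1 i)) = 0"
    by (rule prod_zero) (auto intro!: bexI[of _ j] simp: m1_def \<mu>1[simplified])
  then show "(\<integral>\<omega>. (B t \<omega> - B s \<omega>) $ j \<partial>M) = 0"
    using increment_mixed_moment(2)[OF st, of m1] unfolding p1 \<mu>_def by simp
  show "integrable M (\<lambda>\<omega>. (B t \<omega> - B s \<omega>) $ j)"
    using increment_mixed_moment(1)[OF st, of m1] unfolding p1 .
  show "integrable M (\<lambda>\<omega>. (B t \<omega> - B s \<omega>) $ j * (B t \<omega> - B s \<omega>) $ k)"
    using increment_mixed_moment(1)[OF st, of m2] unfolding p2 .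
  have "(\<Prod>i\<in>UNIV. \<mu> (m2 i)) = (if j = k then t - s else 0)"
  proof (cases "j = k")
    case True
    have "(\<Prod>i\<in>UNIV. \<mu> (m2 i)) = (\<Prod>i\<in>UNIV. if i = j then t - s else 1)"
      using True by (intro prod.cong) (auto simp: m2_def \<mu>0 \<mu>2[simplified numeral_2_eq_2])
    then show ?thesis using True by simp
  next
    case False
    then show ?thesis
      by (auto intro!: prod_zero bexI[of _ j] simp: m2_def \<mu>1[simplified])
  qed
  then show "(\<integral>\<omega>. (B t \<omega> - B s \<omega>) $ j * (B t \<omega> - B s \<omega>) $ k \<partial>M) = (if j = k then t - s else 0)"
    using increment_mixed_moment(2)[OF st, of m2] unfolding p2 \<mu>_def by simp
qed

section \<open>Elementary stochastic integrals\<close>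

lemma borel_measurable_vec_nth [measurable (raw)]: "f \<in> borel_measurable N \<Longrightarrow> (\<lambda>x. f x $ j) \<in> borel_measurable N"
  for f :: "'b \<Rightarrow> real^'n"
  by (rule measurable_compose[of f N borel])
     (auto intro!: borel_measurable_continuous_onI continuous_intros)

lemma inner_vec_expand: "x \<bullet> y = (\<Sum>j\<in>UNIV. x $ j * y $ j)" for x y :: "real^'n"
  by (simp add: inner_vec_def)

lemma increment_orthogonal:
  fixes X :: "'a \<Rightarrow> real" and H :: "'a \<Rightarrow> real^'d"
  assumes st: "0 \<le> s" "s \<le> t" and X: "X \<in> borel_measurable (F s)" "integrable M X"
    and H: "H \<in> borel_measurable (F s)" "\<And>\<omega>. \<omega> \<in> space M \<Longrightarrow> norm (H \<omega>) \<le> c"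
  shows "integrable M (\<lambda>\<omega>. X \<omega> * (H \<omega> \<bullet> (B t \<omega> - B s \<omega>)))" (is ?int)
    and "(\<integral>\<omega>. X \<omega> * (H \<omega> \<bullet> (B t \<omega> - B s \<omega>)) \<partial>M) = 0" (is ?eq)
proof -
  have *: "?int \<and> ?eq"
  proof (cases "s = t")
    case False
    then have st': "0 \<le> s" "s < t" using st by auto
    note [measurable] = X(1) H(1) measurable_F_M[OF H(1)] measurable_F_M[OF X(1)]
    have XH: "(\<lambda>\<omega>. X \<omega> * H \<omega> $ j) \<in> borel_measurable (F s)" for j
      by (intro borel_measurable_times borel_measurable_vec_nth X H)
    have XHi: "integrable M (\<lambda>\<omega>. X \<omega> * H \<omega> $ j)" for j
    proof (rule Bochner_Integration.integrable_bound[of M "\<lambda>\<omega>. c * X \<omega>"])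
      show "AE \<omega> in M. norm (X \<omega> * H \<omega> $ j) \<le> norm (c * X \<omega>)"
      proof (rule AE_I2)
        fix \<omega> assume "\<omega> \<in> space M"
        then have "\<bar>H \<omega> $ j\<bar> \<le> \<bar>c\<bar>"
          using H(2) component_le_norm_cart[of "H \<omega>" j] by fastforce
        then show "norm (X \<omega> * H \<omega> $ j) \<le> norm (c * X \<omega>)"
          by (simp add: abs_mult mult.commute[of "\<bar>c\<bar>"] mult_left_mono)
      qed
    qed (use X(2) in auto)
    have h: "(\<lambda>x::real^'d. x $ j) \<in> borel_measurable borel" for j by measurable
    note e = expectation_past_times_increment[OF st' XH XHi h increment_moments(1)[OF st']]
    have eq: "X \<omega> * (H \<omega> \<bullet> (B t \<omega> - B s \<omega>)) = (\<Sum>j\<in>UNIV. (X \<omega> * H \<omega> $ j) * (B t \<omega> - B s \<omega>) $ j)" for \<omega>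
      unfolding inner_vec_expand sum_distrib_left by (simp add: mult.assoc)
    show ?thesis
      unfolding eq using e increment_moments(2)[OF st'] by simp
  qed auto
  show ?int by (rule conjunct1[OF *])
  show ?eq by (rule conjunct2[OF *])
qed

lemma increment_isometry:
  fixes H H' :: "'a \<Rightarrow> real^'d"
  assumes st: "0 \<le> s" "s \<le> t"
    and H: "H \<in> borel_measurable (F s)" "\<And>\<omega>. \<omega> \<in> space M \<Longrightarrow> norm (H \<omega>) \<le> c"
    and H': "H' \<in> borel_measurable (F s)" "\<And>\<omega>. \<omega> \<in> space M \<Longrightarrow> norm (H' \<omega>) \<le> c'"
  shows "integrable M (\<lambda>\<omega>. (H \<omega> \<bullet> (B t \<omega> - B s \<omega>)) * (H' \<omega> \<bullet> (B t \<omega> - B s \<omega>)))" (is ?int)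
    and "(\<integral>\<omega>. (H \<omega> \<bullet> (B t \<omega> - B s \<omega>)) * (H' \<omega> \<bullet> (B t \<omega> - B s \<omega>)) \<partial>M) = (\<integral>\<omega>. H \<omega> \<bullet> H' \<omega> \<partial>M) * (t - s)" (is ?eq)
proof -
  have *: "?int \<and> ?eq"
  proof (cases "s = t")
    case False
    then have st': "0 \<le> s" "s < t" using st by auto
    note [measurable] = H(1) H'(1) measurable_F_M[OF H(1)] measurable_F_M[OF H'(1)]
    have HH: "(\<lambda>\<omega>. H \<omega> $ j * H' \<omega> $ k) \<in> borel_measurable (F s)" for j k
      by (intro borel_measurable_times borel_measurable_vec_nth H H')
    have HHi: "integrable M (\<lambda>\<omega>. H \<omega> $ j * H' \<omega> $ k)" for j k
    proof (rule integrable_const_bound[where B="c * c'"])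
      show "AE \<omega> in M. norm (H \<omega> $ j * H' \<omega> $ k) \<le> c * c'"
      proof (rule AE_I2)
        fix \<omega> assume "\<omega> \<in> space M"
        then have "\<bar>H \<omega> $ j\<bar> \<le> c" "\<bar>H' \<omega> $ k\<bar> \<le> c'"
          using H(2) component_le_norm_cart[of "H \<omega>" j] H'(2) component_le_norm_cart[of "H' \<omega>" k] by fastforce+
        then show "norm (H \<omega> $ j * H' \<omega> $ k) \<le> c * c'"
          by (simp add: abs_mult mult_mono')
      qed
    qed measurable
    have h: "(\<lambda>x::real^'d. x $ j * x $ k) \<in> borel_measurable borel" for j k by measurable
    note e = expectation_past_times_increment[OF st' HH HHi h increment_moments(3)[OF st']]
    have eq: "(H \<omega> \<bullet> (B t \<omega> - B s \<omega>)) * (H' \<omega> \<bullet> (B t \<omega> - B s \<omega>)) =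
        (\<Sum>j\<in>UNIV. \<Sum>k\<in>UNIV. (H \<omega> $ j * H' \<omega> $ k) * ((B t \<omega> - B s \<omega>) $ j * (B t \<omega> - B s \<omega>) $ k))" for \<omega>
      unfolding inner_vec_expand sum_product by (simp add: ac_simps)
    have "(\<integral>\<omega>. (H \<omega> \<bullet> (B t \<omega> - B s \<omega>)) * (H' \<omega> \<bullet> (B t \<omega> - B s \<omega>)) \<partial>M) =
      (\<Sum>j\<in>UNIV. \<Sum>k\<in>UNIV. (\<integral>\<omega>. H \<omega> $ j * H' \<omega> $ k \<partial>M) * (if j = k then t - s else 0))"
      unfolding eq by (simp only: Bochner_Integration.integral_sum Bochner_Integration.integrable_sum e increment_moments(4)[OF st'])
    also have "\<dots> = (\<Sum>j\<in>UNIV. \<Sum>k\<in>UNIV. if j = k then (\<integral>\<omega>. H \<omega> $ j * H' \<omega> $ k \<partial>M) * (t - s) else 0)"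
      by (intro sum.cong) auto
    also have "\<dots> = (\<Sum>j\<in>UNIV. (\<integral>\<omega>. H \<omega> $ j * H' \<omega> $ j \<partial>M)) * (t - s)"
      by (simp add: sum_distrib_right)
    also have "\<dots> = (\<integral>\<omega>. H \<omega> \<bullet> H' \<omega> \<partial>M) * (t - s)"
      unfolding inner_vec_expand by (subst Bochner_Integration.integral_sum) (auto intro: HHi)
    finally have I: "(\<integral>\<omega>. (H \<omega> \<bullet> (B t \<omega> - B s \<omega>)) * (H' \<omega> \<bullet> (B t \<omega> - B s \<omega>)) \<partial>M) =
        (\<integral>\<omega>. H \<omega> \<bullet> H' \<omega> \<partial>M) * (t - s)" .
    have "integrable M (\<lambda>\<omega>. (H \<omega> \<bullet> (B t \<omega> - B s \<omega>)) * (H' \<omega> \<bullet> (B t \<omega> - B s \<omega>)))"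
      unfolding eq using e(1) by simp
    with I show ?thesis by blast
  qed auto
  show ?int by (rule conjunct1[OF *])
  show ?eq by (rule conjunct2[OF *])
qed

definition elementary :: "real \<Rightarrow> real \<Rightarrow> ('a \<Rightarrow> real^'d) \<Rightarrow> bool" where
  "elementary a b H \<longleftrightarrow> 0 \<le> a \<and> a \<le> b \<and> H \<in> borel_measurable (F a) \<and> (\<exists>c. \<forall>\<omega>\<in>space M. norm (H \<omega>) \<le> c)"

definition step_integral :: "real \<Rightarrow> real \<Rightarrow> ('a \<Rightarrow> real^'d) \<Rightarrow> 'a \<Rightarrow> real" where
  "step_integral a b H \<omega> = H \<omega> \<bullet> (B b \<omega> - B a \<omega>)"

lemma step_integral_measurable_F: "elementary a b H \<Longrightarrow> b \<le> t \<Longrightarrow> step_integral a b H \<in> borel_measurable (F t)"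
  unfolding elementary_def step_integral_def
  by (intro borel_measurable_inner borel_measurable_diff B_measurable_F)
     (auto intro: measurable_F_mono[of a t])

lemma step_integral_measurable: "elementary a b H \<Longrightarrow> step_integral a b H \<in> borel_measurable M"
  by (rule measurable_F_M[OF step_integral_measurable_F]) auto

lemma step_integral_orthogonal:
  assumes "elementary a b H" "X \<in> borel_measurable (F a)" "integrable M X"
  shows "integrable M (\<lambda>\<omega>. X \<omega> * step_integral a b H \<omega>)" "(\<integral>\<omega>. X \<omega> * step_integral a b H \<omega> \<partial>M) = 0"
  using assms increment_orthogonal[of a b X H] unfolding elementary_def step_integral_def by blast+

lemma step_integral_integrable: "elementary a b H \<Longrightarrow> integrable M (step_integral a b H)"
  by (rule step_integral_orthogonal(1)[of a b H "\<lambda>_. 1", simplified mult_1_left]) auto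

lemma step_integral_same_interval:
  assumes "elementary a b H" "elementary a b H'"
  shows "integrable M (\<lambda>\<omega>. step_integral a b H \<omega> * step_integral a b H' \<omega>)"
    and "(\<integral>\<omega>. step_integral a b H \<omega> * step_integral a b H' \<omega> \<partial>M) = (\<integral>\<omega>. H \<omega> \<bullet> H' \<omega> \<partial>M) * (b - a)"
proof -
  obtain c c' where c: "\<And>\<omega>. \<omega> \<in> space M \<Longrightarrow> norm (H \<omega>) \<le> c" "\<And>\<omega>. \<omega> \<in> space M \<Longrightarrow> norm (H' \<omega>) \<le> c'"
    using assms unfolding elementary_def by blast
  have *: "0 \<le> a" "a \<le> b" "H \<in> borel_measurable (F a)" "H' \<in> borel_measurable (F a)"
    using assms unfolding elementary_def by auto
  show "integrable M (\<lambda>\<omega>. step_integral a b H \<omega> * step_integral a b H' \<omega>)"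
    "(\<integral>\<omega>. step_integral a b H \<omega> * step_integral a b H' \<omega> \<partial>M) = (\<integral>\<omega>. H \<omega> \<bullet> H' \<omega> \<partial>M) * (b - a)"
    unfolding step_integral_def
    using increment_isometry[OF *(1-3) c(1) *(4) c(2)] by auto
qed

lemma step_integral_square_integrable: "elementary a b H \<Longrightarrow> integrable M (\<lambda>\<omega>. (step_integral a b H \<omega>)\<^sup>2)"
  using step_integral_same_interval(1)[of a b H H] by (simp add: power2_eq_square)

lemma step_integral_times_integrable:
  "elementary a b H \<Longrightarrow> elementary c d H' \<Longrightarrow> integrable M (\<lambda>\<omega>. step_integral a b H \<omega> * step_integral c d H' \<omega>)"
  by (intro integrable_times_of_squares step_integral_measurable step_integral_square_integrable)

lemma elementary_shrink:
  assumes "elementary a b H" "a \<le> a'" "a' \<le> b'" shows "elementary a' b' H"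
proof -
  have "0 \<le> a'" using assms by (simp add: elementary_def)
  moreover have "H \<in> borel_measurable (F a')"
    using assms(1) by (intro measurable_F_mono[OF assms(2)]) (simp add: elementary_def)
  ultimately show ?thesis using assms by (simp add: elementary_def)
qed

lemma step_integral_split: "step_integral a b H \<omega> = step_integral a c H \<omega> + step_integral c b H \<omega>"
  unfolding step_integral_def by (simp flip: inner_add_right)

lemma step_integral_pair_disjoint:
  assumes "elementary a b H" "elementary c d H'" "b \<le> c"
  shows "(\<integral>\<omega>. step_integral a b H \<omega> * step_integral c d H' \<omega> \<partial>M) = 0"
  using step_integral_orthogonal(2)[OF assms(2) step_integral_measurable_F[OF assms(1,3)] step_integral_integrable[OF assms(1)]] .

text \<open>
  The shorter interval carries the isometry; what the longer one adds lies in its future.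
\<close>

lemma step_integral_pair_same_start:
  assumes "elementary a b H" "elementary a d H'" "b \<le> d"
  shows "(\<integral>\<omega>. step_integral a b H \<omega> * step_integral a d H' \<omega> \<partial>M) = (\<integral>\<omega>. H \<omega> \<bullet> H' \<omega> \<partial>M) * (b - a)"
proof -
  have ab: "a \<le> b" using assms(1) by (auto simp: elementary_def)
  have e: "elementary a b H'" "elementary b d H'"
    using elementary_shrink[OF assms(2) order_refl ab] elementary_shrink[OF assms(2) ab assms(3)] .
  have "(\<integral>\<omega>. step_integral a b H \<omega> * step_integral a d H' \<omega> \<partial>M) = (\<integral>\<omega>. step_integral a b H \<omega> * step_integral a b H' \<omega> + step_integral a b H \<omega> * step_integral b d H' \<omega> \<partial>M)"
    by (subst step_integral_split[of a d _ _ b]) (simp add: distrib_left)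
  also have "\<dots> = (\<integral>\<omega>. step_integral a b H \<omega> * step_integral a b H' \<omega> \<partial>M)"
    using step_integral_times_integrable[OF assms(1) e(1)] step_integral_times_integrable[OF assms(1) e(2)]
      step_integral_pair_disjoint[OF assms(1) e(2)] by simp
  also have "\<dots> = (\<integral>\<omega>. H \<omega> \<bullet> H' \<omega> \<partial>M) * (b - a)"
    by (rule step_integral_same_interval(2)[OF assms(1) e(1)])
  finally show ?thesis .
qed

text \<open>
  Cutting the first interval at \<open>c\<close> leaves a part in the past of \<open>c\<close>, which is orthogonal to the second
  integral, and a part that starts where the second interval starts.
\<close>

lemma step_integral_pair_le:
  assumes "elementary a b H" "elementary c d H'" "a \<le> c"
  shows "(\<integral>\<omega>. step_integral a b H \<omega> * step_integral c d H' \<omega> \<partial>M) = (\<integral>\<omega>. H \<omega> \<bullet> H' \<omega> \<partial>M) * max 0 (min b d - max a c)"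
proof (cases "b \<le> c")
  case True
  then show ?thesis using step_integral_pair_disjoint[OF assms(1,2) True] assms(3) by (simp add: max_def min_def)
next
  case False
  then have cb: "c \<le> b" by simp
  have cd: "c \<le> d" using assms(2) by (auto simp: elementary_def)
  have e: "elementary a c H" "elementary c b H"
    using elementary_shrink[OF assms(1) order_refl assms(3)] elementary_shrink[OF assms(1,3) cb] .
  have "(\<integral>\<omega>. step_integral a b H \<omega> * step_integral c d H' \<omega> \<partial>M) = (\<integral>\<omega>. step_integral a c H \<omega> * step_integral c d H' \<omega> + step_integral c b H \<omega> * step_integral c d H' \<omega> \<partial>M)"
    by (subst step_integral_split[of a b _ _ c]) (simp add: distrib_right)
  also have "\<dots> = (\<integral>\<omega>. step_integral c b H \<omega> * step_integral c d H' \<omega> \<partial>M)"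
    using step_integral_times_integrable[OF e(1) assms(2)] step_integral_times_integrable[OF e(2) assms(2)]
      step_integral_pair_disjoint[OF e(1) assms(2)] by simp
  also have "\<dots> = (\<integral>\<omega>. H \<omega> \<bullet> H' \<omega> \<partial>M) * (min b d - c)"
  proof (cases "b \<le> d")
    case True
    then show ?thesis using step_integral_pair_same_start[OF e(2) assms(2)] by simp
  next
    case False
    then show ?thesis using step_integral_pair_same_start[OF assms(2) e(2)] by (simp add: inner_commute mult.commute)
  qed
  finally show ?thesis using assms(3) cb cd by (simp add: max_def)
qed

lemma step_integral_pair:
  assumes "elementary a b H" "elementary c d H'"
  shows "(\<integral>\<omega>. step_integral a b H \<omega> * step_integral c d H' \<omega> \<partial>M) = (\<integral>\<omega>. H \<omega> \<bullet> H' \<omega> \<partial>M) * max 0 (min b d - max a c)"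
proof (cases "a \<le> c")
  case False
  then show ?thesis using step_integral_pair_le[OF assms(2,1)] by (simp add: inner_commute mult.commute min.commute max.commute)
qed (rule step_integral_pair_le[OF assms])

lemma integral_indicator_overlap:
  "integrable lborel (\<lambda>s::real. indicator {a<..b} s * indicator {c<..d} s :: real)"
  "(\<integral>s. indicator {a<..b} s * indicator {c<..d} s \<partial>lborel) = max 0 (min b d - max a c :: real)"
proof -
  have eq: "(indicator {a<..b} s * indicator {c<..d} s :: real) = indicator {max a c<..min b d} s" for s :: real
    by (auto simp: indicator_def)
  have Ioc: "integrable lborel (indicator {x<..y} :: real \<Rightarrow> real)"
    "(\<integral>s. indicator {x<..y} s \<partial>lborel) = max 0 (y - x)" for x y :: real
    by (cases "x \<le> y"; simp add: integrable_indicator_iff)+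
  show "integrable lborel (\<lambda>s::real. indicator {a<..b} s * indicator {c<..d} s :: real)"
    unfolding eq by (rule Ioc)
  show "(\<integral>s. indicator {a<..b} s * indicator {c<..d} s \<partial>lborel) = max 0 (min b d - max a c :: real)"
    unfolding eq by (rule Ioc)
qed

text \<open>
  The isometry for an arbitrary finite family of intervals, which may overlap: in this form it
  applies at once to the difference of two simple integrands with unrelated partitions.
\<close>

lemma elementary_isometry:
  fixes a b :: "'i \<Rightarrow> real" and H :: "'i \<Rightarrow> 'a \<Rightarrow> real^'d"
  assumes N: "finite N" "\<And>i. i \<in> N \<Longrightarrow> elementary (a i) (b i) (H i)"
  shows "(\<integral>\<^sup>+\<omega>. ennreal ((\<Sum>i\<in>N. step_integral (a i) (b i) (H i) \<omega>)\<^sup>2) \<partial>M) =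
     (\<integral>\<^sup>+\<omega>. (\<integral>\<^sup>+s. ennreal ((norm (\<Sum>i\<in>N. indicator {a i<..b i} s *\<^sub>R H i \<omega>))\<^sup>2) \<partial>lborel) \<partial>M)"
proof -
  define ov where "ov i j = max 0 (min (b i) (b j) - max (a i) (a j))" for i j
  define Q where "Q \<omega> = (\<Sum>i\<in>N. \<Sum>j\<in>N. (H i \<omega> \<bullet> H j \<omega>) * ov i j)" for \<omega>
  have [measurable]: "H i \<in> borel_measurable M" if "i \<in> N" for i
    using N(2)[OF that] unfolding elementary_def by (blast intro: measurable_F_M)
  have HH: "integrable M (\<lambda>\<omega>. H i \<omega> \<bullet> H j \<omega>)" if ij: "i \<in> N" "j \<in> N" for i j
  proof -
    obtain c c' where c: "\<forall>\<omega>\<in>space M. norm (H i \<omega>) \<le> c" "\<forall>\<omega>\<in>space M. norm (H j \<omega>) \<le> c'"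
      using N(2)[OF ij(1)] N(2)[OF ij(2)] unfolding elementary_def by blast
    show ?thesis
    proof (rule integrable_const_bound[where B="c * c'"])
      show "AE \<omega> in M. norm (H i \<omega> \<bullet> H j \<omega>) \<le> c * c'"
        using c by (auto intro!: AE_I2 order_trans[OF Cauchy_Schwarz_ineq2] mult_mono')
    qed (use ij in measurable)
  qed
  have sq: "(norm (\<Sum>i\<in>N. indicator {a i<..b i} s *\<^sub>R H i \<omega>))\<^sup>2 =
      (\<Sum>i\<in>N. \<Sum>j\<in>N. (H i \<omega> \<bullet> H j \<omega>) * (indicator {a i<..b i} s * indicator {a j<..b j} s))" for s \<omega>
    unfolding power2_norm_eq_inner inner_sum_left inner_sum_right
    by (intro sum.cong refl) (simp add: inner_commute ac_simps)
  have inner: "(\<integral>\<^sup>+s. ennreal ((norm (\<Sum>i\<in>N. indicator {a i<..b i} s *\<^sub>R H i \<omega>))\<^sup>2) \<partial>lborel) = ennreal (Q \<omega>)" for \<omega>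
  proof -
    have "(\<integral>\<^sup>+s. ennreal ((norm (\<Sum>i\<in>N. indicator {a i<..b i} s *\<^sub>R H i \<omega>))\<^sup>2) \<partial>lborel) =
      ennreal (\<integral>s. (norm (\<Sum>i\<in>N. indicator {a i<..b i} s *\<^sub>R H i \<omega>))\<^sup>2 \<partial>lborel)"
    proof (rule nn_integral_eq_integral)
      show "integrable lborel (\<lambda>s. (norm (\<Sum>i\<in>N. indicator {a i<..b i} s *\<^sub>R H i \<omega>))\<^sup>2)"
        unfolding sq by (intro Bochner_Integration.integrable_sum integrable_mult_right integral_indicator_overlap)
    qed auto
    also have "(\<integral>s. (norm (\<Sum>i\<in>N. indicator {a i<..b i} s *\<^sub>R H i \<omega>))\<^sup>2 \<partial>lborel) = Q \<omega>"
      unfolding sq Q_def ov_def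
      by (simp add: Bochner_Integration.integral_sum integral_indicator_overlap)
    finally show ?thesis .
  qed
  have Q0: "0 \<le> Q \<omega>" for \<omega>
  proof -
    have "(\<integral>s. (norm (\<Sum>i\<in>N. indicator {a i<..b i} s *\<^sub>R H i \<omega>))\<^sup>2 \<partial>lborel) = Q \<omega>"
      unfolding sq Q_def ov_def
      by (simp add: Bochner_Integration.integral_sum integral_indicator_overlap)
    moreover have "0 \<le> (\<integral>s. (norm (\<Sum>i\<in>N. indicator {a i<..b i} s *\<^sub>R H i \<omega>))\<^sup>2 \<partial>lborel)"
      by (rule Bochner_Integration.integral_nonneg) simp
    ultimately show ?thesis by (simp only:)
  qed
  have Qi: "integrable M Q"
    unfolding Q_def[abs_def] by (intro Bochner_Integration.integrable_sum integrable_mult_left HH)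
  have DD: "(\<Sum>i\<in>N. step_integral (a i) (b i) (H i) \<omega>)\<^sup>2 = (\<Sum>i\<in>N. \<Sum>j\<in>N. step_integral (a i) (b i) (H i) \<omega> * step_integral (a j) (b j) (H j) \<omega>)" for \<omega>
    unfolding power2_eq_square sum_product ..
  have "(\<integral>\<omega>. (\<Sum>i\<in>N. step_integral (a i) (b i) (H i) \<omega>)\<^sup>2 \<partial>M) = (\<Sum>i\<in>N. \<Sum>j\<in>N. (\<integral>\<omega>. H i \<omega> \<bullet> H j \<omega> \<partial>M) * ov i j)"
    unfolding DD ov_def using N(2)
    by (simp add: Bochner_Integration.integral_sum step_integral_times_integrable step_integral_pair)
  also have "\<dots> = (\<integral>\<omega>. Q \<omega> \<partial>M)"
    unfolding Q_def by (simp add: Bochner_Integration.integral_sum HH)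
  finally have E: "(\<integral>\<omega>. (\<Sum>i\<in>N. step_integral (a i) (b i) (H i) \<omega>)\<^sup>2 \<partial>M) = (\<integral>\<omega>. Q \<omega> \<partial>M)" .
  have "integrable M (\<lambda>\<omega>. (\<Sum>i\<in>N. step_integral (a i) (b i) (H i) \<omega>)\<^sup>2)"
    unfolding DD using N(2) by (auto intro!: Bochner_Integration.integrable_sum step_integral_times_integrable)
  then show ?thesis
    unfolding inner using E Qi Q0 by (simp add: nn_integral_eq_integral)
qed

lemma elementary_orthogonal:
  fixes a b :: "'i \<Rightarrow> real" and H :: "'i \<Rightarrow> 'a \<Rightarrow> real^'d"
  assumes N: "finite N" "\<And>i. i \<in> N \<Longrightarrow> elementary (a i) (b i) (H i)" "\<And>i. i \<in> N \<Longrightarrow> r \<le> a i"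
    and X: "X \<in> borel_measurable (F r)" "integrable M X"
  shows "integrable M (\<lambda>\<omega>. X \<omega> * (\<Sum>i\<in>N. step_integral (a i) (b i) (H i) \<omega>))"
    and "(\<integral>\<omega>. X \<omega> * (\<Sum>i\<in>N. step_integral (a i) (b i) (H i) \<omega>) \<partial>M) = 0"
proof -
  have *: "integrable M (\<lambda>\<omega>. X \<omega> * step_integral (a i) (b i) (H i) \<omega>)"
      "(\<integral>\<omega>. X \<omega> * step_integral (a i) (b i) (H i) \<omega> \<partial>M) = 0" if "i \<in> N" for i
    using step_integral_orthogonal[OF N(2)[OF that] measurable_F_mono[OF N(3)[OF that] X(1)] X(2)] by auto
  show "integrable M (\<lambda>\<omega>. X \<omega> * (\<Sum>i\<in>N. step_integral (a i) (b i) (H i) \<omega>))"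
    "(\<integral>\<omega>. X \<omega> * (\<Sum>i\<in>N. step_integral (a i) (b i) (H i) \<omega>) \<partial>M) = 0"
    unfolding sum_distrib_left using * by (simp_all add: Bochner_Integration.integral_sum)
qed

end

section \<open>Ito integrals as mean-square limits\<close>

lemma norm_add_square_le:
  fixes x y :: "'b::real_inner"
  assumes "0 < e"
  shows "(norm (x + y))\<^sup>2 \<le> (1 + e) * (norm x)\<^sup>2 + (1 + 1 / e) * (norm y)\<^sup>2"
proof -
  have "2 * (norm x * norm y) \<le> e * (norm x)\<^sup>2 + (1 / e) * (norm y)\<^sup>2"
  proof -
    have "0 \<le> (sqrt e * norm x - norm y / sqrt e)\<^sup>2" by simp
    also have "\<dots> = e * (norm x)\<^sup>2 + (1 / e) * (norm y)\<^sup>2 - 2 * (norm x * norm y)"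
      using assms by (simp add: power2_diff power_mult_distrib power_divide)
    finally show ?thesis by simp
  qed
  moreover have "(norm (x + y))\<^sup>2 \<le> (norm x + norm y)\<^sup>2"
    by (intro power_mono norm_triangle_ineq) auto
  ultimately show ?thesis by (simp add: power2_sum algebra_simps)
qed

abbreviation joint :: "'a measure \<Rightarrow> (real \<Rightarrow> 'a \<Rightarrow> 'b::topological_space) \<Rightarrow> bool" where
  "joint M X \<equiv> case_prod X \<in> borel_measurable (lborel \<Otimes>\<^sub>M M)"

abbreviation dint :: "'a measure \<Rightarrow> (real \<Rightarrow> 'a \<Rightarrow> real) \<Rightarrow> ennreal" where
  "dint M X \<equiv> (\<integral>\<^sup>+\<omega>. \<integral>\<^sup>+r. ennreal (X r \<omega>) \<partial>lborel \<partial>M)"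

abbreviation expect_on :: "'a measure \<Rightarrow> 'a set \<Rightarrow> ('a \<Rightarrow> ennreal) \<Rightarrow> ennreal" where
  "expect_on M A X \<equiv> (\<integral>\<^sup>+\<omega>. indicator A \<omega> * X \<omega> \<partial>M)"

abbreviation msq :: "'b measure \<Rightarrow> ('b \<Rightarrow> 'c::real_normed_vector) \<Rightarrow> ennreal" where
  "msq N f \<equiv> (\<integral>\<^sup>+x. ennreal ((norm (f x))\<^sup>2) \<partial>N)"

lemma msq_add_le:
  fixes f g :: "'b \<Rightarrow> 'c::euclidean_space"
  assumes [measurable]: "f \<in> borel_measurable N" "g \<in> borel_measurable N" and e: "0 < e"
  shows "msq N (\<lambda>x. f x + g x) \<le> ennreal (1 + e) * msq N f + ennreal (1 + 1 / e) * msq N g"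
proof -
  have "msq N (\<lambda>x. f x + g x) \<le>
      (\<integral>\<^sup>+x. ennreal (1 + e) * ennreal ((norm (f x))\<^sup>2) + ennreal (1 + 1 / e) * ennreal ((norm (g x))\<^sup>2) \<partial>N)"
    using norm_add_square_le[OF e] e
    by (intro nn_integral_mono) (simp flip: ennreal_mult ennreal_plus)
  also have "\<dots> = ennreal (1 + e) * msq N f + ennreal (1 + 1 / e) * msq N g"
    by (simp add: nn_integral_add nn_integral_cmult)
  finally show ?thesis .
qed

lemma L2_limit_diff:
  fixes f g :: "'b \<Rightarrow> 'c::euclidean_space" and c :: "'b \<Rightarrow> real"
  assumes [measurable]: "\<And>k. fk k \<in> borel_measurable N" "f \<in> borel_measurable N"
      "\<And>k. gk k \<in> borel_measurable N" "g \<in> borel_measurable N" "c \<in> borel_measurable N"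
    and c: "\<And>x. \<bar>c x\<bar> \<le> 1"
    and lim: "(\<lambda>k. msq N (\<lambda>x. fk k x - f x)) \<longlonglongrightarrow> 0" "(\<lambda>k. msq N (\<lambda>x. gk k x - g x)) \<longlonglongrightarrow> 0"
  shows "(\<lambda>k. msq N (\<lambda>x. c x *\<^sub>R (fk k x - gk k x) - c x *\<^sub>R (f x - g x))) \<longlonglongrightarrow> 0"
proof (rule tendsto_sandwich[OF _ _ tendsto_const])
  show "(\<lambda>k. ennreal 2 * msq N (\<lambda>x. fk k x - f x) + ennreal 2 * msq N (\<lambda>x. gk k x - g x)) \<longlonglongrightarrow> 0"
    using tendsto_add[OF ennreal_tendsto_cmult[OF _ lim(1), of "ennreal 2"] ennreal_tendsto_cmult[OF _ lim(2), of "ennreal 2"]]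
    by simp
  show "\<forall>\<^sub>F k in sequentially. msq N (\<lambda>x. c x *\<^sub>R (fk k x - gk k x) - c x *\<^sub>R (f x - g x))
      \<le> ennreal 2 * msq N (\<lambda>x. fk k x - f x) + ennreal 2 * msq N (\<lambda>x. gk k x - g x)"
  proof (rule always_eventually, rule allI)
    fix k
    have "msq N (\<lambda>x. c x *\<^sub>R (fk k x - gk k x) - c x *\<^sub>R (f x - g x)) \<le> msq N (\<lambda>x. (fk k x - f x) + (g x - gk k x))"
    proof (intro nn_integral_mono ennreal_leI power_mono)
      fix x
      have "c x *\<^sub>R (fk k x - gk k x) - c x *\<^sub>R (f x - g x) = c x *\<^sub>R ((fk k x - f x) + (g x - gk k x))"
        by (simp add: algebra_simps)
      then show "norm (c x *\<^sub>R (fk k x - gk k x) - c x *\<^sub>R (f x - g x)) \<le> norm ((fk k x - f x) + (g x - gk k x))"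
        using c[of x] by (simp add: mult_left_le_one_le)
    qed auto
    also have "\<dots> \<le> ennreal 2 * msq N (\<lambda>x. fk k x - f x) + ennreal 2 * msq N (\<lambda>x. gk k x - g x)"
      using msq_add_le[of "\<lambda>x. fk k x - f x" N "\<lambda>x. g x - gk k x" 1] by (simp add: norm_minus_commute)
    finally show "msq N (\<lambda>x. c x *\<^sub>R (fk k x - gk k x) - c x *\<^sub>R (f x - g x))
      \<le> ennreal 2 * msq N (\<lambda>x. fk k x - f x) + ennreal 2 * msq N (\<lambda>x. gk k x - g x)" .
  qed
qed simp

lemma ennreal_le_lincomb:
  assumes "0 \<le> p" "0 \<le> q" "0 \<le> b" "0 \<le> c" "a \<le> p * b + q * c"
  shows "ennreal a \<le> ennreal p * ennreal b + ennreal q * ennreal c"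
  using assms by (simp flip: ennreal_mult ennreal_plus add: ennreal_leI)

text \<open>
  Stated as an inequality between two different spaces, so that an isometry is obtained by using it
  in both directions. Splitting off \<open>f - fk\<close> and \<open>g - gk\<close> with weights \<open>1 + e\<close> and \<open>1 + 1 / e\<close>
  gives the bound up to the factor \<open>(1 + e)\<^sup>2\<close>, and \<open>e\<close> is arbitrary.
\<close>

lemma L2_limit_mono:
  fixes f :: "'b \<Rightarrow> 'c::euclidean_space" and g :: "'e \<Rightarrow> 'f::euclidean_space"
  assumes f: "\<And>k. fk k \<in> borel_measurable N1" "f \<in> borel_measurable N1"
    and g: "\<And>k. gk k \<in> borel_measurable N2" "g \<in> borel_measurable N2"
    and le: "\<And>k. msq N1 (fk k) \<le> msq N2 (gk k)"
    and lf: "(\<lambda>k. msq N1 (\<lambda>x. fk k x - f x)) \<longlonglongrightarrow> 0"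
    and lg: "(\<lambda>k. msq N2 (\<lambda>x. gk k x - g x)) \<longlonglongrightarrow> 0"
  shows "msq N1 f \<le> msq N2 g" (is "?p \<le> ?q")
proof (cases "?q = \<infinity>")
  case False
  note [measurable] = f g
  define df where "df k = msq N1 (\<lambda>x. fk k x - f x)" for k
  define dg where "dg k = msq N2 (\<lambda>x. gk k x - g x)" for k
  have eps: "?p \<le> ennreal (1 + e) * (ennreal (1 + e) * ?q)" if e: "0 < e" for e
  proof -
    have bound: "?p \<le> ennreal (1 + e) * (ennreal (1 + e) * ?q + ennreal (1 + 1 / e) * dg k) + ennreal (1 + 1 / e) * df k" for k
    proof -
      have "?p \<le> ennreal (1 + e) * msq N1 (fk k) + ennreal (1 + 1 / e) * df k"
        using msq_add_le[of "fk k" N1 "\<lambda>x. f x - fk k x", OF _ _ e]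
        by (simp add: df_def norm_minus_commute)
      moreover have "msq N1 (fk k) \<le> ennreal (1 + e) * ?q + ennreal (1 + 1 / e) * dg k"
        using order_trans[OF le[of k] msq_add_le[of g N2 "\<lambda>x. gk k x - g x", OF _ _ e, simplified]]
        by (simp add: dg_def)
      ultimately show ?thesis
        by (meson add_mono order_refl mult_left_mono order_trans zero_le)
    qed
    have "(\<lambda>k. ennreal (1 + e) * (ennreal (1 + e) * ?q + ennreal (1 + 1 / e) * dg k) + ennreal (1 + 1 / e) * df k)
      \<longlonglongrightarrow> ennreal (1 + e) * (ennreal (1 + e) * ?q + ennreal (1 + 1 / e) * 0) + ennreal (1 + 1 / e) * 0"
      using lf lg unfolding df_def[symmetric] dg_def[symmetric]
      by (intro tendsto_add ennreal_tendsto_cmult tendsto_const) auto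
    from tendsto_lowerbound[OF this eventuallyI[OF bound]] show ?thesis by simp
  qed
  from False obtain q where q: "?q = ennreal q" "0 \<le> q" by (cases ?q) auto
  have "?p \<le> ennreal ((1 + 1 / real (Suc n)) * ((1 + 1 / real (Suc n)) * q))" for n
    using eps[of "1 / real (Suc n)"] q by (simp add: ennreal_mult)
  moreover have "(\<lambda>n. ennreal ((1 + 1 / real (Suc n)) * ((1 + 1 / real (Suc n)) * q))) \<longlonglongrightarrow> ennreal ((1 + 0) * ((1 + 0) * q))"
    by (intro tendsto_ennrealI tendsto_mult tendsto_add tendsto_const LIMSEQ_Suc[OF lim_1_over_n])
  ultimately have "?p \<le> ennreal ((1 + 0) * ((1 + 0) * q))"
    by (rule_tac tendsto_lowerbound[OF _ always_eventually]) auto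
  then show ?thesis using q by simp
qed auto

text \<open>
  By Cauchy-Schwarz the pairing with a fixed square integrable \<open>X\<close> is continuous in mean square.
\<close>

lemma (in prob_space) L2_limit_orthogonal:
  fixes X J :: "'a \<Rightarrow> real"
  assumes [measurable]: "X \<in> borel_measurable M" "J \<in> borel_measurable M" "\<And>k. S k \<in> borel_measurable M"
    and X: "(\<integral>\<^sup>+\<omega>. ennreal ((X \<omega>)\<^sup>2) \<partial>M) < \<infinity>" and J: "(\<integral>\<^sup>+\<omega>. ennreal ((J \<omega>)\<^sup>2) \<partial>M) < \<infinity>"
    and S: "\<And>k. integrable M (\<lambda>\<omega>. X \<omega> * S k \<omega>)" "\<And>k. (\<integral>\<omega>. X \<omega> * S k \<omega> \<partial>M) = 0"
    and lim: "(\<lambda>k. \<integral>\<^sup>+\<omega>. ennreal ((S k \<omega> - J \<omega>)\<^sup>2) \<partial>M) \<longlonglongrightarrow> 0"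
  shows "integrable M (\<lambda>\<omega>. X \<omega> * J \<omega>)" and "(\<integral>\<omega>. X \<omega> * J \<omega> \<partial>M) = 0"
proof -
  show XJ: "integrable M (\<lambda>\<omega>. X \<omega> * J \<omega>)"
    using X J by (intro integrable_times_of_squares) (auto simp: integrable_iff_bounded)
  define x where "x = (\<integral>\<^sup>+\<omega>. ennreal ((X \<omega>)\<^sup>2) \<partial>M)"
  have bound: "(ennreal \<bar>\<integral>\<omega>. X \<omega> * J \<omega> \<partial>M\<bar>)\<^sup>2 \<le> x * (\<integral>\<^sup>+\<omega>. ennreal ((S k \<omega> - J \<omega>)\<^sup>2) \<partial>M)" for k
  proof -
    have "(\<integral>\<omega>. X \<omega> * J \<omega> \<partial>M) = (\<integral>\<omega>. X \<omega> * J \<omega> - X \<omega> * S k \<omega> \<partial>M)"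
      using XJ S by simp
    then have "ennreal \<bar>\<integral>\<omega>. X \<omega> * J \<omega> \<partial>M\<bar> = ennreal (norm (\<integral>\<omega>. X \<omega> * J \<omega> - X \<omega> * S k \<omega> \<partial>M))"
      by simp
    also have "\<dots> \<le> (\<integral>\<^sup>+\<omega>. ennreal (norm (X \<omega> * J \<omega> - X \<omega> * S k \<omega>)) \<partial>M)"
      using XJ S by (intro integral_norm_bound_ennreal) auto
    also have "\<dots> = (\<integral>\<^sup>+\<omega>. ennreal \<bar>X \<omega>\<bar> * ennreal \<bar>S k \<omega> - J \<omega>\<bar> \<partial>M)"
      by (intro nn_integral_cong) (simp flip: ennreal_mult abs_mult right_diff_distrib add: abs_minus_commute)
    finally have "(ennreal \<bar>\<integral>\<omega>. X \<omega> * J \<omega> \<partial>M\<bar>)\<^sup>2 \<le> (\<integral>\<^sup>+\<omega>. ennreal \<bar>X \<omega>\<bar> * ennreal \<bar>S k \<omega> - J \<omega>\<bar> \<partial>M)\<^sup>2"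
      by (intro power_mono) auto
    also have "\<dots> \<le> (\<integral>\<^sup>+\<omega>. ennreal \<bar>X \<omega>\<bar> ^ 2 \<partial>M) * (\<integral>\<^sup>+\<omega>. ennreal \<bar>S k \<omega> - J \<omega>\<bar> ^ 2 \<partial>M)"
      by (rule Cauchy_Schwarz_nn_integral) auto
    finally show ?thesis by (simp add: ennreal_power x_def)
  qed
  have "(\<lambda>k. x * (\<integral>\<^sup>+\<omega>. ennreal ((S k \<omega> - J \<omega>)\<^sup>2) \<partial>M)) \<longlonglongrightarrow> x * 0"
    using X by (intro ennreal_tendsto_cmult lim) (auto simp: x_def)
  from tendsto_lowerbound[OF this eventuallyI[OF bound]]
  have "(ennreal \<bar>\<integral>\<omega>. X \<omega> * J \<omega> \<partial>M\<bar>)\<^sup>2 \<le> 0" by simp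
  then show "(\<integral>\<omega>. X \<omega> * J \<omega> \<partial>M) = 0" by (simp add: ennreal_power)
qed

context brownian
begin

text \<open>
  All that the energy identity uses about the stochastic integral \<open>J\<close> of \<open>V\<close> over \<open>[s, T]\<close>:
  it is orthogonal to the past of \<open>s\<close> and satisfies the conditional isometry.
\<close>

definition ito_rep :: "real \<Rightarrow> real \<Rightarrow> (real \<Rightarrow> 'a \<Rightarrow> real^'d) \<Rightarrow> ('a \<Rightarrow> real) \<Rightarrow> bool" where
  "ito_rep s T V J \<longleftrightarrow> J \<in> borel_measurable M \<and>
    (\<forall>X. X \<in> borel_measurable (F s) \<longrightarrow> (\<integral>\<^sup>+\<omega>. ennreal ((X \<omega>)\<^sup>2) \<partial>M) < \<infinity> \<longrightarrow>
       integrable M (\<lambda>\<omega>. X \<omega> * J \<omega>) \<and> (\<integral>\<omega>. X \<omega> * J \<omega> \<partial>M) = 0) \<and>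
    (\<forall>A\<in>sets (F s). (\<integral>\<^sup>+\<omega>. indicator A \<omega> * ennreal ((J \<omega>)\<^sup>2) \<partial>M) =
       (\<integral>\<^sup>+\<omega>. indicator A \<omega> * (\<integral>\<^sup>+r\<in>{s..T}. ennreal ((norm (V r \<omega>))\<^sup>2) \<partial>lborel) \<partial>M))"

lemma simple_integrand_elementary:
  assumes "simple_integrand M B s T n \<tau> H" "0 \<le> s" "i < n"
  shows "elementary (\<tau> i) (\<tau> (Suc i)) (H i)" "s \<le> \<tau> i" "\<tau> (Suc i) \<le> T"
proof -
  have si: "\<tau> 0 = s" "\<tau> n = T" "\<And>i. i < n \<Longrightarrow> \<tau> i \<le> \<tau> (Suc i)"
    "H i \<in> borel_measurable (F (\<tau> i))" "\<exists>c. \<forall>\<omega>\<in>space M. norm (H i \<omega>) \<le> c"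
    using assms(1,3) unfolding simple_integrand_def by auto
  have ge: "k \<le> n \<Longrightarrow> s \<le> \<tau> k" for k
    by (induction k) (auto intro: order_trans si(3) simp: si(1) Suc_le_eq)
  have le: "k \<le> n \<Longrightarrow> \<tau> (n - k) \<le> T" for k
  proof (induction k)
    case (Suc k)
    then have "n - Suc k < n" "Suc (n - Suc k) = n - k" by auto
    then show ?case using si(3)[of "n - Suc k"] Suc by simp
  qed (simp add: si(2))
  show "s \<le> \<tau> i" using ge assms(3) by simp
  show "\<tau> (Suc i) \<le> T" using le[of "n - Suc i"] assms(3) by simp
  show "elementary (\<tau> i) (\<tau> (Suc i)) (H i)"
    unfolding elementary_def using ge[of i] assms(2,3) si(3)[of i] si(4,5) by simp
qed

lemma simple_integral_eq_sum: "simple_integral B n \<tau> H \<omega> = (\<Sum>i<n. step_integral (\<tau> i) (\<tau> (Suc i)) (H i) \<omega>)"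
  unfolding simple_integral_def step_integral_def ..

lemma simple_difference:
  assumes H: "simple_integrand M B s T n \<tau> H" and H': "simple_integrand M B s T n' \<tau>' H'"
    and s: "0 \<le> s" and A: "A \<in> sets (F s)"
  shows "(\<integral>\<^sup>+\<omega>. ennreal ((norm (indicator A \<omega> * (simple_integral B n \<tau> H \<omega> - simple_integral B n' \<tau>' H' \<omega>)))\<^sup>2) \<partial>M) =
     (\<integral>\<^sup>+\<omega>. (\<integral>\<^sup>+r. ennreal ((norm (indicator A \<omega> *\<^sub>R (simple_process n \<tau> H r \<omega> - simple_process n' \<tau>' H' r \<omega>)))\<^sup>2) \<partial>lborel) \<partial>M)"
    (is ?iso)
    and "X \<in> borel_measurable (F s) \<Longrightarrow> integrable M X \<Longrightarrow>
      integrable M (\<lambda>\<omega>. X \<omega> * (simple_integral B n \<tau> H \<omega> - simple_integral B n' \<tau>' H' \<omega>)) \<and>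
      (\<integral>\<omega>. X \<omega> * (simple_integral B n \<tau> H \<omega> - simple_integral B n' \<tau>' H' \<omega>) \<partial>M) = 0"
proof -
  define N :: "(nat + nat) set" where "N = {..<n} <+> {..<n'}"
  define a where "a = case_sum \<tau> \<tau>'"
  define b where "b = case_sum (\<lambda>i. \<tau> (Suc i)) (\<lambda>i. \<tau>' (Suc i))"
  define G where "G A = case_sum (\<lambda>i \<omega>. indicator A \<omega> *\<^sub>R H i \<omega>) (\<lambda>i \<omega>. - (indicator A \<omega> *\<^sub>R H' i \<omega>))" for A
  note E = simple_integrand_elementary[OF H s] and E' = simple_integrand_elementary[OF H' s]
  have elem_A: "elementary c d (\<lambda>\<omega>. indicator A \<omega> *\<^sub>R K \<omega>) \<and> elementary c d (\<lambda>\<omega>. - (indicator A \<omega> *\<^sub>R K \<omega>))"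
    if e: "elementary c d K" and sc: "s \<le> c" and A: "A \<in> sets (F s)" for c d K A
  proof -
    have [measurable]: "A \<in> sets (F c)" "K \<in> borel_measurable (F c)"
      using sets_F_mono[OF sc] A e by (auto simp: elementary_def)
    obtain x where x: "\<forall>\<omega>\<in>space M. norm (K \<omega>) \<le> x" using e by (auto simp: elementary_def)
    then have "\<forall>\<omega>\<in>space M. norm (indicator A \<omega> *\<^sub>R K \<omega>) \<le> \<bar>x\<bar>"
      by (auto simp: indicator_def intro: order_trans[OF _ abs_ge_self])
    moreover have "(\<lambda>\<omega>. indicator A \<omega> *\<^sub>R K \<omega>) \<in> borel_measurable (F c)" by measurable
    ultimately show ?thesis using e unfolding elementary_def by (auto intro!: exI[of _ "\<bar>x\<bar>"])
  qed
  have fin: "finite N" by (simp add: N_def)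
  have el: "elementary (a i) (b i) (G A i)" if "i \<in> N" "A \<in> sets (F s)" for i A
    using that E E' elem_A unfolding N_def a_def b_def G_def by (auto split: sum.split)
  have sa: "s \<le> a i" if "i \<in> N" for i
    using that E E' unfolding N_def a_def by (auto split: sum.split)
  have sum1: "(\<Sum>i\<in>N. step_integral (a i) (b i) (G A i) \<omega>) =
      indicator A \<omega> * (simple_integral B n \<tau> H \<omega> - simple_integral B n' \<tau>' H' \<omega>)" for \<omega> A
    unfolding N_def simple_integral_def
    by (simp add: sum.Plus a_def b_def G_def step_integral_def sum_distrib_left sum_negf right_diff_distrib)
  have sum2: "(\<Sum>i\<in>N. indicator {a i<..b i} r *\<^sub>R G A i \<omega>) =
      indicator A \<omega> *\<^sub>R (simple_process n \<tau> H r \<omega> - simple_process n' \<tau>' H' r \<omega>)" for r \<omega> A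
    unfolding N_def simple_process_def
    by (simp add: sum.Plus a_def b_def G_def scaleR_sum_right sum_negf scaleR_diff_right mult.commute
        del: sum_indicator_scaleR)
  show ?iso
    using elementary_isometry[of N a b "G A", OF fin] el A unfolding sum1 sum2 by simp
  have top: "space M \<in> sets (F s)" using sets.top[of "F s"] by simp
  show "X \<in> borel_measurable (F s) \<Longrightarrow> integrable M X \<Longrightarrow>
      integrable M (\<lambda>\<omega>. X \<omega> * (simple_integral B n \<tau> H \<omega> - simple_integral B n' \<tau>' H' \<omega>)) \<and>
      (\<integral>\<omega>. X \<omega> * (simple_integral B n \<tau> H \<omega> - simple_integral B n' \<tau>' H' \<omega>) \<partial>M) = 0"
  proof -
    assume X: "X \<in> borel_measurable (F s)" "integrable M X"
    have ind: "\<omega> \<in> space M \<Longrightarrow> X \<omega> * (indicator (space M) \<omega> * (simple_integral B n \<tau> H \<omega> - simple_integral B n' \<tau>' H' \<omega>)) =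
       X \<omega> * (simple_integral B n \<tau> H \<omega> - simple_integral B n' \<tau>' H' \<omega>)" for \<omega>
      by simp
    show ?thesis
      using elementary_orthogonal[of N a b "G (space M)" s X, OF fin _ sa X] el top unfolding sum1
      by (simp add: ind cong: Bochner_Integration.integrable_cong Bochner_Integration.integral_cong)
  qed
qed

lemma simple_measurable:
  assumes "simple_integrand M B s T n \<tau> H" "0 \<le> s"
  shows "simple_integral B n \<tau> H \<in> borel_measurable M"
    and "(\<lambda>(r, \<omega>). simple_process n \<tau> H r \<omega>) \<in> borel_measurable (lborel \<Otimes>\<^sub>M M)"
proof -
  note E = simple_integrand_elementary[OF assms]
  have [measurable]: "step_integral (\<tau> i) (\<tau> (Suc i)) (H i) \<in> borel_measurable M" if "i < n" for i
    using step_integral_measurable[OF E(1)] that by blast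
  have [measurable]: "H i \<in> borel_measurable M" if "i < n" for i
    using E(1)[OF that] unfolding elementary_def by (blast intro: measurable_F_M)
  show "simple_integral B n \<tau> H \<in> borel_measurable M"
    unfolding simple_integral_eq_sum[abs_def] by measurable
  show "(\<lambda>(r, \<omega>). simple_process n \<tau> H r \<omega>) \<in> borel_measurable (lborel \<Otimes>\<^sub>M M)"
    unfolding simple_process_def by measurable
qed

lemma ito_rep_difference:
  assumes s: "0 \<le> s"
    and I: "has_ito_integral M B s T Z I" and I': "has_ito_integral M B s T Z' I'"
    and Z: "(\<lambda>(r, \<omega>). indicator {s..T} r *\<^sub>R Z r \<omega>) \<in> borel_measurable (lborel \<Otimes>\<^sub>M M)"
    and Z': "(\<lambda>(r, \<omega>). indicator {s..T} r *\<^sub>R Z' r \<omega>) \<in> borel_measurable (lborel \<Otimes>\<^sub>M M)"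
    and fin: "(\<integral>\<^sup>+\<omega>. (\<integral>\<^sup>+r\<in>{s..T}. ennreal ((norm (Z r \<omega> - Z' r \<omega>))\<^sup>2) \<partial>lborel) \<partial>M) < \<infinity>"
  shows "ito_rep s T (\<lambda>r \<omega>. Z r \<omega> - Z' r \<omega>) (\<lambda>\<omega>. I \<omega> - I' \<omega>)"
proof -
  obtain n \<tau> H where H: "\<And>k::nat. simple_integrand M B s T (n k) (\<tau> k) (H k)"
    and HZ: "(\<lambda>k. \<integral>\<^sup>+\<omega>. (\<integral>\<^sup>+r\<in>{s..T}. ennreal ((norm (simple_process (n k) (\<tau> k) (H k) r \<omega> - Z r \<omega>))\<^sup>2) \<partial>lborel) \<partial>M) \<longlonglongrightarrow> 0"
    and HI: "(\<lambda>k. \<integral>\<^sup>+\<omega>. ennreal ((simple_integral B (n k) (\<tau> k) (H k) \<omega> - I \<omega>)\<^sup>2) \<partial>M) \<longlonglongrightarrow> 0"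
    and [measurable]: "I \<in> borel_measurable M"
    using I unfolding has_ito_integral_def by blast
  obtain n' \<tau>' H' where H': "\<And>k::nat. simple_integrand M B s T (n' k) (\<tau>' k) (H' k)"
    and HZ': "(\<lambda>k. \<integral>\<^sup>+\<omega>. (\<integral>\<^sup>+r\<in>{s..T}. ennreal ((norm (simple_process (n' k) (\<tau>' k) (H' k) r \<omega> - Z' r \<omega>))\<^sup>2) \<partial>lborel) \<partial>M) \<longlonglongrightarrow> 0"
    and HI': "(\<lambda>k. \<integral>\<^sup>+\<omega>. ennreal ((simple_integral B (n' k) (\<tau>' k) (H' k) \<omega> - I' \<omega>)\<^sup>2) \<partial>M) \<longlonglongrightarrow> 0"
    and [measurable]: "I' \<in> borel_measurable M"
    using I' unfolding has_ito_integral_def by blast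
  define S where "S k \<omega> = simple_integral B (n k) (\<tau> k) (H k) \<omega>" for k \<omega>
  define S' where "S' k \<omega> = simple_integral B (n' k) (\<tau>' k) (H' k) \<omega>" for k \<omega>
  define P where "P k r \<omega> = simple_process (n k) (\<tau> k) (H k) r \<omega>" for k r \<omega>
  define P' where "P' k r \<omega> = simple_process (n' k) (\<tau>' k) (H' k) r \<omega>" for k r \<omega>
  define zh where "zh r \<omega> = indicator {s..T} r *\<^sub>R Z r \<omega>" for r \<omega>
  define zh' where "zh' r \<omega> = indicator {s..T} r *\<^sub>R Z' r \<omega>" for r \<omega>
  have [measurable]: "S k \<in> borel_measurable M" "S' k \<in> borel_measurable M"
      "joint M (P k)" "joint M (P' k)" for k
    using simple_measurable[OF H s] simple_measurable[OF H' s] by (simp_all add: S_def[abs_def] S'_def[abs_def] P_def[abs_def] P'_def[abs_def])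
  have [measurable]: "joint M zh" "joint M zh'"
    using Z Z' by (simp_all add: zh_def[abs_def] zh'_def[abs_def])
  have P_out: "P k r \<omega> = 0" "P' k r \<omega> = 0" if "r \<notin> {s..T}" for k r \<omega>
    using that simple_integrand_elementary(2,3)[OF H s] simple_integrand_elementary(2,3)[OF H' s]
    unfolding P_def P'_def simple_process_def
    by (force intro!: sum.neutral simp: indicator_def)+
  define Q where "Q = M \<Otimes>\<^sub>M (lborel :: real measure)"
  have iter: "msq Q (\<lambda>(\<omega>, r). h r \<omega>) = (\<integral>\<^sup>+\<omega>. \<integral>\<^sup>+r. ennreal ((norm (h r \<omega>))\<^sup>2) \<partial>lborel \<partial>M)"
    if [measurable]: "joint M h" for h :: "real \<Rightarrow> 'a \<Rightarrow> real^'d"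
    unfolding Q_def by (subst lborel.nn_integral_fst[symmetric]) auto
  have P_lim: "(\<lambda>k. msq Q (\<lambda>p. (\<lambda>(\<omega>, r). P k r \<omega>) p - (\<lambda>(\<omega>, r). zh r \<omega>) p)) \<longlonglongrightarrow> 0"
  proof -
    have "msq Q (\<lambda>p. (\<lambda>(\<omega>, r). P k r \<omega>) p - (\<lambda>(\<omega>, r). zh r \<omega>) p) =
        (\<integral>\<^sup>+\<omega>. (\<integral>\<^sup>+r\<in>{s..T}. ennreal ((norm (P k r \<omega> - Z r \<omega>))\<^sup>2) \<partial>lborel) \<partial>M)" for k
      using iter[of "\<lambda>r \<omega>. P k r \<omega> - zh r \<omega>"]
      by (simp add: split_beta') (auto intro!: nn_integral_cong simp: zh_def indicator_def P_out)
    then show ?thesis using HZ unfolding P_def by simp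
  qed
  have P'_lim: "(\<lambda>k. msq Q (\<lambda>p. (\<lambda>(\<omega>, r). P' k r \<omega>) p - (\<lambda>(\<omega>, r). zh' r \<omega>) p)) \<longlonglongrightarrow> 0"
  proof -
    have "msq Q (\<lambda>p. (\<lambda>(\<omega>, r). P' k r \<omega>) p - (\<lambda>(\<omega>, r). zh' r \<omega>) p) =
        (\<integral>\<^sup>+\<omega>. (\<integral>\<^sup>+r\<in>{s..T}. ennreal ((norm (P' k r \<omega> - Z' r \<omega>))\<^sup>2) \<partial>lborel) \<partial>M)" for k
      using iter[of "\<lambda>r \<omega>. P' k r \<omega> - zh' r \<omega>"]
      by (simp add: split_beta') (auto intro!: nn_integral_cong simp: zh'_def indicator_def P_out)
    then show ?thesis using HZ' unfolding P'_def by simp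
  qed
  have S_lim: "(\<lambda>k. msq M (\<lambda>\<omega>. S k \<omega> - I \<omega>)) \<longlonglongrightarrow> 0" "(\<lambda>k. msq M (\<lambda>\<omega>. S' k \<omega> - I' \<omega>)) \<longlonglongrightarrow> 0"
    using HI HI' by (simp_all add: S_def S'_def)
  have iso: "(\<integral>\<^sup>+\<omega>. indicator A \<omega> * ennreal ((I \<omega> - I' \<omega>)\<^sup>2) \<partial>M) =
       (\<integral>\<^sup>+\<omega>. indicator A \<omega> * (\<integral>\<^sup>+r\<in>{s..T}. ennreal ((norm (Z r \<omega> - Z' r \<omega>))\<^sup>2) \<partial>lborel) \<partial>M)"
    if A: "A \<in> sets (F s)" for A
  proof -
    have [measurable]: "A \<in> sets M" using A sets_F_subset by auto
    define fk where "fk k \<omega> = indicator A \<omega> *\<^sub>R (S k \<omega> - S' k \<omega>)" for k \<omega>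
    define f where "f \<omega> = indicator A \<omega> *\<^sub>R (I \<omega> - I' \<omega>)" for \<omega>
    define gk where "gk k = (\<lambda>(\<omega>, r). indicator A \<omega> *\<^sub>R (P k r \<omega> - P' k r \<omega>))" for k
    define h where "h = (\<lambda>(\<omega>, r). indicator A \<omega> *\<^sub>R (zh r \<omega> - zh' r \<omega>))"
    have m: "fk k \<in> borel_measurable M" "f \<in> borel_measurable M" "gk k \<in> borel_measurable Q" "h \<in> borel_measurable Q" for k
      unfolding fk_def[abs_def] f_def[abs_def] gk_def h_def Q_def by measurable
    have eq: "msq M (fk k) = msq Q (gk k)" for k
    proof -
      have "msq Q (gk k) = (\<integral>\<^sup>+\<omega>. \<integral>\<^sup>+r. ennreal ((norm (indicator A \<omega> *\<^sub>R (P k r \<omega> - P' k r \<omega>)))\<^sup>2) \<partial>lborel \<partial>M)"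
        unfolding gk_def by (rule iter) measurable
      then show ?thesis
        using simple_difference(1)[OF H H' s A, of k k] by (simp add: fk_def S_def S'_def P_def P'_def)
    qed
    have "(\<lambda>k. msq M (\<lambda>\<omega>. fk k \<omega> - f \<omega>)) \<longlonglongrightarrow> 0"
      unfolding fk_def f_def by (rule L2_limit_diff[OF _ _ _ _ _ _ S_lim]) (auto simp: indicator_def)
    moreover have "(\<lambda>k. msq Q (\<lambda>p. gk k p - h p)) \<longlonglongrightarrow> 0"
      using L2_limit_diff[OF _ _ _ _ _ _ P_lim P'_lim, of "\<lambda>p. indicator A (fst p)"]
      by (simp add: gk_def h_def split_beta' Q_def indicator_def)
    moreover note m eq
    ultimately have "msq M f = msq Q h"
      by (intro antisym; rule_tac L2_limit_mono) auto
    also have "\<dots> = (\<integral>\<^sup>+\<omega>. \<integral>\<^sup>+r. ennreal ((norm (indicator A \<omega> *\<^sub>R (zh r \<omega> - zh' r \<omega>)))\<^sup>2) \<partial>lborel \<partial>M)"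
      unfolding h_def by (rule iter) measurable
    also have "\<dots> = (\<integral>\<^sup>+\<omega>. indicator A \<omega> * (\<integral>\<^sup>+r\<in>{s..T}. ennreal ((norm (Z r \<omega> - Z' r \<omega>))\<^sup>2) \<partial>lborel) \<partial>M)"
    proof (rule nn_integral_cong)
      fix \<omega>
      show "(\<integral>\<^sup>+r. ennreal ((norm (indicator A \<omega> *\<^sub>R (zh r \<omega> - zh' r \<omega>)))\<^sup>2) \<partial>lborel) =
        indicator A \<omega> * (\<integral>\<^sup>+r\<in>{s..T}. ennreal ((norm (Z r \<omega> - Z' r \<omega>))\<^sup>2) \<partial>lborel)"
        by (cases "\<omega> \<in> A") (auto intro!: nn_integral_cong simp: zh_def zh'_def indicator_def)
    qed
    moreover have "ennreal ((norm (f \<omega>))\<^sup>2) = indicator A \<omega> * ennreal ((I \<omega> - I' \<omega>)\<^sup>2)" for \<omega>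
      by (cases "\<omega> \<in> A") (auto simp: f_def)
    ultimately show ?thesis by simp
  qed
  have top: "space M \<in> sets (F s)" using sets.top[of "F s"] by simp
  have J_fin: "(\<integral>\<^sup>+\<omega>. ennreal ((I \<omega> - I' \<omega>)\<^sup>2) \<partial>M) < \<infinity>"
    using iso[OF top] fin by (simp cong: nn_integral_cong)
  have orth: "integrable M (\<lambda>\<omega>. X \<omega> * (I \<omega> - I' \<omega>)) \<and> (\<integral>\<omega>. X \<omega> * (I \<omega> - I' \<omega>) \<partial>M) = 0"
    if X: "X \<in> borel_measurable (F s)" "(\<integral>\<^sup>+\<omega>. ennreal ((X \<omega>)\<^sup>2) \<partial>M) < \<infinity>" for X
  proof -
    have Xm: "X \<in> borel_measurable M" by (rule measurable_F_M[OF X(1)])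
    have Xi: "integrable M X"
      using Xm X(2) by (rule_tac square_integrable_imp_integrable) (auto simp: integrable_iff_bounded)
    have o: "integrable M (\<lambda>\<omega>. X \<omega> * (S k \<omega> - S' k \<omega>))" "(\<integral>\<omega>. X \<omega> * (S k \<omega> - S' k \<omega>) \<partial>M) = 0" for k
      using simple_difference(2)[OF H H' s top X(1) Xi] unfolding S_def S'_def by auto
    have l: "(\<lambda>k. \<integral>\<^sup>+\<omega>. ennreal (((S k \<omega> - S' k \<omega>) - (I \<omega> - I' \<omega>))\<^sup>2) \<partial>M) \<longlonglongrightarrow> 0"
      using L2_limit_diff[OF _ _ _ _ _ _ S_lim, of "\<lambda>_. 1"] by simp
    show ?thesis
      using L2_limit_orthogonal[OF Xm _ _ X(2) J_fin o l] by simp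
  qed
  show ?thesis
    unfolding ito_rep_def using iso orth by auto
qed

end

section \<open>The energy identity\<close>

text \<open>
  Fubini on the triangle \<open>s \<le> r\<close>.
\<close>

lemma triangle_swap:
  fixes f g :: "real \<Rightarrow> real"
  assumes f: "integrable lborel f" and g: "integrable lborel g"
  shows "(\<integral>s. f s * (\<integral>r. indicator {s..} r * g r \<partial>lborel) \<partial>lborel) = (\<integral>r. g r * (\<integral>s. indicator {..r} s * f s \<partial>lborel) \<partial>lborel)"
    and "integrable lborel (\<lambda>s. f s * (\<integral>r. indicator {s..} r * g r \<partial>lborel))"
    and "integrable lborel (\<lambda>r. g r * (\<integral>s. indicator {..r} s * f s \<partial>lborel))"
proof -
  have [measurable]: "f \<in> borel_measurable borel" "g \<in> borel_measurable borel" using f g by auto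
  define h where "h s r = (if s \<le> r then f s * g r else 0)" for s r
  have [measurable]: "case_prod h \<in> borel_measurable (lborel \<Otimes>\<^sub>M lborel)"
    unfolding h_def by measurable
  have int: "integrable (lborel \<Otimes>\<^sub>M lborel) (case_prod h)"
  proof (rule Bochner_Integration.integrable_bound)
    show "integrable (lborel \<Otimes>\<^sub>M lborel) (\<lambda>(s, r). f s * g r)"
    proof (rule lborel_pair.Fubini_integrable)
      show "integrable lborel (\<lambda>x. \<integral>y. norm (case (x, y) of (s, r) \<Rightarrow> f s * g r) \<partial>lborel)"
        using f g by (simp add: abs_mult)
    qed (use f g in auto)
  qed (auto simp: h_def)
  have 1: "f s * (\<integral>r. indicator {s..} r * g r \<partial>lborel) = (\<integral>r. h s r \<partial>lborel)" for s
  proof -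
    have "f s * (\<integral>r. indicator {s..} r * g r \<partial>lborel) = (\<integral>r. f s * (indicator {s..} r * g r) \<partial>lborel)"
      by simp
    also have "\<dots> = (\<integral>r. h s r \<partial>lborel)"
      by (intro Bochner_Integration.integral_cong) (auto simp: h_def indicator_def)
    finally show ?thesis .
  qed
  have 2: "g r * (\<integral>s. indicator {..r} s * f s \<partial>lborel) = (\<integral>s. h s r \<partial>lborel)" for r
  proof -
    have "g r * (\<integral>s. indicator {..r} s * f s \<partial>lborel) = (\<integral>s. g r * (indicator {..r} s * f s) \<partial>lborel)"
      by simp
    also have "\<dots> = (\<integral>s. h s r \<partial>lborel)"
      by (intro Bochner_Integration.integral_cong) (auto simp: h_def indicator_def)
    finally show ?thesis .
  qed
  show "(\<integral>s. f s * (\<integral>r. indicator {s..} r * g r \<partial>lborel) \<partial>lborel) = (\<integral>r. g r * (\<integral>s. indicator {..r} s * f s \<partial>lborel) \<partial>lborel)"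
    unfolding 1 2 using lborel_pair.Fubini_integral[OF int] by simp
  show "integrable lborel (\<lambda>s. f s * (\<integral>r. indicator {s..} r * g r \<partial>lborel))"
    unfolding 1 using lborel_pair.integrable_fst[OF int] by simp
  show "integrable lborel (\<lambda>r. g r * (\<integral>s. indicator {..r} s * f s \<partial>lborel))"
    unfolding 2 using lborel_pair.integrable_snd[OF int] by simp
qed

text \<open>
  The square is cut along its diagonal into two triangles of equal weight.
\<close>

lemma square_of_integral:
  fixes f :: "real \<Rightarrow> real"
  assumes f: "integrable lborel f"
  shows "(\<integral>r. f r \<partial>lborel)\<^sup>2 = 2 * (\<integral>s. f s * (\<integral>r. indicator {s..} r * f r \<partial>lborel) \<partial>lborel)"
proof -
  have split: "(\<integral>r. indicator {s..} r * f r \<partial>lborel) + (\<integral>r. indicator {..s} r * f r \<partial>lborel) = (\<integral>r. f r \<partial>lborel)" for s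
  proof -
    have i: "integrable lborel (\<lambda>r. indicator {s..} r * f r)" "integrable lborel (\<lambda>r. indicator {..s} r * f r)"
      using integrable_mult_indicator[OF _ f, of "{s..}"] integrable_mult_indicator[OF _ f, of "{..s}"] by auto
    have "(\<integral>r. indicator {s..} r * f r \<partial>lborel) + (\<integral>r. indicator {..s} r * f r \<partial>lborel) =
        (\<integral>r. indicator {s..} r * f r + indicator {..s} r * f r \<partial>lborel)"
      using i by simp
    also have "\<dots> = (\<integral>r. f r \<partial>lborel)"
      using i f AE_lborel_singleton[of s]
      by (intro integral_cong_AE) (auto simp: indicator_def elim!: eventually_mono)
    finally show ?thesis .
  qed
  have "2 * (\<integral>s. f s * (\<integral>r. indicator {s..} r * f r \<partial>lborel) \<partial>lborel) =
      (\<integral>s. f s * (\<integral>r. indicator {s..} r * f r \<partial>lborel) \<partial>lborel) + (\<integral>s. f s * (\<integral>r. indicator {..s} r * f r \<partial>lborel) \<partial>lborel)"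
    using triangle_swap(1)[OF f f] by simp
  also have "\<dots> = (\<integral>s. f s * (\<integral>r. indicator {s..} r * f r \<partial>lborel) + f s * (\<integral>r. indicator {..s} r * f r \<partial>lborel) \<partial>lborel)"
    using triangle_swap(2,3)[OF f f] by simp
  also have "\<dots> = (\<integral>s. f s * (\<integral>r. f r \<partial>lborel) \<partial>lborel)"
    unfolding distrib_left[symmetric] split ..
  finally show ?thesis by (simp add: power2_eq_square)
qed

lemma integrable_square_add:
  fixes f g :: "'b \<Rightarrow> real"
  assumes [measurable]: "f \<in> borel_measurable N" "g \<in> borel_measurable N"
    and "integrable N (\<lambda>x. (f x)\<^sup>2)" "integrable N (\<lambda>x. (g x)\<^sup>2)"
  shows "integrable N (\<lambda>x. (f x + g x)\<^sup>2)"
  unfolding power2_sum using assms integrable_times_of_squares[OF assms]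
  by (auto simp: mult.assoc)

text \<open>
  The energy equality that is usually read off from the Ito formula for \<open>U\<^sup>2\<close>. Write the equation
  as \<open>U s + J s = \<Xi> + \<Phi> s\<close> with \<open>\<Phi> s\<close> the integral of \<open>f\<close> over \<open>[s, T]\<close>. On the left, \<open>U s\<close> and
  \<open>J s\<close> are orthogonal, so the second moment is that of \<open>U s\<close> plus that of \<open>J s\<close>. The right-hand
  side is absolutely continuous in \<open>s\<close>, so its square is \<open>\<Xi>\<^sup>2\<close> plus twice the integral of
  \<open>f r * (\<Xi> + \<Phi> r)\<close>; there \<open>\<Xi> + \<Phi> r = U r + J r\<close>, and \<open>J r\<close> is again orthogonal to \<open>f r\<close>.
\<close>

lemma (in prob_space) energy_identity:
  fixes f U J :: "real \<Rightarrow> 'a \<Rightarrow> real" and v :: "real \<Rightarrow> real"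
  assumes tT: "t < T"
    and f [measurable]: "joint M f"
    and f_out: "\<And>r \<omega>. r \<notin> {t..T} \<Longrightarrow> f r \<omega> = 0"
    and f2: "dint M (\<lambda>r \<omega>. (f r \<omega>)\<^sup>2) < \<infinity>"
    and \<Xi> [measurable]: "\<Xi> \<in> borel_measurable M" and \<Xi>2: "integrable M (\<lambda>\<omega>. (\<Xi> \<omega>)\<^sup>2)"
    and U [measurable]: "joint M U"
    and J [measurable]: "\<And>s. s \<in> {t..<T} \<Longrightarrow> J s \<in> borel_measurable M"
    and J2: "\<And>s. s \<in> {t..<T} \<Longrightarrow> integrable M (\<lambda>\<omega>. (J s \<omega>)\<^sup>2)"
      "\<And>s. s \<in> {t..<T} \<Longrightarrow> (\<integral>\<omega>. (J s \<omega>)\<^sup>2 \<partial>M) = (\<integral>r. indicator {s..} r * v r \<partial>lborel)"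
    and UJ: "\<And>s. s \<in> {t..<T} \<Longrightarrow> integrable M (\<lambda>\<omega>. (U s \<omega>)\<^sup>2) \<Longrightarrow> (\<integral>\<omega>. U s \<omega> * J s \<omega> \<partial>M) = 0"
    and fJ: "\<And>s. s \<in> {t..<T} \<Longrightarrow> integrable M (\<lambda>\<omega>. (f s \<omega>)\<^sup>2) \<Longrightarrow> (\<integral>\<omega>. f s \<omega> * J s \<omega> \<partial>M) = 0"
    and eq: "\<And>s. s \<in> {t..<T} \<Longrightarrow> AE \<omega> in M. U s \<omega> = \<Xi> \<omega> + (\<integral>r. indicator {s..} r * f r \<omega> \<partial>lborel) - J s \<omega>"
    and v: "integrable lborel v"
  shows "integrable lborel (\<lambda>r. \<integral>\<omega>. f r \<omega> * U r \<omega> \<partial>M)"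
    and "AE r in lborel. integrable M (\<lambda>\<omega>. f r \<omega> * U r \<omega>)"
    and "s \<in> {t..<T} \<Longrightarrow> integrable M (\<lambda>\<omega>. (U s \<omega>)\<^sup>2)"
    and "s \<in> {t..<T} \<Longrightarrow> (\<integral>\<omega>. (U s \<omega>)\<^sup>2 \<partial>M) =
      (\<integral>\<omega>. (\<Xi> \<omega>)\<^sup>2 \<partial>M) + (\<integral>r. indicator {s..} r * (2 * (\<integral>\<omega>. f r \<omega> * U r \<omega> \<partial>M) - v r) \<partial>lborel)"
proof -
  interpret P: pair_sigma_finite "lborel :: real measure" M ..
  define \<Phi> where "\<Phi> s \<omega> = (\<integral>r. indicator {s..} r * f r \<omega> \<partial>lborel)" for s \<omega>
  define R where "R \<omega> = (\<integral>\<^sup>+r. ennreal \<bar>f r \<omega>\<bar> \<partial>lborel)" for \<omega>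
  have [measurable]: "R \<in> borel_measurable M" unfolding R_def[abs_def] by measurable
  have ind: "indicator {s..} r * x = (if s \<le> r then x else 0 :: real)" for s r x :: real
    by (simp add: indicator_def)
  have [measurable]: "joint M \<Phi>"
    unfolding \<Phi>_def ind by measurable
  have R2: "(\<integral>\<^sup>+\<omega>. (R \<omega>)\<^sup>2 \<partial>M) < \<infinity>"
  proof -
    have "(R \<omega>)\<^sup>2 \<le> ennreal (T - t) * (\<integral>\<^sup>+r. ennreal ((f r \<omega>)\<^sup>2) \<partial>lborel)" if [simp]: "\<omega> \<in> space M" for \<omega>
    proof -
      have "R \<omega> = (\<integral>\<^sup>+r. indicator {t..T} r * ennreal \<bar>f r \<omega>\<bar> \<partial>lborel)"
        unfolding R_def by (intro nn_integral_cong) (auto simp: indicator_def f_out)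
      then have "(R \<omega>)\<^sup>2 \<le> (\<integral>\<^sup>+r. (indicator {t..T} r)\<^sup>2 \<partial>lborel) * (\<integral>\<^sup>+r. ennreal \<bar>f r \<omega>\<bar> ^ 2 \<partial>lborel)"
        by (simp add: Cauchy_Schwarz_nn_integral)
      also have "(\<integral>\<^sup>+r. (indicator {t..T} r :: ennreal)\<^sup>2 \<partial>lborel) = (\<integral>\<^sup>+r. indicator {t..T} r \<partial>lborel)"
        by (intro nn_integral_cong) (auto simp: indicator_def)
      finally show ?thesis using tT by (simp add: ennreal_power)
    qed
    then have "(\<integral>\<^sup>+\<omega>. (R \<omega>)\<^sup>2 \<partial>M) \<le> (\<integral>\<^sup>+\<omega>. ennreal (T - t) * (\<integral>\<^sup>+r. ennreal ((f r \<omega>)\<^sup>2) \<partial>lborel) \<partial>M)"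
      by (intro nn_integral_mono) auto
    also have "\<dots> = ennreal (T - t) * dint M (\<lambda>r \<omega>. (f r \<omega>)\<^sup>2)"
      by (rule nn_integral_cmult) measurable
    also have "\<dots> < \<infinity>" using f2 by (auto simp: ennreal_mult_less_top)
    finally show ?thesis .
  qed
  have R_fin: "AE \<omega> in M. R \<omega> < \<infinity>"
  proof -
    have "AE \<omega> in M. (R \<omega>)\<^sup>2 \<noteq> \<infinity>" using R2 by (intro nn_integral_PInf_AE) auto
    then show ?thesis by eventually_elim (auto simp: power_eq_top_ennreal less_top)
  qed
  have f_int: "AE \<omega> in M. integrable lborel (\<lambda>r. f r \<omega>)"
    using R_fin AE_space
  proof eventually_elim
    case (elim \<omega>)
    then show ?case by (auto simp: integrable_iff_bounded R_def)
  qed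
  have \<Phi>_le: "ennreal \<bar>\<Phi> s \<omega>\<bar> \<le> R \<omega>" if [simp]: "\<omega> \<in> space M" for s \<omega>
  proof (cases "integrable lborel (\<lambda>r. indicator {s..} r * f r \<omega>)")
    case True
    have "ennreal \<bar>\<Phi> s \<omega>\<bar> \<le> (\<integral>\<^sup>+r. ennreal (norm (indicator {s..} r * f r \<omega>)) \<partial>lborel)"
      unfolding \<Phi>_def using integral_norm_bound_ennreal[OF True] by simp
    also have "\<dots> \<le> R \<omega>"
      unfolding R_def by (intro nn_integral_mono) (auto simp: indicator_def)
    finally show ?thesis .
  qed (simp add: \<Phi>_def not_integrable_integral_eq)
  have \<Phi>_m: "\<Phi> s \<in> borel_measurable M" for s by measurable
  have \<Phi>2: "integrable M (\<lambda>\<omega>. (\<Phi> s \<omega>)\<^sup>2)" for s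
  proof -
    have "(\<integral>\<^sup>+\<omega>. ennreal ((\<Phi> s \<omega>)\<^sup>2) \<partial>M) \<le> (\<integral>\<^sup>+\<omega>. (R \<omega>)\<^sup>2 \<partial>M)"
    proof (rule nn_integral_mono)
      fix \<omega> assume "\<omega> \<in> space M"
      from power_mono[OF \<Phi>_le[OF this, of s], of 2]
      show "ennreal ((\<Phi> s \<omega>)\<^sup>2) \<le> (R \<omega>)\<^sup>2" by (simp add: ennreal_power)
    qed
    with R2 show ?thesis by (auto simp: integrable_iff_bounded)
  qed
  define G where "G r \<omega> = f r \<omega> * (\<Xi> \<omega> + \<Phi> r \<omega>)" for r \<omega>
  have [measurable]: "joint M G" unfolding G_def by measurable
  have G_int: "integrable (lborel \<Otimes>\<^sub>M M) (case_prod G)"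
  proof -
    have "(\<integral>\<^sup>+p. ennreal (norm (case_prod G p)) \<partial>(lborel \<Otimes>\<^sub>M M)) = (\<integral>\<^sup>+\<omega>. \<integral>\<^sup>+r. ennreal \<bar>G r \<omega>\<bar> \<partial>lborel \<partial>M)"
      by (subst P.nn_integral_snd[symmetric]) auto
    also have "\<dots> \<le> (\<integral>\<^sup>+\<omega>. \<integral>\<^sup>+r. ennreal \<bar>f r \<omega>\<bar> * (ennreal \<bar>\<Xi> \<omega>\<bar> + R \<omega>) \<partial>lborel \<partial>M)"
    proof (intro nn_integral_mono)
      fix \<omega> r assume \<omega>: "\<omega> \<in> space M"
      have "ennreal \<bar>G r \<omega>\<bar> \<le> ennreal (\<bar>f r \<omega>\<bar> * (\<bar>\<Xi> \<omega>\<bar> + \<bar>\<Phi> r \<omega>\<bar>))"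
        unfolding G_def by (intro ennreal_leI) (simp add: abs_mult mult_left_mono)
      also have "\<dots> = ennreal \<bar>f r \<omega>\<bar> * (ennreal \<bar>\<Xi> \<omega>\<bar> + ennreal \<bar>\<Phi> r \<omega>\<bar>)"
        by (simp add: ennreal_mult)
      also have "\<dots> \<le> ennreal \<bar>f r \<omega>\<bar> * (ennreal \<bar>\<Xi> \<omega>\<bar> + R \<omega>)"
        by (intro mult_left_mono add_left_mono \<Phi>_le \<omega>) auto
      finally show "ennreal \<bar>G r \<omega>\<bar> \<le> ennreal \<bar>f r \<omega>\<bar> * (ennreal \<bar>\<Xi> \<omega>\<bar> + R \<omega>)" .
    qed
    also have "\<dots> = (\<integral>\<^sup>+\<omega>. R \<omega> * (ennreal \<bar>\<Xi> \<omega>\<bar> + R \<omega>) \<partial>M)"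
      unfolding R_def by (intro nn_integral_cong nn_integral_multc) measurable
    also have "\<dots> \<le> (\<integral>\<^sup>+\<omega>. 2 * (R \<omega>)\<^sup>2 + ennreal ((\<Xi> \<omega>)\<^sup>2) \<partial>M)"
    proof (intro nn_integral_mono)
      fix \<omega>
      have "R \<omega> * x \<le> (R \<omega>)\<^sup>2 + x\<^sup>2" for x :: ennreal
      proof (cases "R \<omega> \<le> x")
        case True
        then have "R \<omega> * x \<le> x\<^sup>2" unfolding power2_eq_square by (rule mult_right_mono) simp
        then show ?thesis by (rule add_increasing[OF zero_le])
      next
        case False
        then have "R \<omega> * x \<le> (R \<omega>)\<^sup>2" unfolding power2_eq_square by (intro mult_left_mono) auto
        then show ?thesis by (rule add_increasing2[OF zero_le])
      qed
      from this[of "ennreal \<bar>\<Xi> \<omega>\<bar>"]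
      have "R \<omega> * (ennreal \<bar>\<Xi> \<omega>\<bar> + R \<omega>) \<le> ((R \<omega>)\<^sup>2 + ennreal \<bar>\<Xi> \<omega>\<bar> ^ 2) + (R \<omega>)\<^sup>2"
        unfolding distrib_left power2_eq_square[of "R \<omega>", symmetric] by (rule add_right_mono)
      also have "\<dots> = 2 * (R \<omega>)\<^sup>2 + ennreal ((\<Xi> \<omega>)\<^sup>2)"
        by (simp add: ennreal_power mult_2 ac_simps)
      finally show "R \<omega> * (ennreal \<bar>\<Xi> \<omega>\<bar> + R \<omega>) \<le> 2 * (R \<omega>)\<^sup>2 + ennreal ((\<Xi> \<omega>)\<^sup>2)" .
    qed
    also have "\<dots> = 2 * (\<integral>\<^sup>+\<omega>. (R \<omega>)\<^sup>2 \<partial>M) + (\<integral>\<^sup>+\<omega>. ennreal ((\<Xi> \<omega>)\<^sup>2) \<partial>M)"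
      by (simp add: nn_integral_add nn_integral_cmult)
    also have "\<dots> < \<infinity>"
      using R2 \<Xi>2 by (auto simp: integrable_iff_bounded ennreal_mult_less_top)
    finally show ?thesis by (simp add: integrable_iff_bounded)
  qed
  have U_m: "U s \<in> borel_measurable M" for s by measurable
  have f_m: "f s \<in> borel_measurable M" for s by measurable
  have \<Xi>\<Phi>2: "integrable M (\<lambda>\<omega>. (\<Xi> \<omega> + \<Phi> s \<omega>)\<^sup>2)" for s
    by (intro integrable_square_add \<Phi>_m \<Phi>2 \<Xi> \<Xi>2)
  have U2: "integrable M (\<lambda>\<omega>. (U s \<omega>)\<^sup>2)" if s: "s \<in> {t..<T}" for s
  proof -
    have "integrable M (\<lambda>\<omega>. ((\<Xi> \<omega> + \<Phi> s \<omega>) + - J s \<omega>)\<^sup>2)"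
      using J[OF s] J2(1)[OF s] \<Phi>_m[of s] by (intro integrable_square_add \<Xi>\<Phi>2) auto
    moreover have "AE \<omega> in M. (\<Xi> \<omega> + \<Phi> s \<omega> + - J s \<omega>)\<^sup>2 = (U s \<omega>)\<^sup>2"
      using eq[OF s] by eventually_elim (simp add: \<Phi>_def)
    ultimately show ?thesis
      using J[OF s] by (subst integrable_cong_AE[THEN iffD1]) (auto simp: )
  qed
  then show "s \<in> {t..<T} \<Longrightarrow> integrable M (\<lambda>\<omega>. (U s \<omega>)\<^sup>2)" .
  have f2_AE: "AE r in lborel. integrable M (\<lambda>\<omega>. (f r \<omega>)\<^sup>2)"
  proof -
    have "(\<integral>\<^sup>+r. \<integral>\<^sup>+\<omega>. ennreal ((f r \<omega>)\<^sup>2) \<partial>M \<partial>lborel) < \<infinity>"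
      using f2 P.Fubini'[of "\<lambda>r \<omega>. ennreal ((f r \<omega>)\<^sup>2)"] by simp
    then have "AE r in lborel. (\<integral>\<^sup>+\<omega>. ennreal ((f r \<omega>)\<^sup>2) \<partial>M) \<noteq> \<infinity>"
      by (intro nn_integral_PInf_AE) auto
    then show ?thesis
      by eventually_elim (auto simp: integrable_iff_bounded less_top)
  qed
  have G_eq: "AE r in lborel. integrable M (\<lambda>\<omega>. f r \<omega> * U r \<omega>) \<and> (\<integral>\<omega>. G r \<omega> \<partial>M) = (\<integral>\<omega>. f r \<omega> * U r \<omega> \<partial>M)"
    using f2_AE AE_lborel_singleton[of T]
  proof eventually_elim
    case (elim r)
    show ?case
    proof (cases "r \<in> {t..<T}")
      case True
      have i: "integrable M (\<lambda>\<omega>. f r \<omega> * U r \<omega>)" "integrable M (\<lambda>\<omega>. f r \<omega> * J r \<omega>)"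
        using elim(1) U2[OF True] J2(1)[OF True] J[OF True] by (auto intro!: integrable_times_of_squares)
      have "(\<integral>\<omega>. G r \<omega> \<partial>M) = (\<integral>\<omega>. f r \<omega> * U r \<omega> + f r \<omega> * J r \<omega> \<partial>M)"
        using eq[OF True] J[OF True]
        by (intro integral_cong_AE) (auto simp: G_def \<Phi>_def distrib_left[symmetric] elim!: eventually_mono)
      also have "\<dots> = (\<integral>\<omega>. f r \<omega> * U r \<omega> \<partial>M)"
        using i fJ[OF True elim(1)] by simp
      finally show ?thesis using i by simp
    next
      case False
      then have "f r \<omega> = 0" for \<omega> using elim(2) by (intro f_out) auto
      then show ?thesis by (simp add: G_def)
    qed
  qed
  then show "AE r in lborel. integrable M (\<lambda>\<omega>. f r \<omega> * U r \<omega>)" by eventually_elim simp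
  have G1: "integrable lborel (\<lambda>r. \<integral>\<omega>. G r \<omega> \<partial>M)"
    using P.integrable_fst[OF G_int] by simp
  show fU: "integrable lborel (\<lambda>r. \<integral>\<omega>. f r \<omega> * U r \<omega> \<partial>M)"
    by (rule integrable_cong_AE_imp[OF G1]) (measurable, use G_eq in \<open>eventually_elim, simp\<close>)
  show "(\<integral>\<omega>. (U s \<omega>)\<^sup>2 \<partial>M) =
      (\<integral>\<omega>. (\<Xi> \<omega>)\<^sup>2 \<partial>M) + (\<integral>r. indicator {s..} r * (2 * (\<integral>\<omega>. f r \<omega> * U r \<omega> \<partial>M) - v r) \<partial>lborel)"
    if s: "s \<in> {t..<T}"
  proof -
    note [measurable] = J[OF s]
    have "(\<integral>\<omega>. (\<Xi> \<omega> + \<Phi> s \<omega>)\<^sup>2 \<partial>M) = (\<integral>\<omega>. (U s \<omega>)\<^sup>2 + (J s \<omega>)\<^sup>2 + 2 * (U s \<omega> * J s \<omega>) \<partial>M)"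
    proof (rule integral_cong_AE)
      show "AE \<omega> in M. (\<Xi> \<omega> + \<Phi> s \<omega>)\<^sup>2 = (U s \<omega>)\<^sup>2 + (J s \<omega>)\<^sup>2 + 2 * (U s \<omega> * J s \<omega>)"
        using eq[OF s]
      proof eventually_elim
        case (elim \<omega>)
        then have "\<Xi> \<omega> + \<Phi> s \<omega> = U s \<omega> + J s \<omega>" by (simp add: \<Phi>_def)
        then show ?case by (simp add: power2_sum)
      qed
    qed auto
    also have "\<dots> = (\<integral>\<omega>. (U s \<omega>)\<^sup>2 \<partial>M) + (\<integral>\<omega>. (J s \<omega>)\<^sup>2 \<partial>M)"
      using U2[OF s] J2(1)[OF s] UJ[OF s U2[OF s]] integrable_times_of_squares[OF U_m J[OF s] U2[OF s] J2(1)[OF s]]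
      by simp
    finally have left: "(\<integral>\<omega>. (\<Xi> \<omega> + \<Phi> s \<omega>)\<^sup>2 \<partial>M) = (\<integral>\<omega>. (U s \<omega>)\<^sup>2 \<partial>M) + (\<integral>r. indicator {s..} r * v r \<partial>lborel)"
      by (simp add: J2(2)[OF s])
    have path: "AE \<omega> in M. (\<Xi> \<omega> + \<Phi> s \<omega>)\<^sup>2 = (\<Xi> \<omega>)\<^sup>2 + 2 * (\<integral>r. indicator {s..} r * G r \<omega> \<partial>lborel)"
      using f_int
    proof eventually_elim
      case (elim \<omega>)
      define h where "h r = indicator {s..} r * f r \<omega>" for r
      have h: "integrable lborel h"
        using integrable_mult_indicator[OF _ elim, of "{s..}"] by (simp add: h_def[abs_def])
      have hh: "h r * (\<integral>x. indicator {r..} x * h x \<partial>lborel) = h r * \<Phi> r \<omega>" for r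
      proof (cases "s \<le> r")
        case True
        then have "(\<integral>x. indicator {r..} x * h x \<partial>lborel) = \<Phi> r \<omega>"
          unfolding \<Phi>_def h_def by (intro Bochner_Integration.integral_cong) (auto simp: indicator_def)
        then show ?thesis by simp
      qed (simp add: h_def)
      have i: "integrable lborel (\<lambda>r. h r * \<Phi> r \<omega>)"
        using triangle_swap(2)[OF h h] unfolding hh .
      have "(\<Phi> s \<omega>)\<^sup>2 = 2 * (\<integral>r. h r * \<Phi> r \<omega> \<partial>lborel)"
        using square_of_integral[OF h] unfolding hh by (simp add: \<Phi>_def h_def)
      moreover have "\<Xi> \<omega> * \<Phi> s \<omega> = (\<integral>r. h r * \<Xi> \<omega> \<partial>lborel)"
        by (simp add: \<Phi>_def h_def)
      moreover have "(\<integral>r. indicator {s..} r * G r \<omega> \<partial>lborel) = (\<integral>r. h r * \<Xi> \<omega> \<partial>lborel) + (\<integral>r. h r * \<Phi> r \<omega> \<partial>lborel)"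
      proof -
        have "(\<integral>r. indicator {s..} r * G r \<omega> \<partial>lborel) = (\<integral>r. h r * \<Xi> \<omega> + h r * \<Phi> r \<omega> \<partial>lborel)"
          by (simp add: G_def h_def algebra_simps)
        also have "\<dots> = (\<integral>r. h r * \<Xi> \<omega> \<partial>lborel) + (\<integral>r. h r * \<Phi> r \<omega> \<partial>lborel)"
          using h i by (intro Bochner_Integration.integral_add) auto
        finally show ?thesis .
      qed
      ultimately show ?case by (simp add: power2_sum)
    qed
    have Gs_int: "integrable (lborel \<Otimes>\<^sub>M M) (\<lambda>(r, \<omega>). indicator {s..} r * G r \<omega>)"
      by (rule Bochner_Integration.integrable_bound[OF G_int]) (auto simp: indicator_def)
    have Gs1: "integrable M (\<lambda>\<omega>. \<integral>r. indicator {s..} r * G r \<omega> \<partial>lborel)"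
      using P.integrable_snd[OF Gs_int] by simp
    have "(\<integral>\<omega>. (\<Xi> \<omega> + \<Phi> s \<omega>)\<^sup>2 \<partial>M) = (\<integral>\<omega>. (\<Xi> \<omega>)\<^sup>2 + 2 * (\<integral>r. indicator {s..} r * G r \<omega> \<partial>lborel) \<partial>M)"
      by (rule integral_cong_AE) (use Gs1 path in auto)
    also have "\<dots> = (\<integral>\<omega>. (\<Xi> \<omega>)\<^sup>2 \<partial>M) + 2 * (\<integral>\<omega>. (\<integral>r. indicator {s..} r * G r \<omega> \<partial>lborel) \<partial>M)"
      using \<Xi>2 Gs1 by simp
    also have "(\<integral>\<omega>. (\<integral>r. indicator {s..} r * G r \<omega> \<partial>lborel) \<partial>M) = (\<integral>r. (\<integral>\<omega>. indicator {s..} r * G r \<omega> \<partial>M) \<partial>lborel)"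
      by (rule P.Fubini_integral[OF Gs_int])
    also have "\<dots> = (\<integral>r. indicator {s..} r * (\<integral>\<omega>. f r \<omega> * U r \<omega> \<partial>M) \<partial>lborel)"
    proof (rule integral_cong_AE)
      show "AE r in lborel. (\<integral>\<omega>. indicator {s..} r * G r \<omega> \<partial>M) = indicator {s..} r * (\<integral>\<omega>. f r \<omega> * U r \<omega> \<partial>M)"
        using G_eq by eventually_elim simp
    qed measurable
    finally have right: "(\<integral>\<omega>. (\<Xi> \<omega> + \<Phi> s \<omega>)\<^sup>2 \<partial>M) = (\<integral>\<omega>. (\<Xi> \<omega>)\<^sup>2 \<partial>M) +
        2 * (\<integral>r. indicator {s..} r * (\<integral>\<omega>. f r \<omega> * U r \<omega> \<partial>M) \<partial>lborel)" .
    have i: "integrable lborel (\<lambda>r. indicator {s..} r * v r)"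
        "integrable lborel (\<lambda>r. indicator {s..} r * (\<integral>\<omega>. f r \<omega> * U r \<omega> \<partial>M))"
      using integrable_mult_indicator[OF _ v, of "{s..}"] integrable_mult_indicator[OF _ fU, of "{s..}"] by auto
    have "(\<integral>r. indicator {s..} r * (2 * (\<integral>\<omega>. f r \<omega> * U r \<omega> \<partial>M) - v r) \<partial>lborel) =
       (\<integral>r. 2 * (indicator {s..} r * (\<integral>\<omega>. f r \<omega> * U r \<omega> \<partial>M)) - indicator {s..} r * v r \<partial>lborel)"
      by (intro Bochner_Integration.integral_cong) (auto simp: algebra_simps)
    also have "\<dots> = 2 * (\<integral>r. indicator {s..} r * (\<integral>\<omega>. f r \<omega> * U r \<omega> \<partial>M) \<partial>lborel) - (\<integral>r. indicator {s..} r * v r \<partial>lborel)"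
      using i by simp
    finally show ?thesis using left right by simp
  qed
qed

text \<open>
  Integration by parts against \<open>exp (\<beta> * s)\<close> for an absolutely continuous \<open>y\<close> with \<open>y' = - q\<close> and
  \<open>y T = yT\<close>. It is used with \<open>y s\<close> the second moment of \<open>U s\<close>; since the weight is deterministic,
  it may enter after the expectation has been taken.
\<close>

lemma exponential_weight:
  fixes y q :: "real \<Rightarrow> real"
  assumes tT: "t < T" and q: "integrable lborel q" and q_out: "\<And>r. r \<notin> {t..T} \<Longrightarrow> q r = 0"
    and y: "\<And>s. s \<in> {t..<T} \<Longrightarrow> y s = yT + (\<integral>r. indicator {s..} r * q r \<partial>lborel)"
    and ym: "y \<in> borel_measurable borel"
  shows "integrable lborel (\<lambda>r. exp (\<beta> * r) * q r)"
    and "exp (\<beta> * t) * y t + \<beta> * (\<integral>s. indicator {t..T} s * (exp (\<beta> * s) * y s) \<partial>lborel)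
      = exp (\<beta> * T) * yT + (\<integral>r. exp (\<beta> * r) * q r \<partial>lborel)"
proof -
  note [measurable] = ym
  have [measurable]: "q \<in> borel_measurable borel" using q by auto
  define k where "k s = indicator {t..T} s * exp (\<beta> * s)" for s :: real
  have k: "integrable lborel k"
  proof -
    have "continuous_on {t..T} (\<lambda>s. exp (\<beta> * s))" by (intro continuous_intros)
    from borel_integrable_atLeastAtMost'[OF this] show ?thesis
      by (simp add: k_def[abs_def] set_integrable_def)
  qed
  have FTC: "\<beta> * (\<integral>s. indicator {..r} s * k s \<partial>lborel) = exp (\<beta> * r) - exp (\<beta> * t)" if r: "r \<in> {t..T}" for r
  proof -
    have "(\<integral>s. (\<beta> * exp (\<beta> * s)) * indicator {t..r} s \<partial>lborel) = exp (\<beta> * r) - exp (\<beta> * t)"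
      using r by (intro integral_FTC_Icc_real) (auto intro!: derivative_eq_intros continuous_intros)
    moreover have "(\<integral>s. (\<beta> * exp (\<beta> * s)) * indicator {t..r} s \<partial>lborel) = (\<integral>s. \<beta> * (indicator {..r} s * k s) \<partial>lborel)"
      using r by (intro Bochner_Integration.integral_cong) (auto simp: k_def indicator_def)
    ultimately show ?thesis by simp
  qed
  have bound: "exp (\<beta> * r) \<le> exp (\<bar>\<beta>\<bar> * max \<bar>t\<bar> \<bar>T\<bar>)" if "r \<in> {t..T}" for r
  proof -
    have "\<beta> * r \<le> \<bar>\<beta>\<bar> * \<bar>r\<bar>" by (metis abs_ge_self abs_mult)
    also have "\<dots> \<le> \<bar>\<beta>\<bar> * max \<bar>t\<bar> \<bar>T\<bar>" using that by (intro mult_left_mono) auto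
    finally show ?thesis by simp
  qed
  show eq: "integrable lborel (\<lambda>r. exp (\<beta> * r) * q r)"
  proof (rule Bochner_Integration.integrable_bound)
    show "integrable lborel (\<lambda>r. exp (\<bar>\<beta>\<bar> * max \<bar>t\<bar> \<bar>T\<bar>) * q r)" using q by simp
    show "AE r in lborel. norm (exp (\<beta> * r) * q r) \<le> norm (exp (\<bar>\<beta>\<bar> * max \<bar>t\<bar> \<bar>T\<bar>) * q r)"
    proof (rule AE_I2)
      fix r
      show "norm (exp (\<beta> * r) * q r) \<le> norm (exp (\<bar>\<beta>\<bar> * max \<bar>t\<bar> \<bar>T\<bar>) * q r)"
        by (cases "r \<in> {t..T}") (auto simp: abs_mult q_out intro!: mult_right_mono bound)
    qed
  qed auto
  have ks: "AE s in lborel. k s * yT + k s * (\<integral>r. indicator {s..} r * q r \<partial>lborel) = indicator {t..T} s * (exp (\<beta> * s) * y s)"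
    using AE_lborel_singleton[of T]
    by eventually_elim (auto simp: k_def indicator_def y distrib_left)
  have i: "integrable lborel (\<lambda>s. k s * yT + k s * (\<integral>r. indicator {s..} r * q r \<partial>lborel))"
    using k triangle_swap(2)[OF k q] by simp
  have "(\<integral>s. indicator {t..T} s * (exp (\<beta> * s) * y s) \<partial>lborel) =
      (\<integral>s. k s * yT + k s * (\<integral>r. indicator {s..} r * q r \<partial>lborel) \<partial>lborel)"
    using ks i by (intro integral_cong_AE) (auto elim!: eventually_mono)
  also have "\<dots> = (\<integral>s. k s \<partial>lborel) * yT + (\<integral>s. k s * (\<integral>r. indicator {s..} r * q r \<partial>lborel) \<partial>lborel)"
    using k triangle_swap(2)[OF k q] by simp
  also have "(\<integral>s. k s * (\<integral>r. indicator {s..} r * q r \<partial>lborel) \<partial>lborel) = (\<integral>r. q r * (\<integral>s. indicator {..r} s * k s \<partial>lborel) \<partial>lborel)"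
    by (rule triangle_swap(1)[OF k q])
  finally have "\<beta> * (\<integral>s. indicator {t..T} s * (exp (\<beta> * s) * y s) \<partial>lborel) =
     \<beta> * (\<integral>s. k s \<partial>lborel) * yT + (\<integral>r. \<beta> * (q r * (\<integral>s. indicator {..r} s * k s \<partial>lborel)) \<partial>lborel)"
    by (simp add: distrib_left)
  also have "\<beta> * (\<integral>s. k s \<partial>lborel) = exp (\<beta> * T) - exp (\<beta> * t)"
  proof -
    have "(\<integral>s. k s \<partial>lborel) = (\<integral>s. indicator {..T} s * k s \<partial>lborel)"
      by (intro Bochner_Integration.integral_cong) (auto simp: k_def indicator_def)
    then show ?thesis using FTC[of T] tT by simp
  qed
  also have "(\<integral>r. \<beta> * (q r * (\<integral>s. indicator {..r} s * k s \<partial>lborel)) \<partial>lborel) = (\<integral>r. exp (\<beta> * r) * q r - exp (\<beta> * t) * q r \<partial>lborel)"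
  proof (intro Bochner_Integration.integral_cong refl)
    fix r
    show "\<beta> * (q r * (\<integral>s. indicator {..r} s * k s \<partial>lborel)) = exp (\<beta> * r) * q r - exp (\<beta> * t) * q r"
    proof (cases "r \<in> {t..T}")
      case True
      have "\<beta> * (q r * (\<integral>s. indicator {..r} s * k s \<partial>lborel)) = q r * (\<beta> * (\<integral>s. indicator {..r} s * k s \<partial>lborel))"
        by simp
      then show ?thesis unfolding FTC[OF True] by (simp add: algebra_simps)
    qed (simp add: q_out)
  qed
  also have "\<dots> = (\<integral>r. exp (\<beta> * r) * q r \<partial>lborel) - exp (\<beta> * t) * (\<integral>r. q r \<partial>lborel)"
    using eq q by simp
  also have "(\<integral>r. q r \<partial>lborel) = y t - yT"
  proof -
    have "(\<integral>r. q r \<partial>lborel) = (\<integral>r. indicator {t..} r * q r \<partial>lborel)"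
      by (intro Bochner_Integration.integral_cong) (auto simp: indicator_def q_out)
    then show ?thesis using y[of t] tT by simp
  qed
  finally show "exp (\<beta> * t) * y t + \<beta> * (\<integral>s. indicator {t..T} s * (exp (\<beta> * s) * y s) \<partial>lborel)
      = exp (\<beta> * T) * yT + (\<integral>r. exp (\<beta> * r) * q r \<partial>lborel)"
    by (simp add: algebra_simps)
qed

section \<open>Measurable versions of processes with constant past\<close>

context brownian
begin

lemma prog_measurable_joint:
  fixes \<psi> :: "real \<Rightarrow> 'a \<Rightarrow> 'b::euclidean_space"
  assumes "prog_measurable M B a b \<psi>" "c \<in> {a..b}"
  shows "(\<lambda>(r, \<omega>). indicator {a..c} r *\<^sub>R \<psi> r \<omega>) \<in> borel_measurable (lborel \<Otimes>\<^sub>M F c)"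
proof -
  let ?\<Omega> = "{p \<in> space (lborel \<Otimes>\<^sub>M F c). fst p \<in> {a..c}}"
  have id: "(\<lambda>p. (fst p, snd p)) \<in> measurable (restrict_space (lborel \<Otimes>\<^sub>M F c) ?\<Omega>) (restrict_space borel {a..c} \<Otimes>\<^sub>M F c)"
  proof (rule measurable_Pair)
    show "fst \<in> measurable (restrict_space (lborel \<Otimes>\<^sub>M F c) ?\<Omega>) (restrict_space borel {a..c})"
      by (rule measurable_restrict_space3) (use measurable_fst[of "lborel :: real measure" "F c"] in auto)
    show "snd \<in> measurable (restrict_space (lborel \<Otimes>\<^sub>M F c) ?\<Omega>) (F c)"
      by (rule measurable_restrict_space1) measurable
  qed
  have "(\<lambda>p. (\<lambda>(r, \<omega>). \<psi> r \<omega>) (fst p, snd p)) \<in> borel_measurable (restrict_space (lborel \<Otimes>\<^sub>M F c) ?\<Omega>)"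
    by (rule measurable_compose[OF id]) (use assms in \<open>simp add: prog_measurable_def\<close>)
  moreover have "?\<Omega> \<inter> space (lborel \<Otimes>\<^sub>M F c) \<in> sets (lborel \<Otimes>\<^sub>M F c)" by measurable
  ultimately have "(\<lambda>p. indicator ?\<Omega> p *\<^sub>R \<psi> (fst p) (snd p)) \<in> borel_measurable (lborel \<Otimes>\<^sub>M F c)"
    by (subst (asm) borel_measurable_restrict_space_iff) (auto simp: split_beta')
  then show ?thesis
    by (rule measurable_cong[THEN iffD1, rotated]) (auto simp: indicator_def)
qed

lemma prog_measurable_at:
  fixes \<psi> :: "real \<Rightarrow> 'a \<Rightarrow> 'b::euclidean_space"
  assumes "prog_measurable M B a b \<psi>" "c \<in> {a..b}"
  shows "\<psi> c \<in> borel_measurable (F c)"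
proof -
  have "(\<lambda>\<omega>. (\<lambda>(r, \<omega>). indicator {a..c} r *\<^sub>R \<psi> r \<omega>) (c, \<omega>)) \<in> borel_measurable (F c)"
    by (rule measurable_compose[OF _ prog_measurable_joint[OF assms]]) measurable
  then show ?thesis using assms(2) by simp
qed

lemma pair_measurable_F_M:
  "f \<in> borel_measurable (lborel \<Otimes>\<^sub>M F c) \<Longrightarrow> f \<in> borel_measurable (lborel \<Otimes>\<^sub>M M)"
  for f :: "real \<times> 'a \<Rightarrow> 'b::euclidean_space"
proof -
  assume f: "f \<in> borel_measurable (lborel \<Otimes>\<^sub>M F c)"
  have id: "(\<lambda>x. x) \<in> measurable M (F c)"
    using sets_F_subset[of c] by (auto simp: measurable_def sets.Int_space_eq2)
  have "(\<lambda>p. (fst p, snd p)) \<in> measurable (lborel \<Otimes>\<^sub>M M) (lborel \<Otimes>\<^sub>M F c)"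
    using measurable_compose[OF measurable_snd id] by (intro measurable_Pair) auto
  from measurable_compose[OF this f] show ?thesis by simp
qed

text \<open>
  A solution is constant before time 0 only outside a null set. Replacing that past by its constant
  value gives a process that is jointly measurable on the whole line, as the time shifts by the delay
  require; beyond \<open>[-l, b]\<close> it is set to 0.
\<close>

definition regular :: "real \<Rightarrow> real \<Rightarrow> (real \<Rightarrow> 'a \<Rightarrow> 'b::euclidean_space) \<Rightarrow> bool" where
  "regular l b y \<longleftrightarrow> y \<in> L2_bar M B l b \<and> (\<exists>k. AE \<omega> in M. \<forall>r\<in>{-l..<0}. y r \<omega> = k)"

definition version :: "real \<Rightarrow> real \<Rightarrow> (real \<Rightarrow> 'a \<Rightarrow> 'b::euclidean_space) \<Rightarrow> real \<Rightarrow> 'a \<Rightarrow> 'b" where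
  "version l b y r \<omega> = indicator {0..b} r *\<^sub>R y r \<omega> +
     indicator {-l..<0} r *\<^sub>R (SOME k. AE \<omega> in M. \<forall>r\<in>{-l..<0}. y r \<omega> = k)"

lemma version_eq: "r \<in> {0..b} \<Longrightarrow> version l b y r \<omega> = y r \<omega>"
  by (simp add: version_def)

lemma version_AE_eq:
  assumes "regular l b y"
  shows "AE \<omega> in M. \<forall>r\<in>{-l..b}. y r \<omega> = version l b y r \<omega>"
proof -
  have "AE \<omega> in M. \<forall>r\<in>{-l..<0}. y r \<omega> = (SOME k. AE \<omega> in M. \<forall>r\<in>{-l..<0}. y r \<omega> = k)"
    using assms unfolding regular_def by (intro someI_ex[where P="\<lambda>k. AE \<omega> in M. \<forall>r\<in>{-l..<0}. y r \<omega> = k"]) simp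
  then show ?thesis
    by eventually_elim (auto simp: version_def indicator_def not_le)
qed

lemma version_measurable_F:
  assumes "regular l b y" "c \<in> {0..b}"
  shows "(\<lambda>(r, \<omega>). indicator {..c} r *\<^sub>R version l b y r \<omega>) \<in> borel_measurable (lborel \<Otimes>\<^sub>M F c)"
proof -
  have "prog_measurable M B 0 b y"
    using assms(1) by (simp add: regular_def L2_bar_def L2_process_def)
  note [measurable] = prog_measurable_joint[OF this assms(2)]
  define k where "k = (SOME k. AE \<omega> in M. \<forall>r\<in>{-l..<0}. y r \<omega> = k)"
  have "(\<lambda>p. (\<lambda>(r, \<omega>). indicator {0..c} r *\<^sub>R y r \<omega>) p + indicator ({-l..<0} \<inter> {..c}) (fst p) *\<^sub>R k)
      \<in> borel_measurable (lborel \<Otimes>\<^sub>M F c)"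
    by (intro borel_measurable_add prog_measurable_joint[OF \<open>prog_measurable M B 0 b y\<close> assms(2)]) measurable
  also have "(\<lambda>p. (\<lambda>(r, \<omega>). indicator {0..c} r *\<^sub>R y r \<omega>) p + indicator ({-l..<0} \<inter> {..c}) (fst p) *\<^sub>R k) =
      (\<lambda>(r, \<omega>). indicator {..c} r *\<^sub>R version l b y r \<omega>)"
    using assms(2) by (auto simp: fun_eq_iff version_def k_def indicator_def)
  finally show ?thesis .
qed

lemma version_measurable:
  assumes "regular l b y" "0 \<le> b"
  shows "joint M (version l b y)"
proof -
  have "(\<lambda>(r, \<omega>). indicator {..b} r *\<^sub>R version l b y r \<omega>) = case_prod (version l b y)"
    using assms(2) by (auto simp: fun_eq_iff version_def indicator_def)
  then show ?thesis
    using pair_measurable_F_M[OF version_measurable_F[OF assms(1), of b]] assms(2) by simp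
qed

lemma version_square_integrable:
  assumes "regular l b y" "0 \<le> l" and b: "0 \<le> b"
  shows "dint M (\<lambda>r \<omega>. (norm (version l b y r \<omega>))\<^sup>2) < \<infinity>"
proof -
  define k where "k = (SOME k. AE \<omega> in M. \<forall>r\<in>{-l..<0}. y r \<omega> = k)"
  note [measurable] = version_measurable[OF assms(1) b]
  have fin: "(\<integral>\<^sup>+\<omega>. (\<integral>\<^sup>+r\<in>{0..b}. ennreal ((norm (y r \<omega>))\<^sup>2) \<partial>lborel) \<partial>M) < \<infinity>"
    using assms(1) by (simp add: regular_def L2_bar_def L2_process_def)
  have "(\<integral>\<^sup>+r. ennreal ((norm (version l b y r \<omega>))\<^sup>2) \<partial>lborel) =
     (\<integral>\<^sup>+r\<in>{0..b}. ennreal ((norm (y r \<omega>))\<^sup>2) \<partial>lborel) + ennreal ((norm k)\<^sup>2) * ennreal l"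
    if "\<omega> \<in> space M" for \<omega>
  proof -
    have "(\<integral>\<^sup>+r. ennreal ((norm (version l b y r \<omega>))\<^sup>2) \<partial>lborel) =
      (\<integral>\<^sup>+r. ennreal ((norm (version l b y r \<omega>))\<^sup>2) * indicator {0..b} r + ennreal ((norm k)\<^sup>2) * indicator {-l..<0} r \<partial>lborel)"
      by (intro nn_integral_cong) (auto simp: version_def k_def indicator_def)
    also have "\<dots> = (\<integral>\<^sup>+r. ennreal ((norm (version l b y r \<omega>))\<^sup>2) * indicator {0..b} r \<partial>lborel) + ennreal ((norm k)\<^sup>2) * ennreal l"
      using assms(2) that by (subst nn_integral_add) (auto simp: nn_integral_cmult)
    also have "(\<integral>\<^sup>+r. ennreal ((norm (version l b y r \<omega>))\<^sup>2) * indicator {0..b} r \<partial>lborel) = (\<integral>\<^sup>+r\<in>{0..b}. ennreal ((norm (y r \<omega>))\<^sup>2) \<partial>lborel)"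
      by (intro nn_integral_cong) (auto simp: version_def indicator_def)
    finally show ?thesis .
  qed
  then have "dint M (\<lambda>r \<omega>. (norm (version l b y r \<omega>))\<^sup>2) =
     (\<integral>\<^sup>+\<omega>. (\<integral>\<^sup>+r\<in>{0..b}. ennreal ((norm (version l b y r \<omega>))\<^sup>2) \<partial>lborel) + ennreal ((norm k)\<^sup>2) * ennreal l \<partial>M)"
    by (intro nn_integral_cong) (auto simp: version_def indicator_def intro!: nn_integral_cong)
  also have "\<dots> = (\<integral>\<^sup>+\<omega>. (\<integral>\<^sup>+r\<in>{0..b}. ennreal ((norm (version l b y r \<omega>))\<^sup>2) \<partial>lborel) \<partial>M) + ennreal ((norm k)\<^sup>2) * ennreal l"
    by (subst nn_integral_add) (auto simp: emeasure_space_1)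
  also have "(\<integral>\<^sup>+\<omega>. (\<integral>\<^sup>+r\<in>{0..b}. ennreal ((norm (version l b y r \<omega>))\<^sup>2) \<partial>lborel) \<partial>M) =
      (\<integral>\<^sup>+\<omega>. (\<integral>\<^sup>+r\<in>{0..b}. ennreal ((norm (y r \<omega>))\<^sup>2) \<partial>lborel) \<partial>M)"
    by (intro nn_integral_cong) (auto simp: version_def indicator_def)
  finally show ?thesis using fin by (simp add: ennreal_mult_less_top)
qed

section \<open>The Lipschitz condition in mean square\<close>

text \<open>
  Conditional Jensen for the square, tested on \<open>A\<close>. Testing \<open>\<bar>G\<bar> \<le> K * E[X | F s]\<close> against
  \<open>\<bar>G\<bar>\<close> itself and using Cauchy-Schwarz gives \<open>a\<^sup>2 \<le> K\<^sup>2 * a * b\<close> for the two sides \<open>a\<close> and \<open>b\<close>;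
  dividing by \<open>a\<close> needs \<open>a\<close> finite, hence the truncation to \<open>\<bar>G\<bar> \<le> n\<close>.
\<close>

lemma square_bound_cond_exp:
  fixes G :: "'a \<Rightarrow> real"
  assumes G: "G \<in> borel_measurable (F s)" and A: "A \<in> sets (F s)"
    and X': "X' \<in> borel_measurable M" and eq: "AE \<omega> in M. X \<omega> = X' \<omega>"
    and le: "AE \<omega> in M. ennreal \<bar>G \<omega>\<bar> \<le> ennreal K * nn_cond_exp M (F s) X \<omega>"
    and K: "0 \<le> K"
  shows "expect_on M A (\<lambda>\<omega>. ennreal ((G \<omega>)\<^sup>2)) \<le> ennreal (K\<^sup>2) * expect_on M A (\<lambda>\<omega>. (X' \<omega>)\<^sup>2)"
proof (cases "X \<in> borel_measurable M")
  case False
  then have "nn_cond_exp M (F s) X = (\<lambda>_. 0)" by (simp add: nn_cond_exp_def)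
  with le have "AE \<omega> in M. indicator A \<omega> * ennreal ((G \<omega>)\<^sup>2) = 0"
    by (auto elim!: eventually_mono)
  then have "expect_on M A (\<lambda>\<omega>. ennreal ((G \<omega>)\<^sup>2)) = (\<integral>\<^sup>+\<omega>. 0 \<partial>M)"
    by (rule nn_integral_cong_AE)
  then show ?thesis by simp
next
  case True
  interpret sub: finite_measure_subalgebra M "F s"
    by unfold_locales (rule subalgebra_F)
  have [measurable]: "G \<in> borel_measurable M" "A \<in> sets M" "X \<in> borel_measurable M" "X' \<in> borel_measurable M"
    using measurable_F_M[OF G] A sets_F_subset True X' by auto
  define b where "b = expect_on M A (\<lambda>\<omega>. (X' \<omega>)\<^sup>2)"
  define An where "An n = {\<omega>\<in>A. \<bar>G \<omega>\<bar> \<le> real n}" for n :: nat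
  define h where "h n \<omega> = indicator (An n) \<omega> * ennreal \<bar>G \<omega>\<bar>" for n \<omega>
  have An: "An n \<in> sets (F s)" for n
  proof -
    have "An n = A \<inter> {\<omega>\<in>space (F s). \<bar>G \<omega>\<bar> \<le> real n}"
      using sets.sets_into_space[OF A] by (auto simp: An_def)
    moreover have "{\<omega>\<in>space (F s). \<bar>G \<omega>\<bar> \<le> real n} \<in> sets (F s)"
      using G by measurable
    ultimately show ?thesis using A by auto
  qed
  have h: "h n \<in> borel_measurable (F s)" for n
    unfolding h_def[abs_def] using G An[of n] by measurable
  have [measurable]: "h n \<in> borel_measurable M" for n by (rule measurable_F_M[OF h])
  have main: "(\<integral>\<^sup>+\<omega>. (h n \<omega>)\<^sup>2 \<partial>M) \<le> ennreal (K\<^sup>2) * b" for n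
  proof -
    define a where "a = (\<integral>\<^sup>+\<omega>. (h n \<omega>)\<^sup>2 \<partial>M)"
    have "a \<le> (\<integral>\<^sup>+\<omega>. ennreal (real n ^ 2) \<partial>M)"
      unfolding a_def
    proof (intro nn_integral_mono)
      fix \<omega>
      have "h n \<omega> \<le> ennreal (real n)" by (auto simp: h_def An_def indicator_def intro: ennreal_leI)
      from power_mono[OF this, of 2] show "(h n \<omega>)\<^sup>2 \<le> ennreal (real n ^ 2)" by (simp add: ennreal_power)
    qed
    then have fin: "a < \<infinity>" by (simp add: emeasure_space_1 order_le_less_trans)
    have "a \<le> (\<integral>\<^sup>+\<omega>. ennreal K * (h n \<omega> * nn_cond_exp M (F s) X \<omega>) \<partial>M)"
      unfolding a_def
    proof (intro nn_integral_mono_AE)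
      show "AE \<omega> in M. (h n \<omega>)\<^sup>2 \<le> ennreal K * (h n \<omega> * nn_cond_exp M (F s) X \<omega>)"
        using le
      proof eventually_elim
        case (elim \<omega>)
        have "h n \<omega> \<le> ennreal K * nn_cond_exp M (F s) X \<omega>"
          using elim by (auto simp: h_def indicator_def)
        from mult_left_mono[OF this, of "h n \<omega>"] show ?case
          by (simp add: power2_eq_square mult.left_commute)
      qed
    qed
    also have "\<dots> = ennreal K * (\<integral>\<^sup>+\<omega>. h n \<omega> * nn_cond_exp M (F s) X \<omega> \<partial>M)"
      by (rule nn_integral_cmult) measurable
    also have "(\<integral>\<^sup>+\<omega>. h n \<omega> * nn_cond_exp M (F s) X \<omega> \<partial>M) = (\<integral>\<^sup>+\<omega>. h n \<omega> * X \<omega> \<partial>M)"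
      by (rule sub.nn_cond_exp_intg[OF h True])
    also have "\<dots> = (\<integral>\<^sup>+\<omega>. h n \<omega> * (indicator A \<omega> * X' \<omega>) \<partial>M)"
      using eq by (intro nn_integral_cong_AE) (auto elim!: eventually_mono simp: h_def An_def indicator_def)
    finally have "a\<^sup>2 \<le> (ennreal K * (\<integral>\<^sup>+\<omega>. h n \<omega> * (indicator A \<omega> * X' \<omega>) \<partial>M))\<^sup>2"
      by (intro power_mono) auto
    also have "\<dots> = ennreal (K\<^sup>2) * (\<integral>\<^sup>+\<omega>. h n \<omega> * (indicator A \<omega> * X' \<omega>) \<partial>M)\<^sup>2"
      using K by (simp only: power_mult_distrib ennreal_power)
    also have "\<dots> \<le> ennreal (K\<^sup>2) * (a * (\<integral>\<^sup>+\<omega>. (indicator A \<omega> * X' \<omega>)\<^sup>2 \<partial>M))"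
      unfolding a_def by (intro mult_left_mono Cauchy_Schwarz_nn_integral) auto
    also have "(\<integral>\<^sup>+\<omega>. (indicator A \<omega> * X' \<omega>)\<^sup>2 \<partial>M) = b"
      unfolding b_def by (intro nn_integral_cong) (auto simp: indicator_def)
    finally have "a * a \<le> a * (ennreal (K\<^sup>2) * b)"
      by (simp add: power2_eq_square mult.left_commute)
    then have "a \<le> ennreal (K\<^sup>2) * b"
      using fin by (cases "a = 0") (auto simp: ennreal_mult_le_mult_iff less_top)
    then show ?thesis by (simp add: a_def)
  qed
  have mono: "incseq (\<lambda>n \<omega>. (h n \<omega>)\<^sup>2)"
    by (intro incseq_SucI le_funI power_mono) (auto simp: h_def An_def indicator_def)
  have "expect_on M A (\<lambda>\<omega>. ennreal ((G \<omega>)\<^sup>2)) \<le> (\<integral>\<^sup>+\<omega>. (SUP n. (h n \<omega>)\<^sup>2) \<partial>M)"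
  proof (intro nn_integral_mono)
    fix \<omega>
    obtain n where n: "\<bar>G \<omega>\<bar> \<le> real n" using real_arch_simple by blast
    then have "indicator A \<omega> * ennreal ((G \<omega>)\<^sup>2) = (h n \<omega>)\<^sup>2"
      by (auto simp: h_def An_def indicator_def ennreal_power)
    then show "indicator A \<omega> * ennreal ((G \<omega>)\<^sup>2) \<le> (SUP n. (h n \<omega>)\<^sup>2)"
      by (auto intro: SUP_upper2[of n])
  qed
  also have "\<dots> = (SUP n. \<integral>\<^sup>+\<omega>. (h n \<omega>)\<^sup>2 \<partial>M)"
    by (rule nn_integral_monotone_convergence_SUP[OF mono]) measurable
  also have "\<dots> \<le> ennreal (K\<^sup>2) * b" by (rule SUP_least) (rule main)
  finally show ?thesis by (simp add: b_def)
qed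

end

lemma delay_measure_space:
  fixes lam :: "real measure"
  assumes "sets lam = sets (restrict_space borel {-l..u})"
  shows "space lam = {-l..u}" and "f \<in> borel_measurable borel \<Longrightarrow> f \<in> borel_measurable lam"
proof -
  show "space lam = {-l..u}" using sets_eq_imp_space_eq[OF assms] by simp
  show "f \<in> borel_measurable borel \<Longrightarrow> f \<in> borel_measurable lam"
    unfolding measurable_cong_sets[OF assms refl] by (rule measurable_restrict_space1)
qed

text \<open>
  A delay \<open>r \<ge> -l\<close> changes the weight by at most the factor \<open>exp (\<beta> * l)\<close> and moves \<open>[t, T]\<close> inside
  \<open>[t - l, T + u]\<close>. This is where the delay makes values before \<open>t\<close> appear in the final estimate.
\<close>

lemma shift_integral_le:
  fixes lam :: "real measure" and w :: "real \<Rightarrow> ennreal"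
  assumes lam: "prob_space lam" "sets lam = sets (restrict_space borel {-l..u})"
    and w [measurable]: "w \<in> borel_measurable borel" and \<beta>: "0 \<le> \<beta>"
  shows "(\<integral>\<^sup>+s\<in>{t..T}. ennreal (exp (\<beta> * s)) * (\<integral>\<^sup>+r. w (s + r) \<partial>lam) \<partial>lborel)
    \<le> ennreal (exp (\<beta> * l)) * (\<integral>\<^sup>+v\<in>{t - l..T + u}. ennreal (exp (\<beta> * v)) * w v \<partial>lborel)"
proof -
  interpret lam: prob_space lam by fact
  interpret L: pair_sigma_finite lam "lborel :: real measure" ..
  \<comment> \<open>The inclusion of \<open>[-l, u]\<close> into the line, measurable from \<open>lam\<close> to the Borel sets.\<close>
  define j :: "real \<Rightarrow> real" where "j r = r" for r
  have [measurable]: "j \<in> borel_measurable lam"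
    unfolding j_def[abs_def] by (rule delay_measure_space(2)[OF lam(2)]) simp
  define R where "R = (\<integral>\<^sup>+v\<in>{t - l..T + u}. ennreal (exp (\<beta> * v)) * w v \<partial>lborel)"
  have "(\<integral>\<^sup>+s\<in>{t..T}. ennreal (exp (\<beta> * s)) * (\<integral>\<^sup>+r. w (s + r) \<partial>lam) \<partial>lborel) =
      (\<integral>\<^sup>+s. (\<integral>\<^sup>+r. indicator {t..T} s * ennreal (exp (\<beta> * s)) * w (s + j r) \<partial>lam) \<partial>lborel)"
  proof (rule nn_integral_cong)
    fix s
    have "(\<integral>\<^sup>+r. indicator {t..T} s * ennreal (exp (\<beta> * s)) * w (s + j r) \<partial>lam) =
        indicator {t..T} s * ennreal (exp (\<beta> * s)) * (\<integral>\<^sup>+r. w (s + j r) \<partial>lam)"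
      by (rule nn_integral_cmult) measurable
    then show "ennreal (exp (\<beta> * s)) * (\<integral>\<^sup>+r. w (s + r) \<partial>lam) * indicator {t..T} s =
        (\<integral>\<^sup>+r. indicator {t..T} s * ennreal (exp (\<beta> * s)) * w (s + j r) \<partial>lam)"
      by (simp add: j_def ac_simps)
  qed
  also have "\<dots> = (\<integral>\<^sup>+r. (\<integral>\<^sup>+s. indicator {t..T} s * ennreal (exp (\<beta> * s)) * w (s + j r) \<partial>lborel) \<partial>lam)"
    by (rule L.Fubini') measurable
  also have "\<dots> \<le> (\<integral>\<^sup>+r. ennreal (exp (\<beta> * l)) * R \<partial>lam)"
  proof (rule nn_integral_mono)
    fix r assume "r \<in> space lam"
    then have r: "-l \<le> r" "r \<le> u" by (auto simp: delay_measure_space(1)[OF lam(2)])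
    have "(\<integral>\<^sup>+s. indicator {t..T} s * ennreal (exp (\<beta> * s)) * w (s + j r) \<partial>lborel) =
      (\<integral>\<^sup>+v. indicator {t..T} (v - r) * ennreal (exp (\<beta> * (v - r))) * w v \<partial>lborel)"
      by (subst nn_integral_real_affine[where c=1 and t="-r"]) (auto simp: j_def)
    also have "\<dots> \<le> (\<integral>\<^sup>+v. ennreal (exp (\<beta> * l)) * (ennreal (exp (\<beta> * v)) * w v * indicator {t - l..T + u} v) \<partial>lborel)"
    proof (rule nn_integral_mono)
      fix v
      have "exp (\<beta> * (v - r)) \<le> exp (\<beta> * l) * exp (\<beta> * v)"
        using mult_left_mono[OF r(1) \<beta>] by (simp flip: exp_add add: algebra_simps)
      then have "ennreal (exp (\<beta> * (v - r))) \<le> ennreal (exp (\<beta> * l)) * ennreal (exp (\<beta> * v))"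
        by (simp flip: ennreal_mult add: ennreal_leI)
      then have "ennreal (exp (\<beta> * (v - r))) * w v \<le> ennreal (exp (\<beta> * l)) * (ennreal (exp (\<beta> * v)) * w v)"
        by (metis mult.assoc mult_right_mono zero_le)
      then show "indicator {t..T} (v - r) * ennreal (exp (\<beta> * (v - r))) * w v
          \<le> ennreal (exp (\<beta> * l)) * (ennreal (exp (\<beta> * v)) * w v * indicator {t - l..T + u} v)"
        using r by (auto simp: indicator_def)
    qed
    also have "\<dots> = ennreal (exp (\<beta> * l)) * R"
      unfolding R_def by (rule nn_integral_cmult) measurable
    finally show "(\<integral>\<^sup>+s. indicator {t..T} s * ennreal (exp (\<beta> * s)) * w (s + j r) \<partial>lborel) \<le> ennreal (exp (\<beta> * l)) * R" .
  qed
  also have "\<dots> = ennreal (exp (\<beta> * l)) * R" by (simp add: lam.emeasure_space_1)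
  finally show ?thesis by (simp add: R_def)
qed

context brownian
begin

lemma shift_measurable_regular:
  assumes y: "regular l (T + u) y" and lam: "sets lam = sets (restrict_space borel {-l..u})"
    and T: "0 \<le> T + u" "s \<in> {0..T}"
  shows "shift_measurable M lam s y"
proof -
  note [measurable] = version_measurable[OF y T(1)]
  show ?thesis
    unfolding shift_measurable_def using version_AE_eq[OF y] AE_space
  proof eventually_elim
    case (elim \<omega>)
    have "(\<lambda>r. version l (T + u) y (s + r) \<omega>) \<in> borel_measurable borel"
      using elim(2) by measurable
    then have "(\<lambda>r. version l (T + u) y (s + r) \<omega>) \<in> borel_measurable lam"
      by (rule delay_measure_space(2)[OF lam])
    moreover have "version l (T + u) y (s + r) \<omega> = y (s + r) \<omega>" if "r \<in> space lam" for r
      using that elim(1) T by (auto simp: delay_measure_space(1)[OF lam])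
    ultimately show ?case by (simp cong: measurable_cong)
  qed
qed

text \<open>
  Only a single time \<open>s\<close> is concerned here. Integrating this bound over \<open>s\<close> afterwards is harmless,
  whereas the conditional expectations in the Lipschitz condition are given for each time separately
  and need not be jointly measurable.
\<close>

lemma lipschitz_mean_square:
  fixes y y' :: "real \<Rightarrow> 'a \<Rightarrow> real" and z z' :: "real \<Rightarrow> 'a \<Rightarrow> real^'d"
  assumes lip: "lipschitz_coefficient M B T l u K lam g"
    and lam: "prob_space lam" "sets lam = sets (restrict_space borel {-l..u})"
    and reg: "regular l (T + u) y" "regular l (T + u) z" "regular l (T + u) y'" "regular l (T + u) z'"
    and s: "s \<in> {0..T}" and Tu: "0 \<le> T + u" and K: "0 \<le> K"
    and g: "g s y z \<in> borel_measurable (F s)" "g s y' z' \<in> borel_measurable (F s)"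
    and A: "A \<in> sets (F s)"
  defines "w \<equiv> (\<lambda>v \<omega>. (version l (T + u) y v \<omega> - version l (T + u) y' v \<omega>)\<^sup>2 + (norm (version l (T + u) z v \<omega> - version l (T + u) z' v \<omega>))\<^sup>2)"
  shows "expect_on M A (\<lambda>\<omega>. ennreal ((g s y z \<omega> - g s y' z' \<omega>)\<^sup>2)) \<le>
    ennreal (2 * K\<^sup>2) * (\<integral>\<^sup>+r. expect_on M A (\<lambda>\<omega>. ennreal (w (s + r) \<omega>)) \<partial>lam)"
proof -
  interpret lam: prob_space lam by fact
  interpret L: pair_sigma_finite lam M ..
  \<comment> \<open>The inclusion of \<open>[-l, u]\<close> into the line, measurable from \<open>lam\<close> to the Borel sets.\<close>
  define j :: "real \<Rightarrow> real" where "j r = r" for r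
  have [measurable]: "j \<in> borel_measurable lam"
    unfolding j_def[abs_def] by (rule delay_measure_space(2)[OF lam(2)]) simp
  note [measurable] = version_measurable[OF reg(1) Tu] version_measurable[OF reg(2) Tu]
    version_measurable[OF reg(3) Tu] version_measurable[OF reg(4) Tu]
  have [measurable]: "A \<in> sets M" using A sets_F_subset by auto
  have [measurable]: "joint M w" unfolding w_def by measurable
  define X where "X \<omega> = (\<integral>\<^sup>+r. ennreal (\<bar>y (s + r) \<omega> - y' (s + r) \<omega>\<bar> + norm (z (s + r) \<omega> - z' (s + r) \<omega>)) \<partial>lam)" for \<omega>
  define h where "h r \<omega> = \<bar>version l (T + u) y r \<omega> - version l (T + u) y' r \<omega>\<bar> + norm (version l (T + u) z r \<omega> - version l (T + u) z' r \<omega>)" for r \<omega>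
  have [measurable]: "joint M h" unfolding h_def by measurable
  define X' where "X' \<omega> = (\<integral>\<^sup>+r. ennreal (h (s + j r) \<omega>) \<partial>lam)" for \<omega>
  have [measurable]: "X' \<in> borel_measurable M" unfolding X'_def[abs_def] by measurable
  have eq: "AE \<omega> in M. X \<omega> = X' \<omega>"
    using version_AE_eq[OF reg(1)] version_AE_eq[OF reg(2)] version_AE_eq[OF reg(3)] version_AE_eq[OF reg(4)]
  proof eventually_elim
    case (elim \<omega>)
    show ?case unfolding X_def X'_def h_def j_def
      using elim s by (intro nn_integral_cong) (auto simp: delay_measure_space(1)[OF lam(2)])
  qed
  have le: "AE \<omega> in M. ennreal \<bar>g s y z \<omega> - g s y' z' \<omega>\<bar> \<le> ennreal K * nn_cond_exp M (F s) X \<omega>"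
    using lip s reg shift_measurable_regular[OF reg(1) lam(2) Tu s] shift_measurable_regular[OF reg(2) lam(2) Tu s]
      shift_measurable_regular[OF reg(3) lam(2) Tu s] shift_measurable_regular[OF reg(4) lam(2) Tu s]
    unfolding lipschitz_coefficient_def X_def[abs_def] regular_def by blast
  have "expect_on M A (\<lambda>\<omega>. ennreal ((g s y z \<omega> - g s y' z' \<omega>)\<^sup>2)) \<le> ennreal (K\<^sup>2) * expect_on M A (\<lambda>\<omega>. (X' \<omega>)\<^sup>2)"
    by (rule square_bound_cond_exp[OF _ A _ eq le K]) (use g in auto)
  also have "expect_on M A (\<lambda>\<omega>. (X' \<omega>)\<^sup>2) \<le> (\<integral>\<^sup>+\<omega>. (\<integral>\<^sup>+r. 2 * (indicator A \<omega> * ennreal (w (s + j r) \<omega>)) \<partial>lam) \<partial>M)"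
  proof (rule nn_integral_mono)
    fix \<omega> assume [simp]: "\<omega> \<in> space M"
    have "(X' \<omega>)\<^sup>2 \<le> (\<integral>\<^sup>+r. ennreal (h (s + j r) \<omega>) ^ 2 \<partial>lam)"
      using Cauchy_Schwarz_nn_integral[of "\<lambda>r. ennreal (h (s + j r) \<omega>)" lam "\<lambda>_. 1"]
      by (simp add: X'_def lam.emeasure_space_1)
    also have "\<dots> \<le> (\<integral>\<^sup>+r. 2 * ennreal (w (s + j r) \<omega>) \<partial>lam)"
    proof (rule nn_integral_mono)
      fix r
      have "(h (s + j r) \<omega>)\<^sup>2 \<le> 2 * w (s + j r) \<omega>"
        unfolding h_def w_def using sum_squares_bound[of "\<bar>version l (T + u) y (s + j r) \<omega> - version l (T + u) y' (s + j r) \<omega>\<bar>"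
          "norm (version l (T + u) z (s + j r) \<omega> - version l (T + u) z' (s + j r) \<omega>)"]
        by (simp add: power2_sum)
      moreover have "0 \<le> h (s + j r) \<omega>" "0 \<le> w (s + j r) \<omega>" by (auto simp: h_def w_def)
      ultimately show "ennreal (h (s + j r) \<omega>) ^ 2 \<le> 2 * ennreal (w (s + j r) \<omega>)"
        by (simp add: ennreal_power ennreal_leI flip: ennreal_numeral ennreal_mult)
    qed
    finally show "indicator A \<omega> * (X' \<omega>)\<^sup>2 \<le> (\<integral>\<^sup>+r. 2 * (indicator A \<omega> * ennreal (w (s + j r) \<omega>)) \<partial>lam)"
      by (auto simp: indicator_def)
  qed
  also have "\<dots> = (\<integral>\<^sup>+r. (\<integral>\<^sup>+\<omega>. 2 * (indicator A \<omega> * ennreal (w (s + j r) \<omega>)) \<partial>M) \<partial>lam)"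
    by (rule L.Fubini') measurable
  also have "\<dots> = 2 * (\<integral>\<^sup>+r. expect_on M A (\<lambda>\<omega>. ennreal (w (s + j r) \<omega>)) \<partial>lam)"
    by (simp add: nn_integral_cmult cong: nn_integral_cong)
  finally show ?thesis
    using K unfolding j_def by (simp add: mult_left_mono ennreal_mult mult.assoc mult.left_commute)
qed

end

section \<open>Two solutions of the equation\<close>

lemma (in prob_space) slices:
  fixes H :: "real \<Rightarrow> 'a \<Rightarrow> real"
  assumes H [measurable]: "joint M H"
    and nn: "\<And>r \<omega>. 0 \<le> H r \<omega>"
    and fin: "dint M H < \<infinity>"
  shows "integrable lborel (\<lambda>r. \<integral>\<omega>. H r \<omega> \<partial>M)"
    and "AE r in lborel. integrable M (\<lambda>\<omega>. H r \<omega>)"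
    and "dint M H = ennreal (\<integral>r. \<integral>\<omega>. H r \<omega> \<partial>M \<partial>lborel)"
    and "(\<integral>\<^sup>+r. \<integral>\<^sup>+\<omega>. ennreal (H r \<omega>) \<partial>M \<partial>lborel) = ennreal (\<integral>r. \<integral>\<omega>. H r \<omega> \<partial>M \<partial>lborel)"
proof -
  interpret P: pair_sigma_finite "lborel :: real measure" M ..
  have eq: "(\<integral>\<^sup>+p. ennreal (case_prod H p) \<partial>(lborel \<Otimes>\<^sub>M M)) = dint M H"
    by (subst P.nn_integral_snd[symmetric]) auto
  have int: "integrable (lborel \<Otimes>\<^sub>M M) (case_prod H)"
    using fin nn by (auto simp: integrable_iff_bounded eq[symmetric] split_beta')
  show "integrable lborel (\<lambda>r. \<integral>\<omega>. H r \<omega> \<partial>M)" using P.integrable_fst[OF int] by simp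
  show "AE r in lborel. integrable M (\<lambda>\<omega>. H r \<omega>)" using P.AE_integrable_fst[OF int] by simp
  have "(\<integral>\<^sup>+p. ennreal (case_prod H p) \<partial>(lborel \<Otimes>\<^sub>M M)) = ennreal (\<integral>p. case_prod H p \<partial>(lborel \<Otimes>\<^sub>M M))"
    using int nn by (intro nn_integral_eq_integral) (auto simp: split_beta')
  also have "(\<integral>p. case_prod H p \<partial>(lborel \<Otimes>\<^sub>M M)) = (\<integral>r. \<integral>\<omega>. H r \<omega> \<partial>M \<partial>lborel)"
    using P.integral_fst[OF int] by simp
  finally show 1: "dint M H = ennreal (\<integral>r. \<integral>\<omega>. H r \<omega> \<partial>M \<partial>lborel)"
    using eq by simp
  show "(\<integral>\<^sup>+r. \<integral>\<^sup>+\<omega>. ennreal (H r \<omega>) \<partial>M \<partial>lborel) = ennreal (\<integral>r. \<integral>\<omega>. H r \<omega> \<partial>M \<partial>lborel)"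
    unfolding 1[symmetric] by (rule P.Fubini'[symmetric]) measurable
qed

lemma (in prob_space) AE_integrable_path:
  fixes H :: "real \<Rightarrow> 'a \<Rightarrow> real"
  assumes H [measurable]: "joint M H"
    and out: "\<And>r \<omega>. r \<notin> {a..b} \<Longrightarrow> H r \<omega> = 0"
    and fin: "dint M (\<lambda>r \<omega>. (H r \<omega>)\<^sup>2) < \<infinity>"
  shows "AE \<omega> in M. integrable lborel (\<lambda>r. H r \<omega>)"
proof -
  have "AE \<omega> in M. (\<integral>\<^sup>+r. ennreal ((H r \<omega>)\<^sup>2) \<partial>lborel) \<noteq> \<infinity>"
    using fin by (intro nn_integral_PInf_AE) auto
  then show ?thesis using AE_space
  proof eventually_elim
    case (elim \<omega>)
    then have "integrable lborel (\<lambda>r. (H r \<omega>)\<^sup>2)"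
      by (auto simp: integrable_iff_bounded less_top)
    moreover have "integrable lborel (indicator {a..b} :: real \<Rightarrow> real)"
      by (cases "a \<le> b") (auto simp: integrable_indicator_iff)
    ultimately have "integrable lborel (\<lambda>r. indicator {a..b} r + (H r \<omega>)\<^sup>2)" by simp
    then show ?case
    proof (rule Bochner_Integration.integrable_bound)
      show "(\<lambda>r. H r \<omega>) \<in> borel_measurable lborel" using elim by measurable
      have "\<bar>x\<bar> \<le> 1 + x\<^sup>2" for x :: real
        using sum_squares_bound[of 1 "\<bar>x\<bar>"] by (simp add: power2_eq_square)
      then show "AE r in lborel. norm (H r \<omega>) \<le> norm (indicator {a..b} r + (H r \<omega>)\<^sup>2)"
        by (intro AE_I2) (auto simp: indicator_def out)
    qed
  qed
qed

lemma (in prob_space) square_add_finite: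
  fixes a b :: "real \<Rightarrow> 'a \<Rightarrow> real"
  assumes [measurable]: "joint M a" "joint M b"
    and a: "dint M (\<lambda>r \<omega>. (a r \<omega>)\<^sup>2) < \<infinity>"
    and b: "dint M (\<lambda>r \<omega>. (b r \<omega>)\<^sup>2) < \<infinity>"
    and le: "\<And>r \<omega>. \<bar>c r \<omega>\<bar> \<le> \<bar>a r \<omega>\<bar> + \<bar>b r \<omega>\<bar>"
  shows "dint M (\<lambda>r \<omega>. (c r \<omega>)\<^sup>2) < \<infinity>"
proof -
  have "dint M (\<lambda>r \<omega>. (c r \<omega>)\<^sup>2) \<le>
    (\<integral>\<^sup>+\<omega>. \<integral>\<^sup>+r. 2 * ennreal ((a r \<omega>)\<^sup>2) + 2 * ennreal ((b r \<omega>)\<^sup>2) \<partial>lborel \<partial>M)"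
  proof (intro nn_integral_mono)
    fix \<omega> r
    have "(c r \<omega>)\<^sup>2 = \<bar>c r \<omega>\<bar>\<^sup>2" by simp
    also have "\<dots> \<le> (\<bar>a r \<omega>\<bar> + \<bar>b r \<omega>\<bar>)\<^sup>2" by (intro power_mono le) auto
    also have "\<dots> \<le> 2 * (a r \<omega>)\<^sup>2 + 2 * (b r \<omega>)\<^sup>2"
      using norm_add_square_le[of 1 "\<bar>a r \<omega>\<bar>" "\<bar>b r \<omega>\<bar>"] by simp
    finally have "(c r \<omega>)\<^sup>2 \<le> 2 * (a r \<omega>)\<^sup>2 + 2 * (b r \<omega>)\<^sup>2" .
    from ennreal_le_lincomb[of 2 2, OF _ _ _ _ this]
    show "ennreal ((c r \<omega>)\<^sup>2) \<le> 2 * ennreal ((a r \<omega>)\<^sup>2) + 2 * ennreal ((b r \<omega>)\<^sup>2)" by simp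
  qed
  also have "\<dots> = 2 * dint M (\<lambda>r \<omega>. (a r \<omega>)\<^sup>2) + 2 * dint M (\<lambda>r \<omega>. (b r \<omega>)\<^sup>2)"
    by (simp add: nn_integral_add nn_integral_cmult cong: nn_integral_cong)
  also have "\<dots> < \<infinity>" using a b by (auto simp: ennreal_mult_less_top)
  finally show ?thesis .
qed

text \<open>
  All conditional estimates are proved in integrated form on the events of the conditioning
  \<open>\<sigma>\<close>-algebra. The event on which the bound fails is one of them, and the finiteness of the
  right-hand side turns the comparison of integrals there into a contradiction.
\<close>

lemma (in finite_measure_subalgebra) AE_le_of_tests:
  assumes f: "f \<in> borel_measurable F" and g: "g \<in> borel_measurable F"
    and le: "\<And>A. A \<in> sets F \<Longrightarrow> (expect_on M A f) \<le> expect_on M A g"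
    and fin: "(\<integral>\<^sup>+\<omega>. g \<omega> \<partial>M) < (\<infinity> :: ennreal)"
  shows "AE \<omega> in M. f \<omega> \<le> g \<omega>"
proof -
  define A where "A = {\<omega>\<in>space F. g \<omega> < f \<omega>}"
  have A: "A \<in> sets F" unfolding A_def using f g by measurable
  have [measurable]: "A \<in> sets M" "f \<in> borel_measurable M" "g \<in> borel_measurable M"
    using A f g subalg measurable_from_subalg[OF subalg] by (auto simp: subalgebra_def)
  have "AE \<omega> in M. indicator A \<omega> * f \<omega> \<le> indicator A \<omega> * g \<omega>"
  proof (rule ccontr)
    assume n: "\<not> (AE \<omega> in M. indicator A \<omega> * f \<omega> \<le> indicator A \<omega> * g \<omega>)"
    have "expect_on M A g \<le> (\<integral>\<^sup>+\<omega>. g \<omega> \<partial>M)"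
      by (intro nn_integral_mono) (auto simp: indicator_def)
    then have "expect_on M A g \<noteq> \<infinity>" using fin by (auto simp: top_unique)
    then have "expect_on M A g < (expect_on M A f)"
    proof (rule nn_integral_less[rotated 2])
      show "AE \<omega> in M. indicator A \<omega> * g \<omega> \<le> indicator A \<omega> * f \<omega>"
        by (rule AE_I2) (auto simp: A_def indicator_def)
      show "\<not> (AE \<omega> in M. indicator A \<omega> * f \<omega> \<le> indicator A \<omega> * g \<omega>)" by (rule n)
    qed auto
    then show False using le[OF A] by simp
  qed
  then show ?thesis
    using AE_space
  proof eventually_elim
    case (elim \<omega>)
    then show ?case
      using subalg by (cases "\<omega> \<in> A") (auto simp: A_def subalgebra_def not_less)
  qed
qed

context brownian
begin

text \<open>
  Before time 0 the process agrees for all times at once with some fixed function \<open>h\<close>, and at each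
  single time almost surely with \<open>Y 0\<close> (for \<open>Z\<close>: with 0). Two constants that agree almost surely
  are equal, so \<open>h\<close> is constant; in particular no measurability question arises for the delay measure.
\<close>

lemma bsde_regular:
  assumes sol: "bsde_solution M B T l u f \<xi> \<eta> Y Z" and l: "0 \<le> l"
  shows "regular l (T + u) Y" and "regular l (T + u) Z"
proof -
  have Y: "Y \<in> L2_bar M B l (T + u)" and Z: "Z \<in> L2_bar M B l (T + u)"
    and past: "\<And>t. t \<in> {-l..<0} \<Longrightarrow> AE \<omega> in M. Y t \<omega> = Y 0 \<omega> \<and> Z t \<omega> = 0"
    using sol unfolding bsde_solution_def by auto
  obtain h where h: "AE \<omega> in M. \<forall>r\<in>{-l..0}. Y r \<omega> = h r"
    using Y unfolding L2_bar_def by blast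
  have hc: "h r = h 0" if r: "r \<in> {-l..<0}" for r
  proof -
    have "AE \<omega> in M. h r = h 0"
      using h past[OF r]
    proof eventually_elim
      case (elim \<omega>)
      have "Y r \<omega> = h r" "Y 0 \<omega> = h 0" using elim(1) r l by auto
      then show ?case using elim(2) by simp
    qed
    then show ?thesis by simp
  qed
  have "AE \<omega> in M. \<forall>r\<in>{-l..<0}. Y r \<omega> = h 0"
    using h
  proof eventually_elim
    case (elim \<omega>)
    show ?case
    proof
      fix r assume r: "r \<in> {-l..<0}"
      then have "Y r \<omega> = h r" using elim by auto
      with hc[OF r] show "Y r \<omega> = h 0" by simp
    qed
  qed
  then show "regular l (T + u) Y" using Y unfolding regular_def by blast
  obtain h' where h': "AE \<omega> in M. \<forall>r\<in>{-l..0}. Z r \<omega> = h' r"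
    using Z unfolding L2_bar_def by blast
  have hc': "h' r = 0" if r: "r \<in> {-l..<0}" for r
  proof -
    have "AE \<omega> in M. h' r = 0"
      using h' past[OF r]
    proof eventually_elim
      case (elim \<omega>)
      have "Z r \<omega> = h' r" using elim(1) r by auto
      then show ?case using elim(2) by simp
    qed
    then show ?thesis by simp
  qed
  have "AE \<omega> in M. \<forall>r\<in>{-l..<0}. Z r \<omega> = 0"
    using h'
  proof eventually_elim
    case (elim \<omega>)
    show ?case
    proof
      fix r assume r: "r \<in> {-l..<0}"
      then have "Z r \<omega> = h' r" using elim by auto
      with hc'[OF r] show "Z r \<omega> = 0" by simp
    qed
  qed
  then show "regular l (T + u) Z" using Z unfolding regular_def by blast
qed

lemma regular_zero: "regular l b (\<lambda>_ _. 0 :: 'b::euclidean_space)"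
proof -
  have "(\<lambda>_ _. 0 :: 'b) \<in> L2_bar M B l b"
    unfolding L2_bar_def L2_process_def prog_measurable_def
    by (auto intro!: exI[of _ "\<lambda>_. 0"])
  then show ?thesis unfolding regular_def by auto
qed

lemma L2_process_indicator:
  fixes \<psi> :: "real \<Rightarrow> 'a \<Rightarrow> 'b::euclidean_space"
  assumes "\<psi> \<in> L2_process M B a b" "a \<le> b"
  shows "(\<lambda>(r, \<omega>). indicator {a..b} r *\<^sub>R \<psi> r \<omega>) \<in> borel_measurable (lborel \<Otimes>\<^sub>M M)"
    and "dint M (\<lambda>r \<omega>. (norm (indicator {a..b} r *\<^sub>R \<psi> r \<omega>))\<^sup>2) < \<infinity>"
proof -
  show "(\<lambda>(r, \<omega>). indicator {a..b} r *\<^sub>R \<psi> r \<omega>) \<in> borel_measurable (lborel \<Otimes>\<^sub>M M)"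
    using assms prog_measurable_joint[of a b \<psi> b] pair_measurable_F_M
    by (auto simp: L2_process_def)
  have "dint M (\<lambda>r \<omega>. (norm (indicator {a..b} r *\<^sub>R \<psi> r \<omega>))\<^sup>2) =
    (\<integral>\<^sup>+\<omega>. (\<integral>\<^sup>+r\<in>{a..b}. ennreal ((norm (\<psi> r \<omega>))\<^sup>2) \<partial>lborel) \<partial>M)"
    by (intro nn_integral_cong) (auto simp: indicator_def)
  then show "dint M (\<lambda>r \<omega>. (norm (indicator {a..b} r *\<^sub>R \<psi> r \<omega>))\<^sup>2) < \<infinity>"
    using assms by (simp add: L2_process_def)
qed

end

locale bsde_pair = brownian M B
  for M :: "'a measure" and B :: "real \<Rightarrow> 'a \<Rightarrow> real ^ 'd" +
  fixes T l u K \<beta> :: real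
    and \<xi> \<xi>' :: "real \<Rightarrow> 'a \<Rightarrow> real" and \<eta> \<eta>' :: "real \<Rightarrow> 'a \<Rightarrow> real ^ 'd"
    and \<phi> \<phi>' :: "real \<Rightarrow> 'a \<Rightarrow> real"
    and g :: "real \<Rightarrow> (real \<Rightarrow> 'a \<Rightarrow> real) \<Rightarrow> (real \<Rightarrow> 'a \<Rightarrow> real ^ 'd) \<Rightarrow> 'a \<Rightarrow> real"
    and lam :: "real measure"
    and Y Y' :: "real \<Rightarrow> 'a \<Rightarrow> real" and Z Z' :: "real \<Rightarrow> 'a \<Rightarrow> real ^ 'd"
  assumes T: "0 < T" and l: "0 \<le> l" and u: "0 \<le> u" and K: "0 < K"
    and \<beta>: "2 \<le> \<beta>" "8 * K\<^sup>2 * exp (\<beta> * l) / \<beta> \<le> 1"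
    and \<xi>: "\<xi> \<in> L2_process M B T (T + u)" "\<xi>' \<in> L2_process M B T (T + u)"
    and \<eta>: "\<eta> \<in> L2_process M B T (T + u)" "\<eta>' \<in> L2_process M B T (T + u)"
    and \<xi>T: "\<xi> T \<in> L2_rv M B T" "\<xi>' T \<in> L2_rv M B T"
    and \<phi>: "\<phi> \<in> L2_process M B 0 T" "\<phi>' \<in> L2_process M B 0 T"
    and g_prog: "\<And>y z. y \<in> L2_bar M B l (T + u) \<Longrightarrow> z \<in> L2_bar M B l (T + u) \<Longrightarrow>
      prog_measurable M B 0 T (\<lambda>t. g t y z)"
    and g0: "(\<lambda>t. g t (\<lambda>_ _. 0) (\<lambda>_ _. 0)) \<in> L2_process M B 0 T"
    and lam: "prob_space lam" "sets lam = sets (restrict_space borel {-l..u})"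
    and lip: "lipschitz_coefficient M B T l u K lam g"
    and sol: "bsde_solution M B T l u (\<lambda>t y z \<omega>. g t y z \<omega> + \<phi> t \<omega>) \<xi> \<eta> Y Z"
    and sol': "bsde_solution M B T l u (\<lambda>t y z \<omega>. g t y z \<omega> + \<phi>' t \<omega>) \<xi>' \<eta>' Y' Z'"
begin

abbreviation version' :: "(real \<Rightarrow> 'a \<Rightarrow> 'b::euclidean_space) \<Rightarrow> real \<Rightarrow> 'a \<Rightarrow> 'b"
  where "version' \<equiv> version l (T + u)"

lemma Tu: "0 \<le> T + u" using T u by simp

lemmas regular_solution = bsde_regular[OF sol l] bsde_regular[OF sol' l]

lemma regular_g_measurable:
  assumes "regular l (T + u) y" "regular l (T + u) z"
  shows "(\<lambda>(r, \<omega>). indicator {0..T} r *\<^sub>R g r y z \<omega>) \<in> borel_measurable (lborel \<Otimes>\<^sub>M M)"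
    and "s \<in> {0..T} \<Longrightarrow> g s y z \<in> borel_measurable (F s)"
proof -
  have p: "prog_measurable M B 0 T (\<lambda>t. g t y z)"
    using assms by (intro g_prog) (auto simp: regular_def)
  show "(\<lambda>(r, \<omega>). indicator {0..T} r *\<^sub>R g r y z \<omega>) \<in> borel_measurable (lborel \<Otimes>\<^sub>M M)"
    using prog_measurable_joint[OF p, of T] T by (intro pair_measurable_F_M[of _ T]) auto
  show "s \<in> {0..T} \<Longrightarrow> g s y z \<in> borel_measurable (F s)" by (rule prog_measurable_at[OF p])
qed

lemma g_difference_bound:
  assumes reg: "regular l (T + u) y" "regular l (T + u) z" "regular l (T + u) y'" "regular l (T + u) z'"
    and t: "0 \<le> t" and A: "A \<in> sets (F t)" and b: "0 \<le> b"
  defines "w \<equiv> (\<lambda>v \<omega>. (version' y v \<omega> - version' y' v \<omega>)\<^sup>2 + (norm (version' z v \<omega> - version' z' v \<omega>))\<^sup>2)"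
  shows "(\<integral>\<^sup>+s\<in>{t..T}. ennreal (exp (b * s)) * expect_on M A (\<lambda>\<omega>. ennreal ((g s y z \<omega> - g s y' z' \<omega>)\<^sup>2)) \<partial>lborel)
    \<le> ennreal (2 * K\<^sup>2 * exp (b * l)) *
      (\<integral>\<^sup>+v\<in>{t - l..T + u}. ennreal (exp (b * v)) * expect_on M A (\<lambda>\<omega>. ennreal (w v \<omega>)) \<partial>lborel)"
proof -
  note [measurable] = version_measurable[OF reg(1) Tu] version_measurable[OF reg(2) Tu]
    version_measurable[OF reg(3) Tu] version_measurable[OF reg(4) Tu]
  have [measurable]: "A \<in> sets M" using A sets_F_subset by auto
  have [measurable]: "joint M w" unfolding w_def by measurable
  interpret lam: prob_space lam by (rule lam(1))
  define wA where "wA v = expect_on M A (\<lambda>\<omega>. ennreal (w v \<omega>))" for v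
  have [measurable]: "wA \<in> borel_measurable borel" unfolding wA_def[abs_def] by measurable
  have wm: "(\<lambda>s. \<integral>\<^sup>+r. wA (s + r) \<partial>lam) \<in> borel_measurable borel"
  proof -
    define j :: "real \<Rightarrow> real" where "j r = r" for r
    have [measurable]: "j \<in> borel_measurable lam"
      unfolding j_def[abs_def] by (rule delay_measure_space(2)[OF lam(2)]) simp
    have "(\<lambda>s. \<integral>\<^sup>+r. wA (s + j r) \<partial>lam) \<in> borel_measurable borel" by measurable
    then show ?thesis by (simp add: j_def)
  qed
  have "(\<integral>\<^sup>+s\<in>{t..T}. ennreal (exp (b * s)) * expect_on M A (\<lambda>\<omega>. ennreal ((g s y z \<omega> - g s y' z' \<omega>)\<^sup>2)) \<partial>lborel)
    \<le> (\<integral>\<^sup>+s. ennreal (2 * K\<^sup>2) * (ennreal (exp (b * s)) * (\<integral>\<^sup>+r. wA (s + r) \<partial>lam) * indicator {t..T} s) \<partial>lborel)"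
  proof (rule nn_integral_mono)
    fix s
    show "ennreal (exp (b * s)) * expect_on M A (\<lambda>\<omega>. ennreal ((g s y z \<omega> - g s y' z' \<omega>)\<^sup>2)) * indicator {t..T} s
      \<le> ennreal (2 * K\<^sup>2) * (ennreal (exp (b * s)) * (\<integral>\<^sup>+r. wA (s + r) \<partial>lam) * indicator {t..T} s)"
    proof (cases "s \<in> {t..T}")
      case True
      then have s: "s \<in> {0..T}" "A \<in> sets (F s)" using t A sets_F_mono[of t s] by auto
      have "expect_on M A (\<lambda>\<omega>. ennreal ((g s y z \<omega> - g s y' z' \<omega>)\<^sup>2)) \<le> ennreal (2 * K\<^sup>2) * (\<integral>\<^sup>+r. wA (s + r) \<partial>lam)"
        unfolding wA_def w_def
        by (rule lipschitz_mean_square[OF lip lam reg s(1) Tu _ _ _ s(2)])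
           (use K regular_g_measurable(2)[OF reg(1,2) s(1)] regular_g_measurable(2)[OF reg(3,4) s(1)] in auto)
      from mult_left_mono[OF this, of "ennreal (exp (b * s))"] show ?thesis
        using True by (simp add: mult.left_commute)
    qed simp
  qed
  also have "\<dots> = ennreal (2 * K\<^sup>2) * (\<integral>\<^sup>+s\<in>{t..T}. ennreal (exp (b * s)) * (\<integral>\<^sup>+r. wA (s + r) \<partial>lam) \<partial>lborel)"
    by (rule nn_integral_cmult) (use wm in measurable)
  also have "\<dots> \<le> ennreal (2 * K\<^sup>2) * (ennreal (exp (b * l)) * (\<integral>\<^sup>+v\<in>{t - l..T + u}. ennreal (exp (b * v)) * wA v \<partial>lborel))"
    by (intro mult_left_mono shift_integral_le[OF lam _ b]) auto
  also have "\<dots> = ennreal (2 * K\<^sup>2 * exp (b * l)) * (\<integral>\<^sup>+v\<in>{t - l..T + u}. ennreal (exp (b * v)) * wA v \<partial>lborel)"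
    by (simp add: ennreal_mult mult.assoc)
  finally show ?thesis unfolding wA_def .
qed

lemma version_square_integrable_swapped:
  assumes h: "regular l (T + u) h"
  shows "(\<integral>\<^sup>+v. \<integral>\<^sup>+\<omega>. ennreal ((norm (version' h v \<omega>))\<^sup>2) \<partial>M \<partial>lborel) < \<infinity>"
proof -
  interpret P: pair_sigma_finite "lborel :: real measure" M ..
  note [measurable] = version_measurable[OF h Tu]
  have "dint M (\<lambda>r \<omega>. (norm (version' h r \<omega>))\<^sup>2) =
      (\<integral>\<^sup>+v. \<integral>\<^sup>+\<omega>. ennreal ((norm (version' h v \<omega>))\<^sup>2) \<partial>M \<partial>lborel)"
    by (rule P.Fubini') measurable
  with version_square_integrable[OF h l Tu] show ?thesis by simp
qed

lemma difference_square_integrable: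
  assumes reg: "regular l (T + u) y" "regular l (T + u) z" "regular l (T + u) y'" "regular l (T + u) z'"
  shows "(\<integral>\<^sup>+v. \<integral>\<^sup>+\<omega>. ennreal ((version' y v \<omega> - version' y' v \<omega>)\<^sup>2 + (norm (version' z v \<omega> - version' z' v \<omega>))\<^sup>2) \<partial>M \<partial>lborel) < \<infinity>"
proof -
  interpret P: pair_sigma_finite "lborel :: real measure" M ..
  note [measurable] = version_measurable[OF reg(1) Tu] version_measurable[OF reg(2) Tu]
    version_measurable[OF reg(3) Tu] version_measurable[OF reg(4) Tu]
  have two: "(norm (a - b))\<^sup>2 \<le> 2 * (norm a)\<^sup>2 + 2 * (norm b)\<^sup>2" for a b :: "'x::real_inner"
    using norm_add_square_le[of 1 a "- b"] by simp
  have "(\<integral>\<^sup>+v. \<integral>\<^sup>+\<omega>. ennreal ((version' y v \<omega> - version' y' v \<omega>)\<^sup>2 + (norm (version' z v \<omega> - version' z' v \<omega>))\<^sup>2) \<partial>M \<partial>lborel)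
    \<le> (\<integral>\<^sup>+v. \<integral>\<^sup>+\<omega>. (2 * ennreal ((norm (version' y v \<omega>))\<^sup>2) + 2 * ennreal ((norm (version' y' v \<omega>))\<^sup>2)) +
        (2 * ennreal ((norm (version' z v \<omega>))\<^sup>2) + 2 * ennreal ((norm (version' z' v \<omega>))\<^sup>2)) \<partial>M \<partial>lborel)"
  proof (intro nn_integral_mono)
    fix v \<omega>
    have "ennreal ((version' y v \<omega> - version' y' v \<omega>)\<^sup>2) \<le> 2 * ennreal ((norm (version' y v \<omega>))\<^sup>2) + 2 * ennreal ((norm (version' y' v \<omega>))\<^sup>2)"
      using ennreal_le_lincomb[of 2 2, OF _ _ _ _ two[of "version' y v \<omega>" "version' y' v \<omega>"]] by simp
    moreover have "ennreal ((norm (version' z v \<omega> - version' z' v \<omega>))\<^sup>2) \<le> 2 * ennreal ((norm (version' z v \<omega>))\<^sup>2) + 2 * ennreal ((norm (version' z' v \<omega>))\<^sup>2)"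
      using ennreal_le_lincomb[of 2 2, OF _ _ _ _ two[of "version' z v \<omega>" "version' z' v \<omega>"]] by simp
    ultimately show "ennreal ((version' y v \<omega> - version' y' v \<omega>)\<^sup>2 + (norm (version' z v \<omega> - version' z' v \<omega>))\<^sup>2) \<le>
       (2 * ennreal ((norm (version' y v \<omega>))\<^sup>2) + 2 * ennreal ((norm (version' y' v \<omega>))\<^sup>2)) +
        (2 * ennreal ((norm (version' z v \<omega>))\<^sup>2) + 2 * ennreal ((norm (version' z' v \<omega>))\<^sup>2))"
      by (subst ennreal_plus) (auto intro: add_mono)
  qed
  also have "\<dots> < \<infinity>"
    using version_square_integrable_swapped[OF reg(1)] version_square_integrable_swapped[OF reg(2)]
      version_square_integrable_swapped[OF reg(3)] version_square_integrable_swapped[OF reg(4)]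
    by (simp add: nn_integral_add nn_integral_cmult ennreal_mult_less_top)
  finally show ?thesis .
qed

text \<open>
  Comparison with \<open>g\<close> at the zero processes. Square integrability makes the time integral in the
  equation a genuine one, so that two equations may be subtracted.
\<close>

lemma g_square_integrable:
  assumes reg: "regular l (T + u) y" "regular l (T + u) z"
  shows "dint M (\<lambda>r \<omega>. (indicator {0..T} r *\<^sub>R g r y z \<omega>)\<^sup>2) < \<infinity>"
proof -
  interpret P: pair_sigma_finite "lborel :: real measure" M ..
  define o1 :: "real \<Rightarrow> 'a \<Rightarrow> real" where "o1 = (\<lambda>_ _. 0)"
  define o2 :: "real \<Rightarrow> 'a \<Rightarrow> real^'d" where "o2 = (\<lambda>_ _. 0)"
  have ro: "regular l (T + u) o1" "regular l (T + u) o2"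
    unfolding o1_def o2_def by (rule regular_zero)+
  define a where "a r \<omega> = indicator {0..T} r *\<^sub>R g r y z \<omega>" for r \<omega>
  define b where "b r \<omega> = indicator {0..T} r *\<^sub>R g r o1 o2 \<omega>" for r \<omega>
  have [measurable]: "joint M a" "joint M b"
    using regular_g_measurable(1)[OF reg] regular_g_measurable(1)[OF ro] by (simp_all add: a_def[abs_def] b_def[abs_def])
  have b_fin: "dint M (\<lambda>r \<omega>. (b r \<omega>)\<^sup>2) < \<infinity>"
    using L2_process_indicator(2)[OF g0] T by (simp add: b_def o1_def o2_def)
  define w where "w = (\<lambda>v \<omega>. (version' y v \<omega> - version' o1 v \<omega>)\<^sup>2 + (norm (version' z v \<omega> - version' o2 v \<omega>))\<^sup>2)"
  have top: "space M \<in> sets (F 0)" using sets.top[of "F 0"] by simp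
  have "dint M (\<lambda>r \<omega>. (a r \<omega> - b r \<omega>)\<^sup>2) = (\<integral>\<^sup>+r. \<integral>\<^sup>+\<omega>. ennreal ((a r \<omega> - b r \<omega>)\<^sup>2) \<partial>M \<partial>lborel)"
    by (rule P.Fubini') measurable
  also have "\<dots> = (\<integral>\<^sup>+s\<in>{0..T}. ennreal (exp (0 * s)) * (\<integral>\<^sup>+\<omega>. indicator (space M) \<omega> * ennreal ((g s y z \<omega> - g s o1 o2 \<omega>)\<^sup>2) \<partial>M) \<partial>lborel)"
    by (intro nn_integral_cong) (auto simp: a_def b_def indicator_def intro!: nn_integral_cong)
  also have "\<dots> \<le> ennreal (2 * K\<^sup>2 * exp (0 * l)) * (\<integral>\<^sup>+v\<in>{0 - l..T + u}. ennreal (exp (0 * v)) * (\<integral>\<^sup>+\<omega>. indicator (space M) \<omega> * ennreal (w v \<omega>) \<partial>M) \<partial>lborel)"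
    unfolding w_def by (rule g_difference_bound[OF reg ro _ top]) auto
  also have "\<dots> \<le> ennreal (2 * K\<^sup>2 * exp (0 * l)) * (\<integral>\<^sup>+v. \<integral>\<^sup>+\<omega>. ennreal (w v \<omega>) \<partial>M \<partial>lborel)"
    by (intro mult_left_mono nn_integral_mono) (auto simp: indicator_def intro!: nn_integral_mono)
  also have "\<dots> < \<infinity>"
    using difference_square_integrable[OF reg ro] unfolding w_def by (simp add: ennreal_mult_less_top)
  finally have ab: "dint M (\<lambda>r \<omega>. (a r \<omega> - b r \<omega>)\<^sup>2) < \<infinity>" .
  have "dint M (\<lambda>r \<omega>. (a r \<omega>)\<^sup>2) < \<infinity>"
    by (rule square_add_finite[OF _ _ ab b_fin]) auto
  then show ?thesis by (simp add: a_def)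
qed

end

section \<open>The weighted energy estimate for the difference\<close>

lemma (in brownian) ito_rep_cong:
  assumes "ito_rep s T V J" "\<And>r \<omega>. r \<in> {s..T} \<Longrightarrow> V r \<omega> = V' r \<omega>"
  shows "ito_rep s T V' J"
proof -
  have "(\<integral>\<^sup>+r\<in>{s..T}. ennreal ((norm (V r \<omega>))\<^sup>2) \<partial>lborel) = (\<integral>\<^sup>+r\<in>{s..T}. ennreal ((norm (V' r \<omega>))\<^sup>2) \<partial>lborel)" for \<omega>
    using assms(2) by (intro nn_integral_cong) (auto simp: indicator_def)
  then show ?thesis using assms(1) unfolding ito_rep_def by simp
qed

context bsde_pair
begin

text \<open>
  \<open>U\<close> and \<open>V\<close> are the differences of the two solutions, \<open>G\<close> and \<open>P\<close> those of the generators along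
  the solutions and of \<open>\<phi>\<close> and \<open>\<phi>'\<close>, cut off outside \<open>[0, T]\<close>; \<open>\<Xi>\<close> is the terminal difference.
\<close>

definition U :: "real \<Rightarrow> 'a \<Rightarrow> real" where "U r \<omega> = version' Y r \<omega> - version' Y' r \<omega>"
definition V :: "real \<Rightarrow> 'a \<Rightarrow> real^'d" where "V r \<omega> = version' Z r \<omega> - version' Z' r \<omega>"
definition w :: "real \<Rightarrow> 'a \<Rightarrow> real" where "w r \<omega> = (U r \<omega>)\<^sup>2 + (norm (V r \<omega>))\<^sup>2"
definition gY :: "real \<Rightarrow> 'a \<Rightarrow> real" where "gY r \<omega> = indicator {0..T} r *\<^sub>R g r Y Z \<omega>"
definition gY' :: "real \<Rightarrow> 'a \<Rightarrow> real" where "gY' r \<omega> = indicator {0..T} r *\<^sub>R g r Y' Z' \<omega>"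
definition \<phi>h :: "real \<Rightarrow> 'a \<Rightarrow> real" where "\<phi>h r \<omega> = indicator {0..T} r *\<^sub>R \<phi> r \<omega>"
definition \<phi>h' :: "real \<Rightarrow> 'a \<Rightarrow> real" where "\<phi>h' r \<omega> = indicator {0..T} r *\<^sub>R \<phi>' r \<omega>"
definition G :: "real \<Rightarrow> 'a \<Rightarrow> real" where "G r \<omega> = gY r \<omega> - gY' r \<omega>"
definition P :: "real \<Rightarrow> 'a \<Rightarrow> real" where "P r \<omega> = \<phi>h r \<omega> - \<phi>h' r \<omega>"
definition \<Xi> :: "'a \<Rightarrow> real" where "\<Xi> \<omega> = \<xi> T \<omega> - \<xi>' T \<omega>"

lemma jointly_measurable [measurable]:
  "joint M U" "joint M V"
  "joint M w"
  "joint M gY" "joint M gY'"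
  "joint M \<phi>h" "joint M \<phi>h'"
  "joint M G" "joint M P"
proof -
  note [measurable] = regular_solution[THEN version_measurable, OF Tu]
  show U [measurable]: "joint M U" unfolding U_def by measurable
  show V [measurable]: "joint M V" unfolding V_def by measurable
  show "joint M w" unfolding w_def by measurable
  show [measurable]: "joint M gY" "joint M gY'"
    using regular_g_measurable(1)[OF regular_solution(1,2)] regular_g_measurable(1)[OF regular_solution(3,4)]
    by (simp_all add: gY_def[abs_def] gY'_def[abs_def])
  show [measurable]: "joint M \<phi>h" "joint M \<phi>h'"
    using \<phi>[THEN L2_process_indicator(1)] T
    by (simp_all add: \<phi>h_def[abs_def] \<phi>h'_def[abs_def])
  show "joint M G" unfolding G_def by measurable
  show "joint M P" unfolding P_def by measurable
qed

lemma adapted: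
  assumes "s \<in> {0..T}"
  shows "U s \<in> borel_measurable (F s)" "G s \<in> borel_measurable (F s)" "P s \<in> borel_measurable (F s)"
proof -
  have s: "s \<in> {0..T + u}" using assms u by auto
  have "prog_measurable M B 0 (T + u) Y" "prog_measurable M B 0 (T + u) Y'"
    using regular_solution(1,3) by (auto simp: regular_def L2_bar_def L2_process_def)
  note [measurable] = this[THEN prog_measurable_at, OF s]
  have "(\<lambda>\<omega>. Y s \<omega> - Y' s \<omega>) \<in> borel_measurable (F s)" by measurable
  then show "U s \<in> borel_measurable (F s)" using s by (simp add: U_def[abs_def] version_eq)
  note [measurable] = regular_g_measurable(2)[OF regular_solution(1,2) assms] regular_g_measurable(2)[OF regular_solution(3,4) assms]
  have "(\<lambda>\<omega>. g s Y Z \<omega> - g s Y' Z' \<omega>) \<in> borel_measurable (F s)" by measurable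
  then show "G s \<in> borel_measurable (F s)" using assms by (simp add: G_def[abs_def] gY_def gY'_def)
  have "prog_measurable M B 0 T \<phi>" "prog_measurable M B 0 T \<phi>'"
    using \<phi> by (auto simp: L2_process_def)
  note [measurable] = this[THEN prog_measurable_at, OF assms]
  have "(\<lambda>\<omega>. \<phi> s \<omega> - \<phi>' s \<omega>) \<in> borel_measurable (F s)" by measurable
  then show "P s \<in> borel_measurable (F s)" using assms by (simp add: P_def[abs_def] \<phi>h_def \<phi>h'_def)
qed

lemma w_finite: "dint M w < \<infinity>"
proof -
  interpret Q: pair_sigma_finite "lborel :: real measure" M ..
  have "dint M w = (\<integral>\<^sup>+r. \<integral>\<^sup>+\<omega>. ennreal (w r \<omega>) \<partial>M \<partial>lborel)"
    by (rule Q.Fubini') measurable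
  then show ?thesis
    using difference_square_integrable[OF regular_solution] by (simp add: w_def U_def V_def)
qed

lemma squares_finite:
  "dint M (\<lambda>r \<omega>. (U r \<omega>)\<^sup>2) < \<infinity>"
  "dint M (\<lambda>r \<omega>. (norm (V r \<omega>))\<^sup>2) < \<infinity>"
  "dint M (\<lambda>r \<omega>. (gY r \<omega>)\<^sup>2) < \<infinity>"
  "dint M (\<lambda>r \<omega>. (gY' r \<omega>)\<^sup>2) < \<infinity>"
  "dint M (\<lambda>r \<omega>. (\<phi>h r \<omega>)\<^sup>2) < \<infinity>"
  "dint M (\<lambda>r \<omega>. (\<phi>h' r \<omega>)\<^sup>2) < \<infinity>"
  "dint M (\<lambda>r \<omega>. (G r \<omega>)\<^sup>2) < \<infinity>"
  "dint M (\<lambda>r \<omega>. (P r \<omega>)\<^sup>2) < \<infinity>"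
proof -
  have "dint M (\<lambda>r \<omega>. (U r \<omega>)\<^sup>2) \<le> dint M w"
    "dint M (\<lambda>r \<omega>. (norm (V r \<omega>))\<^sup>2) \<le> dint M w"
    by (intro nn_integral_mono ennreal_leI; simp add: w_def)+
  then show "dint M (\<lambda>r \<omega>. (U r \<omega>)\<^sup>2) < \<infinity>"
    "dint M (\<lambda>r \<omega>. (norm (V r \<omega>))\<^sup>2) < \<infinity>"
    using w_finite by (auto intro: order_le_less_trans)
  show g: "dint M (\<lambda>r \<omega>. (gY r \<omega>)\<^sup>2) < \<infinity>"
    "dint M (\<lambda>r \<omega>. (gY' r \<omega>)\<^sup>2) < \<infinity>"
    unfolding gY_def gY'_def
    using g_square_integrable[OF regular_solution(1,2)] g_square_integrable[OF regular_solution(3,4)] by auto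
  show p: "dint M (\<lambda>r \<omega>. (\<phi>h r \<omega>)\<^sup>2) < \<infinity>"
    "dint M (\<lambda>r \<omega>. (\<phi>h' r \<omega>)\<^sup>2) < \<infinity>"
    unfolding \<phi>h_def \<phi>h'_def using L2_process_indicator(2)[OF \<phi>(1)] L2_process_indicator(2)[OF \<phi>(2)] T by auto
  show "dint M (\<lambda>r \<omega>. (G r \<omega>)\<^sup>2) < \<infinity>"
    by (rule square_add_finite[OF _ _ g]) (auto simp: G_def)
  show "dint M (\<lambda>r \<omega>. (P r \<omega>)\<^sup>2) < \<infinity>"
    by (rule square_add_finite[OF _ _ p]) (auto simp: P_def)
qed

lemma vanish_outside: "r \<notin> {0..T} \<Longrightarrow> gY r \<omega> = 0 \<and> gY' r \<omega> = 0 \<and> \<phi>h r \<omega> = 0 \<and> \<phi>h' r \<omega> = 0 \<and> G r \<omega> = 0 \<and> P r \<omega> = 0"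
  by (simp add: gY_def gY'_def \<phi>h_def \<phi>h'_def G_def P_def)

lemma bsde_difference:
  "\<exists>J. \<forall>s\<in>{0..<T}. ito_rep s T V (J s) \<and>
    (AE \<omega> in M. U s \<omega> = \<Xi> \<omega> + (\<integral>r. indicator {s..} r * (G r \<omega> + P r \<omega>) \<partial>lborel) - J s \<omega>)"
proof (rule bchoice, rule ballI)
  fix s assume s: "s \<in> {0..<T}"
  obtain I where I: "has_ito_integral M B s T Z I"
    "AE \<omega> in M. Y s \<omega> = \<xi> T \<omega> + (LINT r:{s..T}|lborel. g r Y Z \<omega> + \<phi> r \<omega>) - I \<omega>"
    using sol s unfolding bsde_solution_def by blast
  obtain I' where I': "has_ito_integral M B s T Z' I'"
    "AE \<omega> in M. Y' s \<omega> = \<xi>' T \<omega> + (LINT r:{s..T}|lborel. g r Y' Z' \<omega> + \<phi>' r \<omega>) - I' \<omega>"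
    using sol' s unfolding bsde_solution_def by blast
  have Zj: "(\<lambda>(r, \<omega>). indicator {s..T} r *\<^sub>R X r \<omega>) \<in> borel_measurable (lborel \<Otimes>\<^sub>M M)"
    if "regular l (T + u) X" for X :: "real \<Rightarrow> 'a \<Rightarrow> real^'d"
  proof -
    note [measurable] = version_measurable[OF that Tu]
    have "(\<lambda>(r, \<omega>). indicator {s..T} r *\<^sub>R version' X r \<omega>) \<in> borel_measurable (lborel \<Otimes>\<^sub>M M)" by measurable
    also have "(\<lambda>(r, \<omega>). indicator {s..T} r *\<^sub>R version' X r \<omega>) = (\<lambda>(r, \<omega>). indicator {s..T} r *\<^sub>R X r \<omega>)"
      using s u by (auto simp: fun_eq_iff indicator_def version_eq)
    finally show ?thesis .
  qed
  have VZ: "V r \<omega> = Z r \<omega> - Z' r \<omega>" if "r \<in> {s..T}" for r \<omega>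
    using that s u by (simp add: V_def version_eq)
  have "(\<integral>\<^sup>+\<omega>. (\<integral>\<^sup>+r\<in>{s..T}. ennreal ((norm (Z r \<omega> - Z' r \<omega>))\<^sup>2) \<partial>lborel) \<partial>M) \<le>
      (dint M (\<lambda>r \<omega>. (norm (V r \<omega>))\<^sup>2))"
    using VZ by (intro nn_integral_mono) (auto simp: indicator_def)
  then have fin: "(\<integral>\<^sup>+\<omega>. (\<integral>\<^sup>+r\<in>{s..T}. ennreal ((norm (Z r \<omega> - Z' r \<omega>))\<^sup>2) \<partial>lborel) \<partial>M) < \<infinity>"
    using squares_finite(2) by (rule order_le_less_trans)
  have "ito_rep s T (\<lambda>r \<omega>. Z r \<omega> - Z' r \<omega>) (\<lambda>\<omega>. I \<omega> - I' \<omega>)"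
    by (rule ito_rep_difference[OF _ I(1) I'(1) Zj Zj fin]) (use s regular_solution in auto)
  then have rep: "ito_rep s T V (\<lambda>\<omega>. I \<omega> - I' \<omega>)"
    by (rule ito_rep_cong) (simp add: VZ)
  have path: "AE \<omega> in M. integrable lborel (\<lambda>r. gY r \<omega>)" "AE \<omega> in M. integrable lborel (\<lambda>r. gY' r \<omega>)"
    "AE \<omega> in M. integrable lborel (\<lambda>r. \<phi>h r \<omega>)" "AE \<omega> in M. integrable lborel (\<lambda>r. \<phi>h' r \<omega>)"
    by (rule AE_integrable_path[of _ 0 T]; use vanish_outside squares_finite in auto)+
  have "AE \<omega> in M. U s \<omega> = \<Xi> \<omega> + (\<integral>r. indicator {s..} r * (G r \<omega> + P r \<omega>) \<partial>lborel) - (I \<omega> - I' \<omega>)"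
    using I(2) I'(2) path
  proof eventually_elim
    case (elim \<omega>)
    have i: "integrable lborel (\<lambda>r. indicator {s..} r * (gY r \<omega> + \<phi>h r \<omega>))"
       "integrable lborel (\<lambda>r. indicator {s..} r * (gY' r \<omega> + \<phi>h' r \<omega>))"
      using integrable_mult_indicator[OF _ Bochner_Integration.integrable_add[OF elim(3,5)], of "{s..}"]
        integrable_mult_indicator[OF _ Bochner_Integration.integrable_add[OF elim(4,6)], of "{s..}"] by auto
    have "(LINT r:{s..T}|lborel. g r Y Z \<omega> + \<phi> r \<omega>) = (\<integral>r. indicator {s..} r * (gY r \<omega> + \<phi>h r \<omega>) \<partial>lborel)"
      unfolding set_lebesgue_integral_def
      using s by (intro Bochner_Integration.integral_cong) (auto simp: gY_def \<phi>h_def indicator_def)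
    moreover have "(LINT r:{s..T}|lborel. g r Y' Z' \<omega> + \<phi>' r \<omega>) = (\<integral>r. indicator {s..} r * (gY' r \<omega> + \<phi>h' r \<omega>) \<partial>lborel)"
      unfolding set_lebesgue_integral_def
      using s by (intro Bochner_Integration.integral_cong) (auto simp: gY'_def \<phi>h'_def indicator_def)
    moreover have "(\<integral>r. indicator {s..} r * (G r \<omega> + P r \<omega>) \<partial>lborel) =
      (\<integral>r. indicator {s..} r * (gY r \<omega> + \<phi>h r \<omega>) - indicator {s..} r * (gY' r \<omega> + \<phi>h' r \<omega>) \<partial>lborel)"
      by (intro Bochner_Integration.integral_cong) (auto simp: G_def P_def algebra_simps)
    moreover have "\<dots> = (\<integral>r. indicator {s..} r * (gY r \<omega> + \<phi>h r \<omega>) \<partial>lborel) - (\<integral>r. indicator {s..} r * (gY' r \<omega> + \<phi>h' r \<omega>) \<partial>lborel)"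
      by (rule Bochner_Integration.integral_diff[OF i])
    moreover have "U s \<omega> = Y s \<omega> - Y' s \<omega>" using s u by (simp add: U_def version_eq)
    ultimately show ?case using elim(1,2) by (simp add: \<Xi>_def)
  qed
  with rep show "\<exists>J. ito_rep s T V J \<and>
    (AE \<omega> in M. U s \<omega> = \<Xi> \<omega> + (\<integral>r. indicator {s..} r * (G r \<omega> + P r \<omega>) \<partial>lborel) - J \<omega>)"
    by blast
qed

lemma \<Xi>_measurable [measurable]: "\<Xi> \<in> borel_measurable M"
  using \<xi>T measurable_F_M unfolding \<Xi>_def[abs_def] L2_rv_def by (intro borel_measurable_diff) blast+

lemma \<Xi>_square_integrable: "integrable M (\<lambda>\<omega>. (\<Xi> \<omega>)\<^sup>2)"
proof -
  have m: "\<xi> T \<in> borel_measurable M" "\<xi>' T \<in> borel_measurable M"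
    using \<xi>T unfolding L2_rv_def by (blast intro: measurable_F_M)+
  then have "integrable M (\<lambda>\<omega>. (\<xi> T \<omega> + - \<xi>' T \<omega>)\<^sup>2)"
    using \<xi>T by (intro integrable_square_add) (auto simp: L2_rv_def integrable_iff_bounded)
  then show ?thesis by (simp add: \<Xi>_def)
qed

definition weighted :: "real \<Rightarrow> 'a set \<Rightarrow> (real \<Rightarrow> 'a \<Rightarrow> real) \<Rightarrow> real \<Rightarrow> 'a \<Rightarrow> real" where
  "weighted t A X r \<omega> = indicator {t..T} r * (exp (\<beta> * r) * (indicator A \<omega> * X r \<omega>))"

lemma weighted_slices:
  assumes [measurable]: "joint M X" "A \<in> sets M"
    and nn: "\<And>r \<omega>. 0 \<le> X r \<omega>"
    and fin: "dint M X < \<infinity>"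
  shows "integrable lborel (\<lambda>r. \<integral>\<omega>. weighted t A X r \<omega> \<partial>M)"
    and "AE r in lborel. integrable M (\<lambda>\<omega>. weighted t A X r \<omega>)"
    and "(\<integral>\<^sup>+r. \<integral>\<^sup>+\<omega>. ennreal (weighted t A X r \<omega>) \<partial>M \<partial>lborel) = ennreal (\<integral>r. \<integral>\<omega>. weighted t A X r \<omega> \<partial>M \<partial>lborel)"
proof -
  have [measurable]: "joint M (weighted t A X)"
    unfolding weighted_def by measurable
  have "dint M (weighted t A X) \<le>
    (\<integral>\<^sup>+\<omega>. \<integral>\<^sup>+r. ennreal (exp (\<beta> * T)) * ennreal (X r \<omega>) \<partial>lborel \<partial>M)"
  proof (intro nn_integral_mono)
    fix \<omega> r
    have "weighted t A X r \<omega> \<le> exp (\<beta> * T) * X r \<omega>"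
      using nn[of r \<omega>] \<beta>(1) by (auto simp: weighted_def indicator_def intro!: mult_right_mono)
    then show "ennreal (weighted t A X r \<omega>) \<le> ennreal (exp (\<beta> * T)) * ennreal (X r \<omega>)"
      using nn[of r \<omega>] by (simp flip: ennreal_mult add: ennreal_leI)
  qed
  also have "\<dots> = ennreal (exp (\<beta> * T)) * dint M X"
    by (simp add: nn_integral_cmult cong: nn_integral_cong)
  also have "\<dots> < \<infinity>" using fin by (simp add: ennreal_mult_less_top)
  finally have fin': "dint M (weighted t A X) < \<infinity>" .
  have nn': "0 \<le> weighted t A X r \<omega>" for r \<omega> using nn by (simp add: weighted_def)
  have m: "joint M (weighted t A X)" by measurable
  note * = slices[OF m nn' fin']
  show "integrable lborel (\<lambda>r. \<integral>\<omega>. weighted t A X r \<omega> \<partial>M)"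
    "AE r in lborel. integrable M (\<lambda>\<omega>. weighted t A X r \<omega>)"
    "(\<integral>\<^sup>+r. \<integral>\<^sup>+\<omega>. ennreal (weighted t A X r \<omega>) \<partial>M \<partial>lborel) = ennreal (\<integral>r. \<integral>\<omega>. weighted t A X r \<omega> \<partial>M \<partial>lborel)"
    by (fact *)+
qed

abbreviation wint :: "real \<Rightarrow> 'a set \<Rightarrow> (real \<Rightarrow> 'a \<Rightarrow> real) \<Rightarrow> real" where
  "wint t A X \<equiv> (\<integral>r. \<integral>\<omega>. weighted t A X r \<omega> \<partial>M \<partial>lborel)"

text \<open>
  The energy identity for the processes multiplied by the indicator of \<open>A\<close>, weighted with
  \<open>exp (\<beta> * s)\<close>. The weight contributes \<open>\<beta> * U\<^sup>2\<close>; Young's inequality spends \<open>\<beta> / 2\<close> of it on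
  \<open>2 * G * U\<close> and \<open>1 / 4\<close> on \<open>2 * P * U\<close>.
\<close>

lemma energy_inequality:
  assumes t: "t \<in> {0..<T}" and A: "A \<in> sets (F t)"
  shows "integrable M (\<lambda>\<omega>. indicator A \<omega> * (U t \<omega>)\<^sup>2)"
    and "exp (\<beta> * t) * (\<integral>\<omega>. indicator A \<omega> * (U t \<omega>)\<^sup>2 \<partial>M) + (\<beta> / 2 - 1 / 4) * wint t A (\<lambda>r \<omega>. (U r \<omega>)\<^sup>2)
      + wint t A (\<lambda>r \<omega>. (norm (V r \<omega>))\<^sup>2)
    \<le> exp (\<beta> * T) * (\<integral>\<omega>. indicator A \<omega> * (\<Xi> \<omega>)\<^sup>2 \<partial>M) + 2 / \<beta> * wint t A (\<lambda>r \<omega>. (G r \<omega>)\<^sup>2)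
      + 4 * wint t A (\<lambda>r \<omega>. (P r \<omega>)\<^sup>2)"
proof -
  interpret Q: pair_sigma_finite "lborel :: real measure" M ..
  have [measurable]: "A \<in> sets M" using A sets_F_subset by auto
  have AF: "A \<in> sets (F s)" if "t \<le> s" for s using A sets_F_mono[OF that] by auto
  obtain J where J: "\<And>s. s \<in> {0..<T} \<Longrightarrow> ito_rep s T V (J s)"
    "\<And>s. s \<in> {0..<T} \<Longrightarrow> AE \<omega> in M. U s \<omega> = \<Xi> \<omega> + (\<integral>r. indicator {s..} r * (G r \<omega> + P r \<omega>) \<partial>lborel) - J s \<omega>"
    using bsde_difference by blast
  define f where "f r \<omega> = indicator A \<omega> * (indicator {t..T} r * (G r \<omega> + P r \<omega>))" for r \<omega>
  define UA where "UA r \<omega> = indicator A \<omega> * U r \<omega>" for r \<omega>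
  define JA where "JA s \<omega> = indicator A \<omega> * J s \<omega>" for s \<omega>
  define \<Xi>A where "\<Xi>A \<omega> = indicator A \<omega> * \<Xi> \<omega>" for \<omega>
  define v where "v r = (\<integral>\<omega>. indicator {t..T} r * (indicator A \<omega> * (norm (V r \<omega>))\<^sup>2) \<partial>M)" for r
  have [measurable]: "joint M f" unfolding f_def by measurable
  have [measurable]: "joint M UA" unfolding UA_def by measurable
  have f2: "dint M (\<lambda>r \<omega>. (f r \<omega>)\<^sup>2) < \<infinity>"
    by (rule square_add_finite[OF _ _ squares_finite(7,8)]) (auto simp: f_def indicator_def)
  have V_slices: "integrable lborel (\<lambda>r. \<integral>\<omega>. indicator {s..T} r * (indicator A \<omega> * (norm (V r \<omega>))\<^sup>2) \<partial>M)"
     "dint M (\<lambda>r \<omega>. indicator {s..T} r * (indicator A \<omega> * (norm (V r \<omega>))\<^sup>2)) =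
      ennreal (\<integral>r. \<integral>\<omega>. indicator {s..T} r * (indicator A \<omega> * (norm (V r \<omega>))\<^sup>2) \<partial>M \<partial>lborel)" for s
  proof -
    have "dint M (\<lambda>r \<omega>. indicator {s..T} r * (indicator A \<omega> * (norm (V r \<omega>))\<^sup>2)) \<le>
      (dint M (\<lambda>r \<omega>. (norm (V r \<omega>))\<^sup>2))"
      by (intro nn_integral_mono) (auto simp: indicator_def)
    then have fin: "dint M (\<lambda>r \<omega>. indicator {s..T} r * (indicator A \<omega> * (norm (V r \<omega>))\<^sup>2)) < \<infinity>"
      using squares_finite(2) by (rule order_le_less_trans)
    note * = slices[of "\<lambda>r \<omega>. indicator {s..T} r * (indicator A \<omega> * (norm (V r \<omega>))\<^sup>2)", OF _ _ fin]
    show "integrable lborel (\<lambda>r. \<integral>\<omega>. indicator {s..T} r * (indicator A \<omega> * (norm (V r \<omega>))\<^sup>2) \<partial>M)"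
     "dint M (\<lambda>r \<omega>. indicator {s..T} r * (indicator A \<omega> * (norm (V r \<omega>))\<^sup>2)) =
      ennreal (\<integral>r. \<integral>\<omega>. indicator {s..T} r * (indicator A \<omega> * (norm (V r \<omega>))\<^sup>2) \<partial>M \<partial>lborel)"
      by (rule *; simp)+
  qed
  have JA_m: "JA s \<in> borel_measurable M" if "s \<in> {t..<T}" for s
  proof -
    have [measurable]: "J s \<in> borel_measurable M" using J(1)[of s] that t unfolding ito_rep_def by auto
    show ?thesis unfolding JA_def[abs_def] by measurable
  qed
  have JA2: "integrable M (\<lambda>\<omega>. (JA s \<omega>)\<^sup>2)" "(\<integral>\<omega>. (JA s \<omega>)\<^sup>2 \<partial>M) = (\<integral>r. indicator {s..} r * v r \<partial>lborel)"
    if s: "s \<in> {t..<T}" for s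
  proof -
    have "(\<integral>\<^sup>+\<omega>. ennreal ((JA s \<omega>)\<^sup>2) \<partial>M) = expect_on M A (\<lambda>\<omega>. ennreal ((J s \<omega>)\<^sup>2))"
      by (intro nn_integral_cong) (auto simp: JA_def indicator_def)
    also have "\<dots> = expect_on M A (\<lambda>\<omega>. \<integral>\<^sup>+r\<in>{s..T}. ennreal ((norm (V r \<omega>))\<^sup>2) \<partial>lborel)"
      using J(1)[of s] s t AF[of s] unfolding ito_rep_def by auto
    also have "\<dots> = dint M (\<lambda>r \<omega>. indicator {s..T} r * (indicator A \<omega> * (norm (V r \<omega>))\<^sup>2))"
    proof (rule nn_integral_cong)
      fix \<omega>
      show "indicator A \<omega> * (\<integral>\<^sup>+r\<in>{s..T}. ennreal ((norm (V r \<omega>))\<^sup>2) \<partial>lborel) =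
         (\<integral>\<^sup>+r. ennreal (indicator {s..T} r * (indicator A \<omega> * (norm (V r \<omega>))\<^sup>2)) \<partial>lborel)"
        by (cases "\<omega> \<in> A") (auto intro!: nn_integral_cong simp: indicator_def)
    qed
    also have "\<dots> = ennreal (\<integral>r. \<integral>\<omega>. indicator {s..T} r * (indicator A \<omega> * (norm (V r \<omega>))\<^sup>2) \<partial>M \<partial>lborel)"
      by (rule V_slices(2))
    also have "(\<integral>r. \<integral>\<omega>. indicator {s..T} r * (indicator A \<omega> * (norm (V r \<omega>))\<^sup>2) \<partial>M \<partial>lborel) = (\<integral>r. indicator {s..} r * v r \<partial>lborel)"
    proof (intro Bochner_Integration.integral_cong refl)
      fix r
      show "(\<integral>\<omega>. indicator {s..T} r * (indicator A \<omega> * (norm (V r \<omega>))\<^sup>2) \<partial>M) = indicator {s..} r * v r"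
        using s unfolding v_def by (cases "s \<le> r") (simp_all add: indicator_def)
    qed
    finally have eq: "(\<integral>\<^sup>+\<omega>. ennreal ((JA s \<omega>)\<^sup>2) \<partial>M) = ennreal (\<integral>r. indicator {s..} r * v r \<partial>lborel)" .
    have nn: "0 \<le> (\<integral>r. indicator {s..} r * v r \<partial>lborel)"
      by (intro Bochner_Integration.integral_nonneg mult_nonneg_nonneg) (auto simp: v_def)
    show "integrable M (\<lambda>\<omega>. (JA s \<omega>)\<^sup>2)"
      using JA_m[OF s] eq by (auto simp: integrable_iff_bounded)
    then show "(\<integral>\<omega>. (JA s \<omega>)\<^sup>2 \<partial>M) = (\<integral>r. indicator {s..} r * v r \<partial>lborel)"
      using eq nn by (simp add: nn_integral_eq_integral)
  qed
  have orth: "(\<integral>\<omega>. X \<omega> * JA s \<omega> \<partial>M) = 0"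
    if s: "s \<in> {t..<T}" and X: "X \<in> borel_measurable (F s)" "integrable M (\<lambda>\<omega>. (X \<omega>)\<^sup>2)" "\<And>\<omega>. \<omega> \<notin> A \<Longrightarrow> X \<omega> = 0" for s X
  proof -
    have "(\<integral>\<^sup>+\<omega>. ennreal ((X \<omega>)\<^sup>2) \<partial>M) < \<infinity>" using X(2) by (simp add: integrable_iff_bounded)
    then have "(\<integral>\<omega>. X \<omega> * J s \<omega> \<partial>M) = 0"
      using J(1)[of s] s t X(1) unfolding ito_rep_def by auto
    moreover have "(\<lambda>\<omega>. X \<omega> * JA s \<omega>) = (\<lambda>\<omega>. X \<omega> * J s \<omega>)"
    proof
      fix \<omega>
      show "X \<omega> * JA s \<omega> = X \<omega> * J s \<omega>"
        using X(3)[of \<omega>] by (cases "\<omega> \<in> A") (auto simp: JA_def)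
    qed
    ultimately show ?thesis by (simp only:)
  qed
  have UA_F: "UA s \<in> borel_measurable (F s)" and f_F: "f s \<in> borel_measurable (F s)" if s: "s \<in> {t..<T}" for s
  proof -
    have s': "s \<in> {0..T}" and A': "A \<in> sets (F s)" using s t AF[of s] by auto
    show "UA s \<in> borel_measurable (F s)" "f s \<in> borel_measurable (F s)"
      unfolding UA_def[abs_def] f_def[abs_def]
      by (intro borel_measurable_times borel_measurable_add borel_measurable_indicator
        borel_measurable_const adapted[OF s'] A')+
  qed
  have v: "integrable lborel v" using V_slices(1)[of t] by (simp add: v_def[abs_def])
  have eqA: "AE \<omega> in M. UA s \<omega> = \<Xi>A \<omega> + (\<integral>r. indicator {s..} r * f r \<omega> \<partial>lborel) - JA s \<omega>" if s: "s \<in> {t..<T}" for s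
  proof -
    have "s \<in> {0..<T}" using s t by auto
    from J(2)[OF this] show ?thesis
    proof eventually_elim
      case (elim \<omega>)
      have "(\<integral>r. indicator {s..} r * f r \<omega> \<partial>lborel) = (\<integral>r. indicator A \<omega> * (indicator {s..} r * (G r \<omega> + P r \<omega>)) \<partial>lborel)"
        using s t vanish_outside
        by (intro Bochner_Integration.integral_cong refl) (force simp: f_def indicator_def)
      also have "\<dots> = indicator A \<omega> * (\<integral>r. indicator {s..} r * (G r \<omega> + P r \<omega>) \<partial>lborel)" by simp
      finally show ?case unfolding UA_def \<Xi>A_def JA_def elim by (simp add: algebra_simps)
    qed
  qed
  have tT: "t < T" using t by simp
  have \<Xi>A2: "integrable M (\<lambda>\<omega>. (\<Xi>A \<omega>)\<^sup>2)"
    by (rule Bochner_Integration.integrable_bound[OF \<Xi>_square_integrable]) (auto simp: \<Xi>A_def[abs_def] indicator_def)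
  have \<Xi>A_m: "\<Xi>A \<in> borel_measurable M" unfolding \<Xi>A_def[abs_def] by measurable
  have UJ: "s \<in> {t..<T} \<Longrightarrow> integrable M (\<lambda>\<omega>. (UA s \<omega>)\<^sup>2) \<Longrightarrow> (\<integral>\<omega>. UA s \<omega> * JA s \<omega> \<partial>M) = 0" for s
    by (rule orth[OF _ UA_F]) (auto simp: UA_def)
  have fJ: "s \<in> {t..<T} \<Longrightarrow> integrable M (\<lambda>\<omega>. (f s \<omega>)\<^sup>2) \<Longrightarrow> (\<integral>\<omega>. f s \<omega> * JA s \<omega> \<partial>M) = 0" for s
    by (rule orth[OF _ f_F]) (auto simp: f_def)
  have f_out: "r \<notin> {t..T} \<Longrightarrow> f r \<omega> = 0" for r \<omega> by (simp add: f_def)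
  note e = energy_identity[OF tT \<open>joint M f\<close> f_out f2 \<Xi>A_m \<Xi>A2 \<open>joint M UA\<close> JA_m JA2 UJ fJ eqA v]
  have E: "integrable lborel (\<lambda>r. \<integral>\<omega>. f r \<omega> * UA r \<omega> \<partial>M)"
    "AE r in lborel. integrable M (\<lambda>\<omega>. f r \<omega> * UA r \<omega>)"
    "\<And>s. s \<in> {t..<T} \<Longrightarrow> integrable M (\<lambda>\<omega>. (UA s \<omega>)\<^sup>2)"
    "\<And>s. s \<in> {t..<T} \<Longrightarrow> (\<integral>\<omega>. (UA s \<omega>)\<^sup>2 \<partial>M) =
      (\<integral>\<omega>. (\<Xi>A \<omega>)\<^sup>2 \<partial>M) + (\<integral>r. indicator {s..} r * (2 * (\<integral>\<omega>. f r \<omega> * UA r \<omega> \<partial>M) - v r) \<partial>lborel)"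
    by (rule e; assumption)+
  have sqA: "(UA s \<omega>)\<^sup>2 = indicator A \<omega> * (U s \<omega>)\<^sup>2" "(\<Xi>A \<omega>)\<^sup>2 = indicator A \<omega> * (\<Xi> \<omega>)\<^sup>2" for s \<omega>
    by (auto simp: UA_def \<Xi>A_def indicator_def)
  show "integrable M (\<lambda>\<omega>. indicator A \<omega> * (U t \<omega>)\<^sup>2)" using E(3)[of t] tT by (simp add: sqA)
  define y where "y s = (\<integral>\<omega>. (UA s \<omega>)\<^sup>2 \<partial>M)" for s
  define q where "q r = 2 * (\<integral>\<omega>. f r \<omega> * UA r \<omega> \<partial>M) - v r" for r
  have q_int: "integrable lborel q" unfolding q_def[abs_def] using E(1) v by simp
  have q_out: "r \<notin> {t..T} \<Longrightarrow> q r = 0" for r by (simp add: q_def f_def v_def)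
  have y_m: "y \<in> borel_measurable borel" unfolding y_def[abs_def] by measurable
  note e = exponential_weight[OF tT q_int q_out E(4)[folded y_def q_def] y_m, of \<beta>]
  have W: "integrable lborel (\<lambda>r. exp (\<beta> * r) * q r)"
    "exp (\<beta> * t) * y t + \<beta> * (\<integral>s. indicator {t..T} s * (exp (\<beta> * s) * y s) \<partial>lborel)
      = exp (\<beta> * T) * (\<integral>\<omega>. (\<Xi>A \<omega>)\<^sup>2 \<partial>M) + (\<integral>r. exp (\<beta> * r) * q r \<partial>lborel)"
    by (rule e; assumption)+
  have wU: "(\<integral>s. indicator {t..T} s * (exp (\<beta> * s) * y s) \<partial>lborel) = wint t A (\<lambda>r \<omega>. (U r \<omega>)\<^sup>2)"
    unfolding y_def weighted_def sqA by simp
  let ?U = "weighted t A (\<lambda>r \<omega>. (U r \<omega>)\<^sup>2)" and ?V = "weighted t A (\<lambda>r \<omega>. (norm (V r \<omega>))\<^sup>2)"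
  let ?G = "weighted t A (\<lambda>r \<omega>. (G r \<omega>)\<^sup>2)" and ?P = "weighted t A (\<lambda>r \<omega>. (P r \<omega>)\<^sup>2)"
  have mU: "(\<lambda>(r, \<omega>). (U r \<omega>)\<^sup>2) \<in> borel_measurable (lborel \<Otimes>\<^sub>M M)" by measurable
  have mV: "(\<lambda>(r, \<omega>). (norm (V r \<omega>))\<^sup>2) \<in> borel_measurable (lborel \<Otimes>\<^sub>M M)" by measurable
  have mG: "(\<lambda>(r, \<omega>). (G r \<omega>)\<^sup>2) \<in> borel_measurable (lborel \<Otimes>\<^sub>M M)" by measurable
  have mP: "(\<lambda>(r, \<omega>). (P r \<omega>)\<^sup>2) \<in> borel_measurable (lborel \<Otimes>\<^sub>M M)" by measurable
  note sU = weighted_slices[OF mU \<open>A \<in> sets M\<close> zero_le_power2 squares_finite(1), of t]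
  note sV = weighted_slices[OF mV \<open>A \<in> sets M\<close> zero_le_power2 squares_finite(2), of t]
  note sG = weighted_slices[OF mG \<open>A \<in> sets M\<close> zero_le_power2 squares_finite(7), of t]
  note sP = weighted_slices[OF mP \<open>A \<in> sets M\<close> zero_le_power2 squares_finite(8), of t]
  have young: "2 * ((G r \<omega> + P r \<omega>) * U r \<omega>) \<le> (\<beta> / 2 + 1 / 4) * (U r \<omega>)\<^sup>2 + 2 / \<beta> * (G r \<omega>)\<^sup>2 + 4 * (P r \<omega>)\<^sup>2" for r \<omega>
  proof -
    have y2: "2 * (a * b) \<le> e * b\<^sup>2 + (1 / e) * a\<^sup>2" if "0 < e" for a b e :: real
    proof -
      have "0 \<le> (sqrt e * b - a / sqrt e)\<^sup>2" by simp
      also have "\<dots> = e * b\<^sup>2 + (1 / e) * a\<^sup>2 - 2 * (a * b)"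
        using that by (simp add: power2_diff power_mult_distrib power_divide mult.commute)
      finally show ?thesis by simp
    qed
    show ?thesis
      using y2[of "\<beta> / 2" "G r \<omega>" "U r \<omega>"] y2[of "1 / 4" "P r \<omega>" "U r \<omega>"] \<beta>(1) by (simp add: distrib_right)
  qed
  have "(\<integral>r. exp (\<beta> * r) * q r \<partial>lborel) \<le> (\<integral>r. (\<beta> / 2 + 1 / 4) * (\<integral>\<omega>. ?U r \<omega> \<partial>M)
      + 2 / \<beta> * (\<integral>\<omega>. ?G r \<omega> \<partial>M) + 4 * (\<integral>\<omega>. ?P r \<omega> \<partial>M)
      - (\<integral>\<omega>. ?V r \<omega> \<partial>M) \<partial>lborel)"
  proof (rule integral_mono_AE[OF W(1)])
    show "integrable lborel (\<lambda>r. (\<beta> / 2 + 1 / 4) * (\<integral>\<omega>. ?U r \<omega> \<partial>M)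
      + 2 / \<beta> * (\<integral>\<omega>. ?G r \<omega> \<partial>M) + 4 * (\<integral>\<omega>. ?P r \<omega> \<partial>M)
      - (\<integral>\<omega>. ?V r \<omega> \<partial>M))"
      using sU(1) sV(1) sG(1) sP(1) by simp
    show "AE r in lborel. exp (\<beta> * r) * q r \<le> (\<beta> / 2 + 1 / 4) * (\<integral>\<omega>. ?U r \<omega> \<partial>M)
      + 2 / \<beta> * (\<integral>\<omega>. ?G r \<omega> \<partial>M) + 4 * (\<integral>\<omega>. ?P r \<omega> \<partial>M)
      - (\<integral>\<omega>. ?V r \<omega> \<partial>M)"
      using sU(2) sG(2) sP(2) E(2)
    proof eventually_elim
      case (elim r)
      have "exp (\<beta> * r) * (2 * (\<integral>\<omega>. f r \<omega> * UA r \<omega> \<partial>M)) = (\<integral>\<omega>. exp (\<beta> * r) * (2 * (f r \<omega> * UA r \<omega>)) \<partial>M)" by simp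
      also have "\<dots> \<le> (\<integral>\<omega>. (\<beta> / 2 + 1 / 4) * ?U r \<omega>
          + 2 / \<beta> * ?G r \<omega> + 4 * ?P r \<omega> \<partial>M)"
      proof (rule integral_mono)
        show "integrable M (\<lambda>\<omega>. exp (\<beta> * r) * (2 * (f r \<omega> * UA r \<omega>)))" using elim by simp
        show "integrable M (\<lambda>\<omega>. (\<beta> / 2 + 1 / 4) * ?U r \<omega>
          + 2 / \<beta> * ?G r \<omega> + 4 * ?P r \<omega>)"
          using elim by simp
        fix \<omega>
        show "exp (\<beta> * r) * (2 * (f r \<omega> * UA r \<omega>)) \<le> (\<beta> / 2 + 1 / 4) * ?U r \<omega>
          + 2 / \<beta> * ?G r \<omega> + 4 * ?P r \<omega>"
        proof (cases "r \<in> {t..T} \<and> \<omega> \<in> A")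
          case True
          then show ?thesis
            using mult_left_mono[OF young[of r \<omega>], of "exp (\<beta> * r)"]
            by (simp add: f_def UA_def weighted_def distrib_left mult.left_commute)
        qed (auto simp: f_def UA_def weighted_def)
      qed
      also have "\<dots> = (\<beta> / 2 + 1 / 4) * (\<integral>\<omega>. ?U r \<omega> \<partial>M)
        + 2 / \<beta> * (\<integral>\<omega>. ?G r \<omega> \<partial>M) + 4 * (\<integral>\<omega>. ?P r \<omega> \<partial>M)"
        using elim by simp
      finally have 1: "exp (\<beta> * r) * (2 * (\<integral>\<omega>. f r \<omega> * UA r \<omega> \<partial>M)) \<le> (\<beta> / 2 + 1 / 4) * (\<integral>\<omega>. ?U r \<omega> \<partial>M)
        + 2 / \<beta> * (\<integral>\<omega>. ?G r \<omega> \<partial>M) + 4 * (\<integral>\<omega>. ?P r \<omega> \<partial>M)" .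
      have 2: "exp (\<beta> * r) * v r = (\<integral>\<omega>. ?V r \<omega> \<partial>M)"
      proof -
        have "exp (\<beta> * r) * v r = (\<integral>\<omega>. exp (\<beta> * r) * (indicator {t..T} r * (indicator A \<omega> * (norm (V r \<omega>))\<^sup>2)) \<partial>M)"
          unfolding v_def by (rule integral_mult_right_zero[symmetric])
        then show ?thesis unfolding weighted_def by (simp only: mult.left_commute)
      qed
      show ?case unfolding q_def right_diff_distrib 2 using 1 by linarith
    qed
  qed
  also have "\<dots> = (\<beta> / 2 + 1 / 4) * wint t A (\<lambda>r \<omega>. (U r \<omega>)\<^sup>2) + 2 / \<beta> * wint t A (\<lambda>r \<omega>. (G r \<omega>)\<^sup>2)
     + 4 * wint t A (\<lambda>r \<omega>. (P r \<omega>)\<^sup>2) - wint t A (\<lambda>r \<omega>. (norm (V r \<omega>))\<^sup>2)"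
    using sU(1) sV(1) sG(1) sP(1) by simp
  finally show "exp (\<beta> * t) * (\<integral>\<omega>. indicator A \<omega> * (U t \<omega>)\<^sup>2 \<partial>M) + (\<beta> / 2 - 1 / 4) * wint t A (\<lambda>r \<omega>. (U r \<omega>)\<^sup>2)
      + wint t A (\<lambda>r \<omega>. (norm (V r \<omega>))\<^sup>2)
    \<le> exp (\<beta> * T) * (\<integral>\<omega>. indicator A \<omega> * (\<Xi> \<omega>)\<^sup>2 \<partial>M) + 2 / \<beta> * wint t A (\<lambda>r \<omega>. (G r \<omega>)\<^sup>2)
      + 4 * wint t A (\<lambda>r \<omega>. (P r \<omega>)\<^sup>2)"
    using W(2)[unfolded wU, unfolded y_def sqA] by (simp add: algebra_simps)
qed

end

section \<open>Absorption and conditioning\<close>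

lemma (in prob_space) tested_swap:
  fixes X :: "real \<Rightarrow> 'a \<Rightarrow> ennreal"
  assumes [measurable]: "joint M X" "A \<in> sets M" "S \<in> sets borel"
  shows "expect_on M A (\<lambda>\<omega>. \<integral>\<^sup>+r\<in>S. X r \<omega> \<partial>lborel) = (\<integral>\<^sup>+r\<in>S. expect_on M A (\<lambda>\<omega>. X r \<omega>) \<partial>lborel)"
proof -
  interpret Q: pair_sigma_finite "lborel :: real measure" M ..
  have "expect_on M A (\<lambda>\<omega>. \<integral>\<^sup>+r\<in>S. X r \<omega> \<partial>lborel) = (\<integral>\<^sup>+\<omega>. \<integral>\<^sup>+r. indicator A \<omega> * (X r \<omega> * indicator S r) \<partial>lborel \<partial>M)"
    by (intro nn_integral_cong nn_integral_cmult[symmetric]) measurable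
  also have "\<dots> = (\<integral>\<^sup>+r. \<integral>\<^sup>+\<omega>. indicator A \<omega> * (X r \<omega> * indicator S r) \<partial>M \<partial>lborel)"
    by (rule Q.Fubini') measurable
  also have "\<dots> = (\<integral>\<^sup>+r\<in>S. expect_on M A (\<lambda>\<omega>. X r \<omega>) \<partial>lborel)"
    by (intro nn_integral_cong) (simp add: mult.assoc[symmetric] nn_integral_multc)
  finally show ?thesis .
qed

context bsde_pair
begin

definition w\<xi> :: "real \<Rightarrow> 'a \<Rightarrow> real" where
  "w\<xi> r \<omega> = (indicator {T..T + u} r *\<^sub>R \<xi> r \<omega> - indicator {T..T + u} r *\<^sub>R \<xi>' r \<omega>)\<^sup>2
    + (norm (indicator {T..T + u} r *\<^sub>R \<eta> r \<omega> - indicator {T..T + u} r *\<^sub>R \<eta>' r \<omega>))\<^sup>2"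

lemma w\<xi>_measurable [measurable]: "joint M w\<xi>"
proof -
  have "T \<le> T + u" using u by simp
  note m = \<xi>[THEN L2_process_indicator(1), OF this] \<eta>[THEN L2_process_indicator(1), OF this]
  define a where "a r \<omega> = indicator {T..T + u} r *\<^sub>R \<xi> r \<omega>" for r \<omega>
  define a' where "a' r \<omega> = indicator {T..T + u} r *\<^sub>R \<xi>' r \<omega>" for r \<omega>
  define b where "b r \<omega> = indicator {T..T + u} r *\<^sub>R \<eta> r \<omega>" for r \<omega>
  define b' where "b' r \<omega> = indicator {T..T + u} r *\<^sub>R \<eta>' r \<omega>" for r \<omega>
  have [measurable]: "joint M a" "joint M a'"
    "joint M b" "joint M b'"
    using m by (simp_all add: a_def[abs_def] a'_def[abs_def] b_def[abs_def] b'_def[abs_def])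
  have "(\<lambda>(r, \<omega>). (a r \<omega> - a' r \<omega>)\<^sup>2 + (norm (b r \<omega> - b' r \<omega>))\<^sup>2) \<in> borel_measurable (lborel \<Otimes>\<^sub>M M)"
    by measurable
  then show ?thesis by (simp add: w\<xi>_def[abs_def] a_def b_def a'_def b'_def)
qed

lemma w_terminal:
  assumes "r \<in> {T..T + u}"
  shows "AE \<omega> in M. w r \<omega> = w\<xi> r \<omega>"
proof -
  have "AE \<omega> in M. Y r \<omega> = \<xi> r \<omega> \<and> Z r \<omega> = \<eta> r \<omega>" "AE \<omega> in M. Y' r \<omega> = \<xi>' r \<omega> \<and> Z' r \<omega> = \<eta>' r \<omega>"
    using sol sol' assms unfolding bsde_solution_def by auto
  then show ?thesis
  proof eventually_elim
    case (elim \<omega>)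
    have "r \<in> {0..T + u}" using assms T by auto
    then show ?case using elim assms by (simp add: w_def w\<xi>_def U_def V_def version_eq)
  qed
qed

lemma U_T: "AE \<omega> in M. U T \<omega> = \<Xi> \<omega>"
proof -
  have "AE \<omega> in M. Y T \<omega> = \<xi> T \<omega> \<and> Z T \<omega> = \<eta> T \<omega>" "AE \<omega> in M. Y' T \<omega> = \<xi>' T \<omega> \<and> Z' T \<omega> = \<eta>' T \<omega>"
    using sol sol' u unfolding bsde_solution_def by auto
  then show ?thesis
    using T u by (auto elim!: eventually_elim2 simp: U_def \<Xi>_def version_eq)
qed

definition stability_const :: real where "stability_const = 16 * exp (\<beta> * (T + u))"

text \<open>
  The Lipschitz bound returns at most \<open>(2 / \<beta>) * 2 * K\<^sup>2 * exp (\<beta> * l) \<le> 1 / 2\<close> times the weighted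
  energy over \<open>[t - l, T + u]\<close>. Since \<open>\<beta> / 2 - 1 / 4 - 1 / 2 \<ge> 1 / 4\<close> and \<open>1 - 1 / 2 \<ge> 1 / 4\<close>, a
  quarter of the energy over \<open>[t, T]\<close> survives the absorption; the rest of the constant bounds the
  weights.
\<close>

lemma tested_estimate_before:
  assumes t: "t \<in> {0..<T}" and A: "A \<in> sets (F t)"
  shows "expect_on M A (\<lambda>\<omega>. ennreal ((U t \<omega>)\<^sup>2)) + expect_on M A (\<lambda>\<omega>. \<integral>\<^sup>+s\<in>{t..T}. ennreal (w s \<omega>) \<partial>lborel)
    \<le> ennreal stability_const * (expect_on M A (\<lambda>\<omega>. ennreal ((\<Xi> \<omega>)\<^sup>2))
        + expect_on M A (\<lambda>\<omega>. \<integral>\<^sup>+s\<in>{t..T}. ennreal ((P s \<omega>)\<^sup>2) \<partial>lborel)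
        + expect_on M A (\<lambda>\<omega>. \<integral>\<^sup>+s\<in>{T..T + u}. ennreal (w\<xi> s \<omega>) \<partial>lborel))
      + ennreal stability_const * expect_on M A (\<lambda>\<omega>. \<integral>\<^sup>+s\<in>{t - l..t}. ennreal (w s \<omega>) \<partial>lborel)"
proof -
  interpret Q: pair_sigma_finite "lborel :: real measure" M ..
  have [measurable]: "A \<in> sets M" using A sets_F_subset by auto
  have \<beta>0: "0 \<le> \<beta>" using \<beta>(1) by simp
  have w0: "0 \<le> w v \<omega>" for v \<omega> by (simp add: w_def)
  define wA where "wA v = expect_on M A (\<lambda>\<omega>. ennreal (w v \<omega>))" for v
  have [measurable]: "wA \<in> borel_measurable borel" unfolding wA_def[abs_def] by measurable
  define I where "I a b = (\<integral>\<^sup>+v\<in>{a..b}. ennreal (exp (\<beta> * v)) * wA v \<partial>lborel)" for a b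
  have I_le: "I a b \<le> ennreal (exp (\<beta> * b)) * (\<integral>\<^sup>+v\<in>{a..b}. wA v \<partial>lborel)" for a b
  proof -
    have "I a b \<le> (\<integral>\<^sup>+v. ennreal (exp (\<beta> * b)) * (wA v * indicator {a..b} v) \<partial>lborel)"
      unfolding I_def using \<beta>0
      by (intro nn_integral_mono) (auto simp: indicator_def intro!: mult_right_mono ennreal_leI mult_left_mono)
    then show ?thesis by (simp add: nn_integral_cmult)
  qed
  have wA_sum: "(\<integral>\<^sup>+v\<in>{a..b}. wA v \<partial>lborel) = expect_on M A (\<lambda>\<omega>. \<integral>\<^sup>+s\<in>{a..b}. ennreal (w s \<omega>) \<partial>lborel)" for a b
    unfolding wA_def by (rule tested_swap[symmetric]) measurable
  have wA_fin: "(\<integral>\<^sup>+v\<in>{a..b}. wA v \<partial>lborel) < \<infinity>" for a b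
  proof -
    have "(\<integral>\<^sup>+v\<in>{a..b}. wA v \<partial>lborel) \<le> dint M w"
      unfolding wA_sum by (intro nn_integral_mono) (auto simp: indicator_def intro!: nn_integral_mono)
    then show ?thesis using w_finite by (rule order_le_less_trans)
  qed
  have I_fin: "I a b < \<infinity>" for a b
    using I_le[of a b] wA_fin[of a b] by (auto intro: order_le_less_trans simp: ennreal_mult_less_top)
  obtain p where p: "I (t - l) t = ennreal p" "0 \<le> p" using I_fin[of "t - l" t] by (cases "I (t - l) t") auto
  obtain q where q: "I T (T + u) = ennreal q" "0 \<le> q" using I_fin[of T "T + u"] by (cases "I T (T + u)") auto
  define aU where "aU = wint t A (\<lambda>r \<omega>. (U r \<omega>)\<^sup>2)"
  define aV where "aV = wint t A (\<lambda>r \<omega>. (norm (V r \<omega>))\<^sup>2)"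
  define aG where "aG = wint t A (\<lambda>r \<omega>. (G r \<omega>)\<^sup>2)"
  define aP where "aP = wint t A (\<lambda>r \<omega>. (P r \<omega>)\<^sup>2)"
  define yU where "yU = (\<integral>\<omega>. indicator A \<omega> * (U t \<omega>)\<^sup>2 \<partial>M)"
  define y\<Xi> where "y\<Xi> = (\<integral>\<omega>. indicator A \<omega> * (\<Xi> \<omega>)\<^sup>2 \<partial>M)"
  have nn: "0 \<le> aU" "0 \<le> aV" "0 \<le> aG" "0 \<le> aP" "0 \<le> yU" "0 \<le> y\<Xi>"
    unfolding aU_def aV_def aG_def aP_def yU_def y\<Xi>_def weighted_def
    by (intro Bochner_Integration.integral_nonneg; simp)+
  have weighted_nn: "(\<integral>\<^sup>+r. \<integral>\<^sup>+\<omega>. ennreal (weighted t A X r \<omega>) \<partial>M \<partial>lborel) =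
      (\<integral>\<^sup>+r\<in>{t..T}. ennreal (exp (\<beta> * r)) * expect_on M A (\<lambda>\<omega>. ennreal (X r \<omega>)) \<partial>lborel)"
    if [measurable]: "joint M X" and X: "\<And>r \<omega>. 0 \<le> X r \<omega>" for X
  proof (rule nn_integral_cong)
    fix r
    have "(\<integral>\<^sup>+\<omega>. ennreal (weighted t A X r \<omega>) \<partial>M) = (\<integral>\<^sup>+\<omega>. indicator {t..T} r * ennreal (exp (\<beta> * r)) * (indicator A \<omega> * ennreal (X r \<omega>)) \<partial>M)"
      by (intro nn_integral_cong) (auto simp: weighted_def indicator_def ennreal_mult X)
    also have "\<dots> = indicator {t..T} r * ennreal (exp (\<beta> * r)) * expect_on M A (\<lambda>\<omega>. ennreal (X r \<omega>))"
      by (rule nn_integral_cmult) measurable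
    finally show "(\<integral>\<^sup>+\<omega>. ennreal (weighted t A X r \<omega>) \<partial>M) =
        ennreal (exp (\<beta> * r)) * expect_on M A (\<lambda>\<omega>. ennreal (X r \<omega>)) * indicator {t..T} r"
      by (simp add: ac_simps)
  qed
  have mU: "(\<lambda>(r, \<omega>). (U r \<omega>)\<^sup>2) \<in> borel_measurable (lborel \<Otimes>\<^sub>M M)" by measurable
  have mV: "(\<lambda>(r, \<omega>). (norm (V r \<omega>))\<^sup>2) \<in> borel_measurable (lborel \<Otimes>\<^sub>M M)" by measurable
  have mG: "(\<lambda>(r, \<omega>). (G r \<omega>)\<^sup>2) \<in> borel_measurable (lborel \<Otimes>\<^sub>M M)" by measurable
  have mP: "(\<lambda>(r, \<omega>). (P r \<omega>)\<^sup>2) \<in> borel_measurable (lborel \<Otimes>\<^sub>M M)" by measurable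
  note sl = weighted_slices(3)[OF mU \<open>A \<in> sets M\<close> zero_le_power2 squares_finite(1), of t, folded aU_def, unfolded weighted_nn[OF mU zero_le_power2]]
    weighted_slices(3)[OF mV \<open>A \<in> sets M\<close> zero_le_power2 squares_finite(2), of t, folded aV_def, unfolded weighted_nn[OF mV zero_le_power2]]
    weighted_slices(3)[OF mG \<open>A \<in> sets M\<close> zero_le_power2 squares_finite(7), of t, folded aG_def, unfolded weighted_nn[OF mG zero_le_power2]]
    weighted_slices(3)[OF mP \<open>A \<in> sets M\<close> zero_le_power2 squares_finite(8), of t, folded aP_def, unfolded weighted_nn[OF mP zero_le_power2]]
  have mid: "I t T = ennreal (aU + aV)"
  proof -
    have split: "wA r = expect_on M A (\<lambda>\<omega>. ennreal ((U r \<omega>)\<^sup>2)) + expect_on M A (\<lambda>\<omega>. ennreal ((norm (V r \<omega>))\<^sup>2))" for r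
      unfolding wA_def w_def by (simp add: nn_integral_add[symmetric] distrib_left)
    have "I t T = (\<integral>\<^sup>+r. ennreal (exp (\<beta> * r)) * expect_on M A (\<lambda>\<omega>. ennreal ((U r \<omega>)\<^sup>2)) * indicator {t..T} r
      + ennreal (exp (\<beta> * r)) * expect_on M A (\<lambda>\<omega>. ennreal ((norm (V r \<omega>))\<^sup>2)) * indicator {t..T} r \<partial>lborel)"
      unfolding I_def split by (intro nn_integral_cong) (simp add: distrib_left distrib_right)
    also have "\<dots> = ennreal aU + ennreal aV"
      unfolding sl(1,2)[symmetric] by (rule nn_integral_add) measurable
    finally show ?thesis using nn by simp
  qed
  have I_split: "I (t - l) (T + u) \<le> I (t - l) t + I t T + I T (T + u)"
  proof -
    have "I (t - l) (T + u) \<le> (\<integral>\<^sup>+v. (ennreal (exp (\<beta> * v)) * wA v * indicator {t - l..t} v +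
        ennreal (exp (\<beta> * v)) * wA v * indicator {t..T} v) + ennreal (exp (\<beta> * v)) * wA v * indicator {T..T + u} v \<partial>lborel)"
      unfolding I_def by (intro nn_integral_mono) (auto simp: indicator_def)
    also have "\<dots> = I (t - l) t + I t T + I T (T + u)"
      unfolding I_def by (simp add: nn_integral_add)
    finally show ?thesis .
  qed
  have aG: "aG \<le> 2 * K\<^sup>2 * exp (\<beta> * l) * (p + (aU + aV) + q)"
  proof -
    have "ennreal aG = (\<integral>\<^sup>+s\<in>{t..T}. ennreal (exp (\<beta> * s)) * expect_on M A (\<lambda>\<omega>. ennreal ((g s Y Z \<omega> - g s Y' Z' \<omega>)\<^sup>2)) \<partial>lborel)"
      unfolding sl(3)[symmetric]
      using t by (intro nn_integral_cong) (auto simp: indicator_def G_def gY_def gY'_def)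
    also have "\<dots> \<le> ennreal (2 * K\<^sup>2 * exp (\<beta> * l)) * I (t - l) (T + u)"
      unfolding I_def wA_def w_def U_def V_def
      by (rule g_difference_bound[OF regular_solution _ A \<beta>0]) (use t in auto)
    also have "\<dots> \<le> ennreal (2 * K\<^sup>2 * exp (\<beta> * l)) * (I (t - l) t + I t T + I T (T + u))"
      by (intro mult_left_mono I_split) auto
    also have "\<dots> = ennreal (2 * K\<^sup>2 * exp (\<beta> * l) * (p + (aU + aV) + q))"
      unfolding mid p q using nn p q by (simp add: ennreal_mult)
    finally show ?thesis
      using nn p q by (subst (asm) ennreal_le_iff) auto
  qed
  have main: "exp (\<beta> * t) * yU + 1 / 4 * (aU + aV) \<le> exp (\<beta> * T) * y\<Xi> + 4 * aP + 1 / 2 * (p + q)"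
  proof -
    have "2 / \<beta> * aG \<le> 2 / \<beta> * (2 * K\<^sup>2 * exp (\<beta> * l) * (p + (aU + aV) + q))"
      using aG \<beta>(1) by (intro mult_left_mono) auto
    also have "\<dots> = 1 / 2 * (8 * K\<^sup>2 * exp (\<beta> * l) / \<beta>) * (p + (aU + aV) + q)"
      by simp
    also have "\<dots> \<le> 1 / 2 * 1 * (p + (aU + aV) + q)"
      using nn p q \<beta>(2) by (intro mult_right_mono mult_left_mono) auto
    finally have G: "2 / \<beta> * aG \<le> 1 / 2 * (p + (aU + aV) + q)" by simp
    have "3 / 4 * aU \<le> (\<beta> / 2 - 1 / 4) * aU"
      using \<beta>(1) nn by (intro mult_right_mono) auto
    with energy_inequality(2)[OF t A, folded aU_def aV_def aG_def aP_def yU_def y\<Xi>_def] G nn(1,2)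
    show ?thesis by (simp only: distrib_left)
  qed
  define E where "E = exp (\<beta> * (T + u))"
  have E: "1 \<le> E" "exp (\<beta> * T) \<le> E" "exp (\<beta> * t) \<le> E" "1 \<le> exp (\<beta> * t)"
    using \<beta>0 Tu T u t by (auto simp: E_def intro!: mult_left_mono mult_nonneg_nonneg)
  define Xi where "Xi = expect_on M A (\<lambda>\<omega>. ennreal ((\<Xi> \<omega>)\<^sup>2))"
  define Ph where "Ph = expect_on M A (\<lambda>\<omega>. \<integral>\<^sup>+s\<in>{t..T}. ennreal ((P s \<omega>)\<^sup>2) \<partial>lborel)"
  define Fu where "Fu = expect_on M A (\<lambda>\<omega>. \<integral>\<^sup>+s\<in>{T..T + u}. ennreal (w\<xi> s \<omega>) \<partial>lborel)"
  define Pa where "Pa = expect_on M A (\<lambda>\<omega>. \<integral>\<^sup>+s\<in>{t - l..t}. ennreal (w s \<omega>) \<partial>lborel)"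
  define Bt where "Bt = expect_on M A (\<lambda>\<omega>. \<integral>\<^sup>+s\<in>{t..T}. ennreal (w s \<omega>) \<partial>lborel)"
  define Ut where "Ut = expect_on M A (\<lambda>\<omega>. ennreal ((U t \<omega>)\<^sup>2))"
  have sq: "expect_on M A (\<lambda>\<omega>. ennreal ((X \<omega>)\<^sup>2)) = ennreal (\<integral>\<omega>. indicator A \<omega> * (X \<omega>)\<^sup>2 \<partial>M)"
    if "integrable M (\<lambda>\<omega>. indicator A \<omega> * (X \<omega>)\<^sup>2)" for X :: "'a \<Rightarrow> real"
  proof -
    have "expect_on M A (\<lambda>\<omega>. ennreal ((X \<omega>)\<^sup>2)) = (\<integral>\<^sup>+\<omega>. ennreal (indicator A \<omega> * (X \<omega>)\<^sup>2) \<partial>M)"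
      by (intro nn_integral_cong) (auto simp: indicator_def)
    then show ?thesis using that by (simp add: nn_integral_eq_integral)
  qed
  have Ut: "Ut = ennreal yU" unfolding Ut_def yU_def by (rule sq[OF energy_inequality(1)[OF t A]])
  have "integrable M (\<lambda>\<omega>. indicator A \<omega> * (\<Xi> \<omega>)\<^sup>2)"
    by (rule Bochner_Integration.integrable_bound[OF \<Xi>_square_integrable]) (auto simp: indicator_def)
  then have Xi: "Xi = ennreal y\<Xi>" unfolding Xi_def y\<Xi>_def by (rule sq)
  have Bt_le: "ennreal (exp (\<beta> * t)) * Bt \<le> ennreal (aU + aV)"
  proof -
    have "ennreal (exp (\<beta> * t)) * Bt = (\<integral>\<^sup>+v. ennreal (exp (\<beta> * t)) * (wA v * indicator {t..T} v) \<partial>lborel)"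
      unfolding Bt_def wA_sum[symmetric] by (simp add: nn_integral_cmult)
    also have "\<dots> \<le> I t T"
      unfolding I_def using \<beta>0
      by (intro nn_integral_mono) (auto simp: indicator_def intro!: mult_right_mono ennreal_leI mult_left_mono)
    finally show ?thesis unfolding mid .
  qed
  have Pa_le: "ennreal p \<le> ennreal (exp (\<beta> * t)) * Pa"
    using I_le[of "t - l" t] unfolding p wA_sum Pa_def .
  have Fu_le: "ennreal q \<le> ennreal E * Fu"
  proof -
    have "(\<integral>\<^sup>+v\<in>{T..T + u}. wA v \<partial>lborel) = (\<integral>\<^sup>+v\<in>{T..T + u}. expect_on M A (\<lambda>\<omega>. ennreal (w\<xi> v \<omega>)) \<partial>lborel)"
    proof (rule nn_integral_cong)
      fix v
      show "wA v * indicator {T..T + u} v = expect_on M A (\<lambda>\<omega>. ennreal (w\<xi> v \<omega>)) * indicator {T..T + u} v"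
      proof (cases "v \<in> {T..T + u}")
        case True
        have "wA v = expect_on M A (\<lambda>\<omega>. ennreal (w\<xi> v \<omega>))"
          unfolding wA_def using w_terminal[OF True] by (intro nn_integral_cong_AE) (auto elim!: eventually_mono)
        then show ?thesis by simp
      qed simp
    qed
    also have "\<dots> = Fu" unfolding Fu_def by (rule tested_swap[symmetric]) measurable
    finally show ?thesis using I_le[of T "T + u"] unfolding q E_def by simp
  qed
  have P_le: "ennreal aP \<le> ennreal E * Ph"
  proof -
    have "ennreal aP \<le> (\<integral>\<^sup>+r. ennreal (exp (\<beta> * T)) * (expect_on M A (\<lambda>\<omega>. ennreal ((P r \<omega>)\<^sup>2)) * indicator {t..T} r) \<partial>lborel)"
      unfolding sl(4)[symmetric] using \<beta>0
      by (intro nn_integral_mono) (auto simp: indicator_def intro!: mult_right_mono ennreal_leI mult_left_mono)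
    also have "\<dots> = ennreal (exp (\<beta> * T)) * (\<integral>\<^sup>+r\<in>{t..T}. expect_on M A (\<lambda>\<omega>. ennreal ((P r \<omega>)\<^sup>2)) \<partial>lborel)"
      by (rule nn_integral_cmult) measurable
    also have "(\<integral>\<^sup>+r\<in>{t..T}. expect_on M A (\<lambda>\<omega>. ennreal ((P r \<omega>)\<^sup>2)) \<partial>lborel) = Ph"
      unfolding Ph_def by (rule tested_swap[symmetric]) measurable
    also have "ennreal (exp (\<beta> * T)) * Ph \<le> ennreal E * Ph"
      using E by (intro mult_right_mono ennreal_leI) auto
    finally show ?thesis .
  qed
  have "ennreal (exp (\<beta> * t)) * (Ut + Bt) \<le> ennreal (exp (\<beta> * t)) * ennreal yU + ennreal (aU + aV)"
    unfolding distrib_left Ut by (intro add_left_mono Bt_le)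
  also have "\<dots> = ennreal (exp (\<beta> * t) * yU + (aU + aV))"
    using nn by (simp add: ennreal_mult)
  also have "\<dots> \<le> ennreal ((4 * exp (\<beta> * T)) * y\<Xi> + 16 * aP + (2 * p + 2 * q))"
  proof (rule ennreal_leI)
    have lin: "x + s \<le> 4 * r + 16 * a + (2 * b + 2 * c)"
      if "0 \<le> x" "x + 1 / 4 * s \<le> r + 4 * a + 1 / 2 * (b + c)" for x s r a b c :: real
      using that by (simp add: field_simps)
    have "0 \<le> exp (\<beta> * t) * yU" using nn(5) by simp
    then show "exp (\<beta> * t) * yU + (aU + aV) \<le> (4 * exp (\<beta> * T)) * y\<Xi> + 16 * aP + (2 * p + 2 * q)"
      using lin[OF _ main] by (simp only: mult.assoc)
  qed
  also have "\<dots> = ennreal (4 * exp (\<beta> * T)) * Xi + ennreal 16 * ennreal aP + (ennreal 2 * ennreal p + ennreal 2 * ennreal q)"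
    using nn p q unfolding Xi by (simp add: ennreal_mult)
  also have "\<dots> \<le> ennreal (16 * E) * Xi + ennreal 16 * (ennreal E * Ph) + (ennreal 16 * (ennreal (exp (\<beta> * t)) * Pa) + ennreal 16 * (ennreal E * Fu))"
    using E by (intro add_mono mult_mono ennreal_leI P_le Pa_le Fu_le) auto
  also have "\<dots> = ennreal stability_const * Xi + ennreal stability_const * Ph + (ennreal (exp (\<beta> * t)) * (ennreal 16 * Pa) + ennreal stability_const * Fu)"
    by (simp add: stability_const_def E_def ennreal_mult mult.assoc mult.left_commute)
  also have "\<dots> \<le> ennreal (exp (\<beta> * t)) * (ennreal stability_const * Xi) + ennreal (exp (\<beta> * t)) * (ennreal stability_const * Ph)
     + (ennreal (exp (\<beta> * t)) * (ennreal stability_const * Pa) + ennreal (exp (\<beta> * t)) * (ennreal stability_const * Fu))"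
  proof -
    have up: "x \<le> ennreal (exp (\<beta> * t)) * x" for x
      using mult_right_mono[of 1 "ennreal (exp (\<beta> * t))" x] E(4) by simp
    have "ennreal 16 * Pa \<le> ennreal stability_const * Pa"
      using E(1) by (intro mult_right_mono ennreal_leI) (auto simp: stability_const_def E_def)
    then show ?thesis by (intro add_mono up mult_left_mono) auto
  qed
  also have "\<dots> = ennreal (exp (\<beta> * t)) * (ennreal stability_const * (Xi + Ph + Fu) + ennreal stability_const * Pa)"
    by (simp only: distrib_left add.assoc add.commute add.left_commute)
  finally have "Ut + Bt \<le> ennreal stability_const * (Xi + Ph + Fu) + ennreal stability_const * Pa"
    by (subst (asm) ennreal_mult_le_mult_iff) auto
  then show ?thesis unfolding Ut_def Bt_def Xi_def Ph_def Fu_def Pa_def .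
qed

lemma tested_estimate:
  assumes t: "t \<in> {0..T}" and A: "A \<in> sets (F t)"
  shows "expect_on M A (\<lambda>\<omega>. ennreal ((U t \<omega>)\<^sup>2)) + expect_on M A (\<lambda>\<omega>. \<integral>\<^sup>+s\<in>{t..T}. ennreal (w s \<omega>) \<partial>lborel)
    \<le> ennreal stability_const * (expect_on M A (\<lambda>\<omega>. ennreal ((\<Xi> \<omega>)\<^sup>2))
        + expect_on M A (\<lambda>\<omega>. \<integral>\<^sup>+s\<in>{t..T}. ennreal ((P s \<omega>)\<^sup>2) \<partial>lborel)
        + expect_on M A (\<lambda>\<omega>. \<integral>\<^sup>+s\<in>{T..T + u}. ennreal (w\<xi> s \<omega>) \<partial>lborel))
      + ennreal stability_const * expect_on M A (\<lambda>\<omega>. \<integral>\<^sup>+s\<in>{t - l..t}. ennreal (w s \<omega>) \<partial>lborel)"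
proof (cases "t < T")
  case True
  then show ?thesis using tested_estimate_before[OF _ A] t by auto
next
  case False
  then have tT: "t = T" using t by auto
  have empty: "(\<integral>\<^sup>+s\<in>{T..T}. ennreal (w s \<omega>) \<partial>lborel) = (\<integral>\<^sup>+s. 0 \<partial>(lborel :: real measure))" for \<omega>
    using AE_lborel_singleton[of T] by (intro nn_integral_cong_AE) (auto elim!: eventually_mono simp: indicator_def)
  have UXi: "expect_on M A (\<lambda>\<omega>. ennreal ((U T \<omega>)\<^sup>2)) = expect_on M A (\<lambda>\<omega>. ennreal ((\<Xi> \<omega>)\<^sup>2))"
    using U_T by (intro nn_integral_cong_AE) (auto elim!: eventually_mono)
  have le: "x \<le> ennreal stability_const * (x + y + z) + v" for x y z v :: ennreal
  proof -
    have "1 \<le> exp (\<beta> * (T + u))" using \<beta>(1) Tu by simp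
    then have "1 \<le> stability_const" unfolding stability_const_def by linarith
    then have "1 \<le> ennreal stability_const" using ennreal_leI[of 1 stability_const] by simp
    moreover have "x \<le> x + y + z" unfolding add.assoc by (rule add_increasing2) auto
    ultimately have "1 * x \<le> ennreal stability_const * (x + y + z)" by (rule mult_mono) auto
    then show ?thesis by (simp add: add_increasing2)
  qed
  have "expect_on M A (\<lambda>\<omega>. \<integral>\<^sup>+s\<in>{T..T}. ennreal (w s \<omega>) \<partial>lborel) = 0"
    unfolding empty by simp
  then show ?thesis unfolding tT UXi by (simp only: add_0_right le)
qed

text \<open>
  The last term needs no conditioning because the past of \<open>t\<close> is known at time \<open>t\<close>.
\<close>

lemma conditional_estimate:
  assumes t: "t \<in> {0..T}"
  shows "AE \<omega> in M. ennreal ((U t \<omega>)\<^sup>2) + nn_cond_exp M (F t) (\<lambda>\<omega>. \<integral>\<^sup>+s\<in>{t..T}. ennreal (w s \<omega>) \<partial>lborel) \<omega>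
    \<le> ennreal stability_const * nn_cond_exp M (F t) (\<lambda>\<omega>. ennreal ((\<Xi> \<omega>)\<^sup>2) + (\<integral>\<^sup>+s\<in>{t..T}. ennreal ((P s \<omega>)\<^sup>2) \<partial>lborel)
        + (\<integral>\<^sup>+s\<in>{T..T + u}. ennreal (w\<xi> s \<omega>) \<partial>lborel)) \<omega>
      + ennreal stability_const * (\<integral>\<^sup>+s\<in>{t - l..t}. ennreal (w s \<omega>) \<partial>lborel)"
proof -
  interpret sub: finite_measure_subalgebra M "F t"
    by unfold_locales (rule subalgebra_F)
  define X1 where "X1 \<omega> = (\<integral>\<^sup>+s\<in>{t..T}. ennreal (w s \<omega>) \<partial>lborel)" for \<omega>
  define X2 where "X2 \<omega> = ennreal ((\<Xi> \<omega>)\<^sup>2) + (\<integral>\<^sup>+s\<in>{t..T}. ennreal ((P s \<omega>)\<^sup>2) \<partial>lborel)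
        + (\<integral>\<^sup>+s\<in>{T..T + u}. ennreal (w\<xi> s \<omega>) \<partial>lborel)" for \<omega>
  define X3 where "X3 \<omega> = (\<integral>\<^sup>+s\<in>{t - l..t}. ennreal (w s \<omega>) \<partial>lborel)" for \<omega>
  have X1m [measurable]: "X1 \<in> borel_measurable M" unfolding X1_def[abs_def] by measurable
  have X2m [measurable]: "X2 \<in> borel_measurable M" unfolding X2_def[abs_def] by measurable
  have X3m [measurable]: "X3 \<in> borel_measurable M" unfolding X3_def[abs_def] by measurable
  have X3F: "X3 \<in> borel_measurable (F t)"
  proof -
    have t': "t \<in> {0..T + u}" using t u by auto
    note m = regular_solution[THEN version_measurable_F, OF t']
    define a where "a r \<omega> = indicator {..t} r *\<^sub>R version' Y r \<omega>" for r \<omega>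
    define a' where "a' r \<omega> = indicator {..t} r *\<^sub>R version' Y' r \<omega>" for r \<omega>
    define b where "b r \<omega> = indicator {..t} r *\<^sub>R version' Z r \<omega>" for r \<omega>
    define b' where "b' r \<omega> = indicator {..t} r *\<^sub>R version' Z' r \<omega>" for r \<omega>
    have [measurable]: "case_prod a \<in> borel_measurable (lborel \<Otimes>\<^sub>M F t)" "case_prod a' \<in> borel_measurable (lborel \<Otimes>\<^sub>M F t)"
      "case_prod b \<in> borel_measurable (lborel \<Otimes>\<^sub>M F t)" "case_prod b' \<in> borel_measurable (lborel \<Otimes>\<^sub>M F t)"
      using m by (simp_all add: a_def[abs_def] b_def[abs_def] a'_def[abs_def] b'_def[abs_def])
    have "(\<lambda>\<omega>. \<integral>\<^sup>+s\<in>{t - l..t}. ennreal ((a s \<omega> - a' s \<omega>)\<^sup>2 + (norm (b s \<omega> - b' s \<omega>))\<^sup>2) \<partial>lborel) \<in> borel_measurable (F t)"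
      by measurable
    also have "(\<lambda>\<omega>. \<integral>\<^sup>+s\<in>{t - l..t}. ennreal ((a s \<omega> - a' s \<omega>)\<^sup>2 + (norm (b s \<omega> - b' s \<omega>))\<^sup>2) \<partial>lborel) = X3"
      unfolding X3_def by (intro ext nn_integral_cong) (auto simp: a_def b_def a'_def b'_def w_def U_def V_def indicator_def)
    finally show ?thesis .
  qed
  have UF: "(\<lambda>\<omega>. ennreal ((U t \<omega>)\<^sup>2)) \<in> borel_measurable (F t)"
    using adapted(1)[OF t] by (intro measurable_compose[OF _ measurable_ennreal] borel_measurable_power)
  have [measurable]: "(\<lambda>\<omega>. ennreal ((U t \<omega>)\<^sup>2)) \<in> borel_measurable M" by measurable
  have test: "expect_on M A (\<lambda>\<omega>. nn_cond_exp M (F t) X \<omega>) = expect_on M A X"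
    if "A \<in> sets (F t)" "X \<in> borel_measurable M" for A X
    using that by (intro sub.nn_cond_exp_intg borel_measurable_indicator)
  have "AE \<omega> in M. ennreal ((U t \<omega>)\<^sup>2) + nn_cond_exp M (F t) X1 \<omega> \<le> ennreal stability_const * nn_cond_exp M (F t) X2 \<omega> + ennreal stability_const * X3 \<omega>"
  proof (rule sub.AE_le_of_tests)
    show "(\<lambda>\<omega>. ennreal ((U t \<omega>)\<^sup>2) + nn_cond_exp M (F t) X1 \<omega>) \<in> borel_measurable (F t)"
      by (intro borel_measurable_add UF borel_measurable_nn_cond_exp)
    show "(\<lambda>\<omega>. ennreal stability_const * nn_cond_exp M (F t) X2 \<omega> + ennreal stability_const * X3 \<omega>) \<in> borel_measurable (F t)"
      using X3F by measurable
  next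
    fix A assume A: "A \<in> sets (F t)"
    then have [measurable]: "A \<in> sets M" using sets_F_subset by auto
    have "expect_on M A (\<lambda>\<omega>. ennreal ((U t \<omega>)\<^sup>2) + nn_cond_exp M (F t) X1 \<omega>) =
        (expect_on M A (\<lambda>\<omega>. ennreal ((U t \<omega>)\<^sup>2))) + expect_on M A X1"
      unfolding distrib_left test[OF A X1m, symmetric] by (rule nn_integral_add) measurable
    also have "\<dots> \<le> ennreal stability_const * expect_on M A X2 + ennreal stability_const * expect_on M A X3"
    proof -
      have "expect_on M A X2 = expect_on M A (\<lambda>\<omega>. ennreal ((\<Xi> \<omega>)\<^sup>2))
        + expect_on M A (\<lambda>\<omega>. \<integral>\<^sup>+s\<in>{t..T}. ennreal ((P s \<omega>)\<^sup>2) \<partial>lborel)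
        + expect_on M A (\<lambda>\<omega>. \<integral>\<^sup>+s\<in>{T..T + u}. ennreal (w\<xi> s \<omega>) \<partial>lborel)"
        unfolding X2_def distrib_left by (simp add: nn_integral_add)
      then show ?thesis using tested_estimate[OF t A] unfolding X1_def X3_def by simp
    qed
    also have "\<dots> = expect_on M A (\<lambda>\<omega>. ennreal stability_const * nn_cond_exp M (F t) X2 \<omega> + ennreal stability_const * X3 \<omega>)"
      unfolding test[OF A X2m, symmetric]
      by (simp add: distrib_left nn_integral_add nn_integral_cmult mult.left_commute[of "indicator A _"])
    finally show "expect_on M A (\<lambda>\<omega>. ennreal ((U t \<omega>)\<^sup>2) + nn_cond_exp M (F t) X1 \<omega>)
      \<le> expect_on M A (\<lambda>\<omega>. ennreal stability_const * nn_cond_exp M (F t) X2 \<omega> + ennreal stability_const * X3 \<omega>)" .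
  next
    have top: "space M \<in> sets (F t)" using sets.top[of "F t"] by simp
    have "(\<integral>\<^sup>+\<omega>. X2 \<omega> \<partial>M) < \<infinity>"
    proof -
      have 1: "(\<integral>\<^sup>+\<omega>. ennreal ((\<Xi> \<omega>)\<^sup>2) \<partial>M) < \<infinity>"
        using \<Xi>_square_integrable by (simp add: integrable_iff_bounded)
      have "(\<integral>\<^sup>+\<omega>. (\<integral>\<^sup>+s\<in>{t..T}. ennreal ((P s \<omega>)\<^sup>2) \<partial>lborel) \<partial>M) \<le> (\<integral>\<^sup>+\<omega>. (\<integral>\<^sup>+s. ennreal ((P s \<omega>)\<^sup>2) \<partial>lborel) \<partial>M)"
        by (intro nn_integral_mono) (auto simp: indicator_def)
      then have 2: "(\<integral>\<^sup>+\<omega>. (\<integral>\<^sup>+s\<in>{t..T}. ennreal ((P s \<omega>)\<^sup>2) \<partial>lborel) \<partial>M) < \<infinity>"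
        using squares_finite(8) by (rule order_le_less_trans)
      have "(\<integral>\<^sup>+\<omega>. (\<integral>\<^sup>+s\<in>{T..T + u}. ennreal (w\<xi> s \<omega>) \<partial>lborel) \<partial>M) =
          (\<integral>\<^sup>+\<omega>. indicator (space M) \<omega> * (\<integral>\<^sup>+s\<in>{T..T + u}. ennreal (w\<xi> s \<omega>) \<partial>lborel) \<partial>M)"
        by (intro nn_integral_cong) simp
      also have "\<dots> = (\<integral>\<^sup>+s\<in>{T..T + u}. (\<integral>\<^sup>+\<omega>. indicator (space M) \<omega> * ennreal (w\<xi> s \<omega>) \<partial>M) \<partial>lborel)"
        by (rule tested_swap) measurable
      also have "\<dots> = (\<integral>\<^sup>+s\<in>{T..T + u}. (\<integral>\<^sup>+\<omega>. indicator (space M) \<omega> * ennreal (w s \<omega>) \<partial>M) \<partial>lborel)"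
      proof (rule nn_integral_cong)
        fix s
        show "(\<integral>\<^sup>+\<omega>. indicator (space M) \<omega> * ennreal (w\<xi> s \<omega>) \<partial>M) * indicator {T..T + u} s =
            (\<integral>\<^sup>+\<omega>. indicator (space M) \<omega> * ennreal (w s \<omega>) \<partial>M) * indicator {T..T + u} s"
        proof (cases "s \<in> {T..T + u}")
          case True
          have "(\<integral>\<^sup>+\<omega>. indicator (space M) \<omega> * ennreal (w\<xi> s \<omega>) \<partial>M) = (\<integral>\<^sup>+\<omega>. indicator (space M) \<omega> * ennreal (w s \<omega>) \<partial>M)"
            using w_terminal[OF True] by (intro nn_integral_cong_AE) (auto elim!: eventually_mono)
          then show ?thesis by simp
        qed simp
      qed
      also have "\<dots> = (\<integral>\<^sup>+\<omega>. indicator (space M) \<omega> * (\<integral>\<^sup>+s\<in>{T..T + u}. ennreal (w s \<omega>) \<partial>lborel) \<partial>M)"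
        by (rule tested_swap[symmetric]) measurable
      also have "\<dots> \<le> dint M w"
        by (intro nn_integral_mono) (auto simp: indicator_def intro!: nn_integral_mono)
      also have "\<dots> < \<infinity>" by (rule w_finite)
      finally have 3: "(\<integral>\<^sup>+\<omega>. (\<integral>\<^sup>+s\<in>{T..T + u}. ennreal (w\<xi> s \<omega>) \<partial>lborel) \<partial>M) < \<infinity>" .
      show ?thesis unfolding X2_def using 1 2 3 by (simp add: nn_integral_add)
    qed
    moreover have "(\<integral>\<^sup>+\<omega>. X3 \<omega> \<partial>M) < \<infinity>"
    proof -
      have "(\<integral>\<^sup>+\<omega>. X3 \<omega> \<partial>M) \<le> dint M w"
        unfolding X3_def by (intro nn_integral_mono) (auto simp: indicator_def)
      then show ?thesis using w_finite by (rule order_le_less_trans)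
    qed
    moreover have "(\<integral>\<^sup>+\<omega>. nn_cond_exp M (F t) X2 \<omega> \<partial>M) = (\<integral>\<^sup>+\<omega>. X2 \<omega> \<partial>M)"
      using test[OF top X2m] by (simp cong: nn_integral_cong)
    ultimately show "(\<integral>\<^sup>+\<omega>. ennreal stability_const * nn_cond_exp M (F t) X2 \<omega> + ennreal stability_const * X3 \<omega> \<partial>M) < \<infinity>"
      by (simp add: nn_integral_add nn_integral_cmult ennreal_mult_less_top)
  qed
  then show ?thesis unfolding X1_def[abs_def] X2_def[abs_def] X3_def .
qed

lemma stability:
  assumes t: "t \<in> {0..T}"
  shows "AE \<omega> in M.
       ennreal (\<bar>Y t \<omega> - Y' t \<omega>\<bar>\<^sup>2) +
       nn_cond_exp M (F t)
         (\<lambda>\<omega>. \<integral>\<^sup>+s\<in>{t..T}. ennreal (\<bar>Y s \<omega> - Y' s \<omega>\<bar>\<^sup>2 + (norm (Z s \<omega> - Z' s \<omega>))\<^sup>2) \<partial>lborel) \<omega>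
       \<le> ennreal stability_const * nn_cond_exp M (F t)
         (\<lambda>\<omega>. ennreal (\<bar>\<xi> T \<omega> - \<xi>' T \<omega>\<bar>\<^sup>2) +
              (\<integral>\<^sup>+s\<in>{t..T}. ennreal (\<bar>\<phi> s \<omega> - \<phi>' s \<omega>\<bar>\<^sup>2) \<partial>lborel) +
              (\<integral>\<^sup>+s\<in>{T..T + u}. ennreal (\<bar>\<xi> s \<omega> - \<xi>' s \<omega>\<bar>\<^sup>2 + (norm (\<eta> s \<omega> - \<eta>' s \<omega>))\<^sup>2) \<partial>lborel)) \<omega> +
         ennreal stability_const *
         (\<integral>\<^sup>+s\<in>{t - l..t}. ennreal (\<bar>Y s \<omega> - Y' s \<omega>\<bar>\<^sup>2 + (norm (Z s \<omega> - Z' s \<omega>))\<^sup>2) \<partial>lborel)"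
proof -
  have 1: "(\<integral>\<^sup>+s\<in>{t..T}. ennreal (\<bar>Y s \<omega> - Y' s \<omega>\<bar>\<^sup>2 + (norm (Z s \<omega> - Z' s \<omega>))\<^sup>2) \<partial>lborel) = (\<integral>\<^sup>+s\<in>{t..T}. ennreal (w s \<omega>) \<partial>lborel)" for \<omega>
    using t u by (intro nn_integral_cong) (auto simp: w_def U_def V_def version_eq indicator_def)
  have 2: "(\<integral>\<^sup>+s\<in>{t..T}. ennreal (\<bar>\<phi> s \<omega> - \<phi>' s \<omega>\<bar>\<^sup>2) \<partial>lborel) = (\<integral>\<^sup>+s\<in>{t..T}. ennreal ((P s \<omega>)\<^sup>2) \<partial>lborel)" for \<omega>
    using t by (intro nn_integral_cong) (auto simp: P_def \<phi>h_def \<phi>h'_def indicator_def)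
  have 3: "(\<integral>\<^sup>+s\<in>{T..T + u}. ennreal (\<bar>\<xi> s \<omega> - \<xi>' s \<omega>\<bar>\<^sup>2 + (norm (\<eta> s \<omega> - \<eta>' s \<omega>))\<^sup>2) \<partial>lborel) = (\<integral>\<^sup>+s\<in>{T..T + u}. ennreal (w\<xi> s \<omega>) \<partial>lborel)" for \<omega>
    by (intro nn_integral_cong) (auto simp: w\<xi>_def indicator_def)
  have 4: "\<bar>Y t \<omega> - Y' t \<omega>\<bar>\<^sup>2 = (U t \<omega>)\<^sup>2" for \<omega> using t u by (simp add: U_def version_eq)
  show ?thesis
    unfolding 1 2 3 4
    using conditional_estimate[OF t] version_AE_eq[OF regular_solution(1)] version_AE_eq[OF regular_solution(2)]
      version_AE_eq[OF regular_solution(3)] version_AE_eq[OF regular_solution(4)]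
  proof eventually_elim
    case (elim \<omega>)
    have "(\<integral>\<^sup>+s\<in>{t - l..t}. ennreal (\<bar>Y s \<omega> - Y' s \<omega>\<bar>\<^sup>2 + (norm (Z s \<omega> - Z' s \<omega>))\<^sup>2) \<partial>lborel) = (\<integral>\<^sup>+s\<in>{t - l..t}. ennreal (w s \<omega>) \<partial>lborel)"
    proof (rule nn_integral_cong)
      fix s
      show "ennreal (\<bar>Y s \<omega> - Y' s \<omega>\<bar>\<^sup>2 + (norm (Z s \<omega> - Z' s \<omega>))\<^sup>2) * indicator {t - l..t} s = ennreal (w s \<omega>) * indicator {t - l..t} s"
      proof (cases "s \<in> {t - l..t}")
        case True
        then have "s \<in> {-l..T + u}" using t u by auto
        then show ?thesis using elim(2-5) by (simp add: w_def U_def V_def)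
      qed simp
    qed
    then show ?case using elim(1) by (simp add: \<Xi>_def)
  qed
qed

end

theorem proposition2p5:
  fixes T l u K :: real
  assumes "T > 0" and "l \<ge> 0" and "u \<ge> 0" and "K > 0"
    and "\<exists>\<beta>\<ge>2. 8 * K\<^sup>2 * exp (\<beta> * l) / \<beta> \<le> 1"
  shows "\<exists>C>0. \<forall>(M :: 'a measure) (B :: real \<Rightarrow> 'a \<Rightarrow> real ^ 'd)
      (\<xi> :: real \<Rightarrow> 'a \<Rightarrow> real) (\<xi>' :: real \<Rightarrow> 'a \<Rightarrow> real)
      (\<eta> :: real \<Rightarrow> 'a \<Rightarrow> real ^ 'd) (\<eta>' :: real \<Rightarrow> 'a \<Rightarrow> real ^ 'd)
      (\<phi> :: real \<Rightarrow> 'a \<Rightarrow> real) (\<phi>' :: real \<Rightarrow> 'a \<Rightarrow> real)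
      (g :: real \<Rightarrow> (real \<Rightarrow> 'a \<Rightarrow> real) \<Rightarrow> (real \<Rightarrow> 'a \<Rightarrow> real ^ 'd) \<Rightarrow> 'a \<Rightarrow> real)
      (lam :: real measure)
      (Y :: real \<Rightarrow> 'a \<Rightarrow> real) (Z :: real \<Rightarrow> 'a \<Rightarrow> real ^ 'd)
      (Y' :: real \<Rightarrow> 'a \<Rightarrow> real) (Z' :: real \<Rightarrow> 'a \<Rightarrow> real ^ 'd).
    prob_space M \<longrightarrow> complete_measure M \<longrightarrow> brownian_motion M B \<longrightarrow>
    \<xi> \<in> L2_process M B T (T + u) \<longrightarrow> \<xi>' \<in> L2_process M B T (T + u) \<longrightarrow>
    \<eta> \<in> L2_process M B T (T + u) \<longrightarrow> \<eta>' \<in> L2_process M B T (T + u) \<longrightarrow>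
    \<xi> T \<in> L2_rv M B T \<longrightarrow> \<xi>' T \<in> L2_rv M B T \<longrightarrow>
    \<phi> \<in> L2_process M B 0 T \<longrightarrow> \<phi>' \<in> L2_process M B 0 T \<longrightarrow>
    (\<forall>y\<in>L2_bar M B l (T + u). \<forall>z\<in>L2_bar M B l (T + u).
       prog_measurable M B 0 T (\<lambda>t. g t y z)) \<longrightarrow>
    (\<lambda>t. g t (\<lambda>_ _. 0) (\<lambda>_ _. 0)) \<in> L2_process M B 0 T \<longrightarrow>
    prob_space lam \<longrightarrow> sets lam = sets (restrict_space borel {-l..u}) \<longrightarrow>
    lipschitz_coefficient M B T l u K lam g \<longrightarrow>
    bsde_solution M B T l u (\<lambda>t y z \<omega>. g t y z \<omega> + \<phi> t \<omega>) \<xi> \<eta> Y Z \<longrightarrow>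
    bsde_solution M B T l u (\<lambda>t y z \<omega>. g t y z \<omega> + \<phi>' t \<omega>) \<xi>' \<eta>' Y' Z' \<longrightarrow>
    (\<forall>t\<in>{0..T}. AE \<omega> in M.
       ennreal (\<bar>Y t \<omega> - Y' t \<omega>\<bar>\<^sup>2) +
       nn_cond_exp M (brownian_filtration M B t)
         (\<lambda>\<omega>. \<integral>\<^sup>+s\<in>{t..T}. ennreal (\<bar>Y s \<omega> - Y' s \<omega>\<bar>\<^sup>2 + (norm (Z s \<omega> - Z' s \<omega>))\<^sup>2) \<partial>lborel) \<omega>
       \<le> ennreal C * nn_cond_exp M (brownian_filtration M B t)
         (\<lambda>\<omega>. ennreal (\<bar>\<xi> T \<omega> - \<xi>' T \<omega>\<bar>\<^sup>2) +
              (\<integral>\<^sup>+s\<in>{t..T}. ennreal (\<bar>\<phi> s \<omega> - \<phi>' s \<omega>\<bar>\<^sup>2) \<partial>lborel) +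
              (\<integral>\<^sup>+s\<in>{T..T + u}. ennreal (\<bar>\<xi> s \<omega> - \<xi>' s \<omega>\<bar>\<^sup>2 + (norm (\<eta> s \<omega> - \<eta>' s \<omega>))\<^sup>2) \<partial>lborel)) \<omega> +
         ennreal C *
         (\<integral>\<^sup>+s\<in>{t - l..t}. ennreal (\<bar>Y s \<omega> - Y' s \<omega>\<bar>\<^sup>2 + (norm (Z s \<omega> - Z' s \<omega>))\<^sup>2) \<partial>lborel))"
proof -
  obtain \<beta> where \<beta>: "2 \<le> \<beta>" "8 * K\<^sup>2 * exp (\<beta> * l) / \<beta> \<le> 1" using assms(5) by blast
  show ?thesis
  proof (rule exI[of _ "16 * exp (\<beta> * (T + u))"], intro conjI allI impI, goal_cases)
    case (2 M B \<xi> \<xi>' \<eta> \<eta>' \<phi> \<phi>' g lam Y Z Y' Z')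
    interpret bsde_pair M B T l u K \<beta> \<xi> \<xi>' \<eta> \<eta>' \<phi> \<phi>' g lam Y Y' Z Z'
      by (intro bsde_pair.intro brownian.intro brownian_axioms.intro bsde_pair_axioms.intro)
        (rule 2 assms \<beta> | use 2 in blast)+
    show ?case by (rule ballI, rule stability[unfolded stability_const_def])
  qed simp
qed

end
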